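(* For each integer $d\ge 3$, there exists a post-critically finite complex polynomial $f$ of degree $d$ which is dynamically exceptional with $\#E=1$, i.e. there is a one-element set $E\subseteq\mathbb{P}^1(\mathbb{C})$ with $f^{-1}(E)\setminus C_f=E$, such that $$\mathrm{FPP}(\mathrm{IMG}(f))=0.$$
   Context: Let $f:\mathbb{P}^1(\mathbb{C})\to\mathbb{P}^1(\mathbb{C})$ be a complex polynomial of degree $d\ge2$. $e_f(z)$ denotes the local degree (ramification index) of $f$ at $z$; $C_f=\{z\in\mathbb{P}^1(\mathbb{C}): e_f(z)>1\}$ is the set of critical points (it contains $\infty$). The post-critical set is $P_f=\{f^n(c): c\in C_f,\ n\ge1\}$, where $f^n$ is the $n$-th iterate; $f$ is post-critically finite if $P_f$ is finite. A post-critically finite polynomial $f$ is dynamically exceptional if there is a non-empty set $E\subseteq\mathbb{P}^1(\mathbb{C})$ with $f^{-1}(E)\setminus C_f=E$. Iterated monodromy group. Let $f$ be post-critically finite of degree $d$ and let $t\in\mathbb{P}^1(\mathbb{C})\setminus P_f$. Each $f^n:\mathbb{P}^1(\mathbb{C})\setminus f^{-n}(P_f)\to\mathbb{P}^1(\mathbb{C})\setminus P_f$ is an unramified covering of degree $d^n$, so $\pi_1(\mathbb{P}^1(\mathbb{C})\setminus P_f,t)$ acts on $f^{-n}(t)$ by path lifting: the class of a loop $\gamma$ sends $\tilde t\in f^{-n}(t)$ to the endpoint of the unique $f^n$-lift of $\gamma$ starting at $\tilde t$. The disjoint union $\bigsqcup_{n\ge0}f^{-n}(t)$ is a $d$-regular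 rooted tree $T$ with root $t$, in which $w\in f^{-(n+1)}(t)$ is a child of $f(w)\in f^{-n}(t)$, and the actions on the levels together form an action on $T$ by automorphisms. $\mathrm{IMG}(f)\le\mathrm{Aut}(T)$ is the quotient of $\pi_1(\mathbb{P}^1(\mathbb{C})\setminus P_f,t)$ by the kernel of this action (equivalently, its image in $\mathrm{Aut}(T)$); up to conjugation by tree isomorphisms it does not depend on $t$. Fixed-point proportion. For a $d$-regular rooted tree $T$ with $n$-th level $\mathcal{L}_n$ (vertices at distance $n$ from the root), let $\pi_n:\mathrm{Aut}(T)\to\mathrm{Aut}(T^n)$ be restriction to the finite subtree $T^n$ of vertices at distance at most $n$ from the root. For $G\le\mathrm{Aut}(T)$, $$\mathrm{FPP}(G)=\lim_{n\to\infty}\frac{\#\{g\in\pi_n(G): g\text{ fixes a vertex in }\mathcal{L}_n\}}{|\pi_n(G)|}$$ (the limit always exists). *)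

theory Defs
  imports "HOL-Complex_Analysis.Complex_Analysis"
begin

section \<open>Polynomials on the Riemann sphere\<close>

text \<open>The sphere is the one-point compactification of the plane; \<^term>\<open>None\<close> is the point at infinity.\<close>

type_synonym sphere_point = "complex option"

definition riemann_sphere :: "sphere_point topology" where
  "riemann_sphere = Alexandroff_compactification euclidean"

text \<open>For a non-constant polynomial this is its holomorphic extension to the sphere; all
  polynomials considered below have degree at least 2.\<close>

definition sphere_map :: "complex poly \<Rightarrow> sphere_point \<Rightarrow> sphere_point" where
  "sphere_map p = map_option (poly p)"

text \<open>At a finite point the local degree is the multiplicity of \<open>z\<close> as a root of
  \<open>p - p(z)\<close>. At infinity, which is fixed, it is the vanishing order at \<open>0\<close> of
  \<open>p\<close> read in the coordinate \<open>w = 1/z\<close>.\<close>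

definition local_degree :: "complex poly \<Rightarrow> sphere_point \<Rightarrow> nat" where
  "local_degree p x =
     (case x of
        Some z \<Rightarrow> order z (p - [:poly p z:])
      | None \<Rightarrow> nat (zorder (\<lambda>w. inverse (poly p (inverse w))) 0))"

definition critical_points :: "complex poly \<Rightarrow> sphere_point set" where
  "critical_points p = {x. local_degree p x > 1}"

definition post_critical_set :: "complex poly \<Rightarrow> sphere_point set" where
  "post_critical_set p = {(sphere_map p ^^ n) c | c n. c \<in> critical_points p \<and> n \<ge> 1}"

definition post_critically_finite :: "complex poly \<Rightarrow> bool" where
  "post_critically_finite p \<longleftrightarrow> finite (post_critical_set p)"

definition exceptional_set :: "complex poly \<Rightarrow> sphere_point set \<Rightarrow> bool" where
  "exceptional_set p E \<longleftrightarrow> E \<noteq> {} \<and> sphere_map p -` E - critical_points p = E"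

lemma local_degree_infinity:
  assumes "degree p \<ge> 1"
  shows "local_degree p None = degree p"
proof -
  let ?q = "reflect_poly p"
  have p0: "p \<noteq> 0" using assms by auto
  have "open (poly ?q -` (- {0}))"
    by (intro open_vimage continuous_intros)
  moreover have "(\<lambda>w. inverse (poly ?q w)) holomorphic_on poly ?q -` (- {0})"
    by (intro holomorphic_intros) auto
  moreover have "inverse (poly p (inverse w)) = inverse (poly ?q w) * (w - 0) powi int (degree p)"
    if "w \<noteq> 0" for w
    using that by (simp add: poly_reflect_poly_nz field_simps)
  ultimately have "zorder (\<lambda>w. inverse (poly p (inverse w))) 0 = int (degree p)"
    using p0 by (intro zorder_eqI[where S = "poly ?q -` (- {0})"
        and g = "\<lambda>w. inverse (poly ?q w)"]) auto
  then show ?thesis by (simp add: local_degree_def)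
qed

lemma infinity_in_critical_points: "degree p \<ge> 2 \<Longrightarrow> None \<in> critical_points p"
  by (simp add: critical_points_def local_degree_infinity)

lemma infinity_in_post_critical_set:
  assumes "degree p \<ge> 2"
  shows "None \<in> post_critical_set p"
proof -
  have "None = (sphere_map p ^^ 1) None" by (simp add: sphere_map_def)
  then show ?thesis
    using infinity_in_critical_points[OF assms] unfolding post_critical_set_def by blast
qed

section \<open>Rooted trees and the fixed-point proportion\<close>

text \<open>A rooted tree is given by its vertices, its root and the map sending each non-root vertex
  to its parent; the value of \<open>parent\<close> at the root plays no role.\<close>

record 'v rooted_tree =
  verts :: "'v set"
  root :: 'v
  parent :: "'v \<Rightarrow> 'v"

definition depth :: "'v rooted_tree \<Rightarrow> 'v \<Rightarrow> nat" where
  "depth T v = (LEAST n. (parent T ^^ n) v = root T)"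

definition level :: "'v rooted_tree \<Rightarrow> nat \<Rightarrow> 'v set" where
  "level T n = {v \<in> verts T. depth T v = n}"

definition truncation :: "'v rooted_tree \<Rightarrow> nat \<Rightarrow> 'v set" where
  "truncation T n = {v \<in> verts T. depth T v \<le> n}"

text \<open>The image of a set of automorphisms under restriction to the finite subtree of depth \<open>n\<close>.\<close>

definition restricted_to_level ::
    "'v rooted_tree \<Rightarrow> nat \<Rightarrow> ('v \<Rightarrow> 'v) set \<Rightarrow> ('v \<Rightarrow> 'v) set" where
  "restricted_to_level T n G = (\<lambda>g. restrict g (truncation T n)) ` G"

definition FPP :: "'v rooted_tree \<Rightarrow> ('v \<Rightarrow> 'v) set \<Rightarrow> real" where
  "FPP T G = lim (\<lambda>n.
     real (card {g \<in> restricted_to_level T n G. \<exists>v \<in> level T n. g v = v}) /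
     real (card (restricted_to_level T n G)))"

section \<open>The iterated monodromy group\<close>

text \<open>The disjoint union of the iterated preimages of \<open>t\<close>: the pair \<open>(n, w)\<close> is the point
  \<open>w\<close> of the \<open>n\<close>-th preimage.\<close>

definition preimage_tree ::
    "complex poly \<Rightarrow> sphere_point \<Rightarrow> (nat \<times> sphere_point) rooted_tree" where
  "preimage_tree p t =
     \<lparr>verts = {(n, w). (sphere_map p ^^ n) w = t},
      root = (0, t),
      parent = (\<lambda>(n, w). (n - 1, sphere_map p w))\<rparr>"

lemma level_preimage_tree:
  "level (preimage_tree p t) n = {n} \<times> {w. (sphere_map p ^^ n) w = t}"
proof -
  have iter: "(parent (preimage_tree p t) ^^ k) (m, w) = (m - k, (sphere_map p ^^ k) w)" for k m w
    by (induction k) (auto simp: preimage_tree_def)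
  have "depth (preimage_tree p t) (m, w) = m" if "(sphere_map p ^^ m) w = t" for m w
    unfolding depth_def
  proof (rule Least_equality)
    show "(parent (preimage_tree p t) ^^ m) (m, w) = root (preimage_tree p t)"
      using that iter[of m m w] by (simp add: preimage_tree_def)
  next
    fix k assume "(parent (preimage_tree p t) ^^ k) (m, w) = root (preimage_tree p t)"
    then show "m \<le> k"
      unfolding iter by (simp add: preimage_tree_def)
  qed
  then show ?thesis
    by (auto simp: level_def) (auto simp: preimage_tree_def)
qed

definition loops_at :: "complex poly \<Rightarrow> sphere_point \<Rightarrow> (real \<Rightarrow> sphere_point) set" where
  "loops_at p t = {\<gamma>. pathin (subtopology riemann_sphere (- post_critical_set p)) \<gamma>
                       \<and> \<gamma> 0 = t \<and> \<gamma> 1 = t}"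

definition is_lift ::
    "complex poly \<Rightarrow> nat \<Rightarrow> (real \<Rightarrow> sphere_point) \<Rightarrow> (real \<Rightarrow> sphere_point) \<Rightarrow> bool" where
  "is_lift p n \<gamma> h \<longleftrightarrow>
     pathin (subtopology riemann_sphere (- ((sphere_map p ^^ n) -` post_critical_set p))) h
     \<and> (\<forall>s\<in>{0..1}. (sphere_map p ^^ n) (h s) = \<gamma> s)"

definition lift_endpoint ::
    "complex poly \<Rightarrow> nat \<Rightarrow> (real \<Rightarrow> sphere_point) \<Rightarrow> sphere_point \<Rightarrow> sphere_point" where
  "lift_endpoint p n \<gamma> w = (THE z. \<exists>h. is_lift p n \<gamma> h \<and> h 0 = w \<and> h 1 = z)"

definition monodromy ::
    "complex poly \<Rightarrow> sphere_point \<Rightarrow> (real \<Rightarrow> sphere_point) \<Rightarrow>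
     nat \<times> sphere_point \<Rightarrow> nat \<times> sphere_point" where
  "monodromy p t \<gamma> =
     restrict (\<lambda>(n, w). (n, lift_endpoint p n \<gamma> w)) (verts (preimage_tree p t))"

text \<open>The image of the fundamental group in the automorphism group of the tree. A class acts
  through any loop representing it, so this is the set of automorphisms induced by loops. It is
  the iterated monodromy group when \<open>p\<close> is post-critically finite of degree at least 2 and
  \<open>t\<close> lies outside the post-critical set.\<close>

definition IMG ::
    "complex poly \<Rightarrow> sphere_point \<Rightarrow> (nat \<times> sphere_point \<Rightarrow> nat \<times> sphere_point) set" where
  "IMG p t = monodromy p t ` loops_at p t"

end

theory Submission
  imports Defs "HOL-Computational_Algebra.Fundamental_Theorem_Algebra"
begin

text \<open>The polynomial is \<open>f(z) = l z (1 - z)\<^sup>d\<^sup>-\<^sup>1\<close> with \<open>l\<close> chosen such that the critical point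
  \<open>q = 1/d\<close> is fixed; the post-critical set is \<open>{0, q, \<infinity>}\<close> and \<open>E = {0}\<close>.

  A loop that runs to a small disc \<open>D\<close> around \<open>q\<close>, turns there around \<open>q\<close> and returns lifts under \<open>f\<close> to
  null-homotopic loops, except at the two children of the base point that are connected to \<open>q\<close>. Since
  \<open>D\<close> is forward invariant, each such loop at a child is a lift of one at its parent. If \<open>a\<close> and \<open>b\<close> are
  two of them, pushed down from the same child so that the other nontrivial sections sit at different
  children, then the commutator of \<open>a\<close> and \<open>b\<close> is supported below that child. Hence for every vertex
  \<open>v\<close> the commutators of such loops at \<open>v\<close> occur in the iterated monodromy group as elements supported
  below \<open>v\<close>. The group acts doubly transitively on the children of a vertex, so the loops include all
  transpositions of children and the commutators all three-cycles. With these, any group element can be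
  multiplied by an element supported below \<open>v\<close> so that no fixed point remains two levels below \<open>v\<close>.

  The number of fixed points on a level has mean 1. By the preceding paragraph, the elements with
  between 1 and \<open>M\<close> fixed points on level \<open>n\<close> lose, two levels further on, a fraction bounded below in
  terms of \<open>M\<close>. With Markov's inequality this forces the proportion with a fixed point to tend to 0.\<close>

section \<open>Polynomials as covering maps\<close>

text \<open>The obstacle is that a single loop around \<open>q\<close> cannot simply be placed below
  one vertex: f is two-to-one at \<open>q\<close>, so a loop pushed down from a child acts in
  general at a second child as well. Commutators cancel this unwanted action, and at least three
  children are needed to keep the two second children apart. The price is parity: a commutator
  permutes the children of a vertex evenly. If d = 3 and an element acts on the children of a fixed
  vertex as a transposition, every even correction is again a transposition and leaves a fixed
  child. This is why two levels are used: one level further down an odd permutation can be realised,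
  by a commutator with a loop that moves the vertex in between away.

  The group enters only through its action on fibres. Loops are concatenated, never multiplied in a
  fundamental group, and all identities are stated for endpoints of lifts.\<close>

lemma preimage_small_ball_subset:
  fixes f :: "complex \<Rightarrow> complex"
  assumes cont: "continuous_on UNIV f"
    and lim: "filterlim f at_infinity at_infinity"
    and "open U" "f -` {x} \<subseteq> U"
  obtains e where "e > 0" "f -` ball x e \<subseteq> U"
proof -
  have "\<forall>\<^sub>F z in at_infinity. norm x + 1 \<le> norm (f z)"
    using lim norm_ge_zero[of x] unfolding filterlim_at_infinity[of 0, OF order_refl]
    by (metis add_nonneg_pos zero_less_one)
  then obtain R where R: "\<And>z. R \<le> norm z \<Longrightarrow> norm x + 1 \<le> norm (f z)"
    by (auto simp: eventually_at_infinity)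
  \<comment> \<open>Large points have values far from \<open>x\<close>, and on the compact part
    outside \<open>U\<close> the closed image misses \<open>x\<close>; the two bounds together give
    the radius.\<close>
  let ?K = "cball 0 R - U"
  have "compact (f ` ?K)"
    by (intro compact_continuous_image compact_diff continuous_on_subset[OF cont])
      (auto simp: assms)
  then have "open (- (f ` ?K))" by (simp add: compact_imp_closed open_closed[symmetric] open_Compl)
  moreover have "x \<in> - (f ` ?K)" using assms(4) by auto
  ultimately obtain e where e: "e > 0" "ball x e \<subseteq> - (f ` ?K)"
    by (meson open_contains_ball)
  show ?thesis
  proof (rule that[of "min e 1"])
    show "f -` ball x (min e 1) \<subseteq> U"
    proof
      fix z assume z: "z \<in> f -` ball x (min e 1)"
      have "norm (f z) < norm x + 1"
        using z norm_triangle_ineq2[of "f z" x] by (auto simp: dist_norm norm_minus_commute)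
      then have "z \<in> cball 0 R" using R[of z] by force
      moreover have "f z \<notin> f ` ?K" using e z by auto
      ultimately show "z \<in> U" by blast
    qed
  qed (use e in auto)
qed

lemma holomorphic_on_poly:
  fixes p :: "complex poly"
  shows "poly p holomorphic_on A"
  using poly_holomorphic_on[of "\<lambda>z. z" A p] by (simp add: holomorphic_on_ident)

lemma poly_deriv_locally_injective:
  assumes "poly (pderiv p) z \<noteq> (0::complex)"
  obtains r where "r > 0" "inj_on (poly p) (ball z r)"
proof -
  have "deriv (poly p) z \<noteq> 0"
    using assms by (simp add: DERIV_imp_deriv[OF poly_DERIV])
  then show ?thesis
    using has_complex_derivative_locally_injective[of "poly p" UNIV z] that
    by (metis holomorphic_on_poly UNIV_I open_UNIV)
qed

text \<open>Asking for all radii up to a bound, not for one radius, makes the conditions survive the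
  passage to the minimum over \<open>Z\<close>.\<close>

lemma finite_common_radius:
  fixes Z :: "complex set"
  assumes "finite Z" "\<And>z. z \<in> Z \<Longrightarrow> \<exists>r>0. \<forall>s\<in>{0<..r}. P z s"
  obtains r :: real where "r > 0" "\<And>z s. z \<in> Z \<Longrightarrow> 0 < s \<Longrightarrow> s \<le> r \<Longrightarrow> P z s"
proof -
  from assms have "\<exists>r>0. \<forall>z\<in>Z. \<forall>s\<in>{0<..r}. P z s"
  proof (induction rule: finite_induct)
    case empty then show ?case by (auto intro: exI[of _ 1])
  next
    case (insert z Z)
    obtain r where r: "r > 0" "\<forall>z\<in>Z. \<forall>s\<in>{0<..r}. P z s" using insert.IH insert.prems by blast
    obtain r' where r': "r' > 0" "\<forall>s\<in>{0<..r'}. P z s" using insert.prems[of z] by blast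
    show ?case using r r' by (intro exI[of _ "min r r'"]) auto
  qed
  then obtain r where "r > 0" "\<forall>z\<in>Z. \<forall>s\<in>{0<..r}. P z s" by blast
  then show ?thesis by (intro that[of r]) auto
qed

lemma poly_fiber_neighbourhood:
  fixes p :: "complex poly"
  assumes "degree p > 0" "\<And>z. poly p z = x \<Longrightarrow> open (V z) \<and> z \<in> V z"
  obtains e where "e > 0" "poly p -` ball x e \<subseteq> (\<Union>z\<in>{z. poly p z = x}. V z)"
proof -
  have "continuous_on UNIV (poly p)" by (intro continuous_intros)
  moreover have "open (\<Union>z\<in>{z. poly p z = x}. V z)" using assms(2) by blast
  moreover have "poly p -` {x} \<subseteq> (\<Union>z\<in>{z. poly p z = x}. V z)" using assms(2) by fast
  ultimately obtain e where "e > 0" "poly p -` ball x e \<subseteq> (\<Union>z\<in>{z. poly p z = x}. V z)"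
    by (rule preimage_small_ball_subset[OF _ filterlim_poly_at_infinity[OF assms(1)]])
  then show ?thesis by (rule that)
qed

lemma finite_poly_fiber:
  fixes p :: "complex poly"
  assumes "degree p > 0"
  shows "finite {z. poly p z = x}"
proof -
  have "p - [:x:] \<noteq> 0" using assms by (metis degree_pCons_0 eq_iff_diff_eq_0 less_numeral_extra(3))
  from poly_roots_finite[OF this] show ?thesis by simp
qed

lemma surj_poly:
  fixes p :: "complex poly"
  assumes "degree p > 0"
  shows "\<exists>z. poly p z = x"
proof -
  have "degree (p + [:- x:]) > 0" using assms by (subst degree_add_eq_left) auto
  then show ?thesis using fundamental_theorem_of_algebra[of "p + [:- x:]"] constant_degree[of "p + [:- x:]"] by auto
qed

lemma finite_poly_vimage:
  fixes p :: "complex poly"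
  assumes "degree p > 0" "finite A"
  shows "finite (poly p -` A)"
proof -
  have "poly p -` A = (\<Union>x\<in>A. {z. poly p z = x})" by auto
  then show ?thesis using assms by (simp add: finite_poly_fiber)
qed

lemma image_Int_vimage: "g ` (A \<inter> g -` B) = g ` A \<inter> B"
  by auto

text \<open>Properness of a polynomial makes a small disc around a regular value evenly covered.\<close>

lemma covering_space_poly:
  fixes p :: "complex poly"
  assumes deg: "degree p > 0" and S: "open S"
    and reg: "\<And>z. poly p z \<in> S \<Longrightarrow> poly (pderiv p) z \<noteq> 0"
  shows "covering_space (poly p -` S) (poly p) S"
proof
  show "continuous_on (poly p -` S) (poly p)" by (intro continuous_intros)
  show "poly p ` (poly p -` S) = S" using surj_poly[OF deg] by (metis image_vimage_eq Int_absorb2 subsetI rangeI)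
next
  fix x assume x: "x \<in> S"
  let ?Z = "{z. poly p z = x}"
  have fin: "finite ?Z" by (rule finite_poly_fiber[OF deg])
  have opn: "open (poly p -` S)"
    using S by (intro open_vimage continuous_intros)
  have "\<exists>r>0. \<forall>s\<in>{0<..r}. inj_on (poly p) (ball z s) \<and> (\<forall>z'\<in>?Z. z' \<noteq> z \<longrightarrow> 2 * s \<le> dist z z')"
    if z: "z \<in> ?Z" for z
  proof -
    obtain r where r: "r > 0" "inj_on (poly p) (ball z r)"
      using reg[of z] z x poly_deriv_locally_injective by blast
    obtain d where d: "d > 0" "\<forall>z'\<in>?Z. z' \<noteq> z \<longrightarrow> d \<le> dist z z'"
      using finite_set_avoid[OF fin] by blast
    show ?thesis
      using r d by (intro exI[of _ "min r (d/2)"]) (force intro: inj_on_subset simp: subset_ball)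
  qed
  then obtain r where r: "r > 0"
    and r': "\<And>z s. z \<in> ?Z \<Longrightarrow> 0 < s \<Longrightarrow> s \<le> r \<Longrightarrow>
      inj_on (poly p) (ball z s) \<and> (\<forall>z'\<in>?Z. z' \<noteq> z \<longrightarrow> 2 * s \<le> dist z z')"
    by (rule finite_common_radius[OF fin, where P =
      "\<lambda>z s. inj_on (poly p) (ball z s) \<and> (\<forall>z'\<in>?Z. z' \<noteq> z \<longrightarrow> 2 * s \<le> dist z z')"]) blast+
  have inj: "inj_on (poly p) (ball z r)" if "z \<in> ?Z" for z using r'[OF that r] by blast
  have sep: "2 * r \<le> dist z z'" if "z \<in> ?Z" "z' \<in> ?Z" "z' \<noteq> z" for z z'
    using r'[OF that(1) r] that by blast
  obtain e where e: "e > 0" "poly p -` ball x e \<subseteq> (\<Union>z\<in>?Z. ball z r)"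
    using poly_fiber_neighbourhood[OF deg, of x "\<lambda>z. ball z r"] r by auto
  \<comment> \<open>Intersecting the images of all discs lets every sheet cover the same set
    \<open>N\<close>, which is open because the fibre is finite.\<close>
  define N where "N = S \<inter> ball x e \<inter> (\<Inter>z\<in>?Z. poly p ` ball z r)"
  have opim: "open (poly p ` U)" if "z \<in> ?Z" "open U" "U \<subseteq> ball z r" for z U
    using that inj by (intro open_mapping_thm3) (auto intro!: holomorphic_on_poly intro: inj_on_subset)
  have "open N" unfolding N_def using S fin opim by (intro open_Int open_INT) auto
  have "x \<in> N" unfolding N_def using x e r by (auto intro!: image_eqI[of x "poly p"])
  show "\<exists>T. x \<in> T \<and> openin (top_of_set S) T \<and>
     (\<exists>v. \<Union>v = poly p -` S \<inter> poly p -` T \<and> (\<forall>u\<in>v. openin (top_of_set (poly p -` S)) u) \<and>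
        pairwise disjnt v \<and> (\<forall>u\<in>v. \<exists>q. homeomorphism u T (poly p) q))"
  proof (intro exI[of _ N] exI[of _ "(\<lambda>z. ball z r \<inter> poly p -` N) ` ?Z"] conjI ballI)
    show "x \<in> N" by fact
    show "openin (top_of_set S) N" using \<open>open N\<close> by (intro open_openin_trans[OF S]) (auto simp: N_def)
    show "\<Union> ((\<lambda>z. ball z r \<inter> poly p -` N) ` ?Z) = poly p -` S \<inter> poly p -` N"
      using e by (auto simp: N_def)
    have opv: "open (poly p -` N)" using \<open>open N\<close> by (intro open_vimage continuous_intros)
    show "pairwise disjnt ((\<lambda>z. ball z r \<inter> poly p -` N) ` ?Z)"
    proof (rule pairwiseI)
      fix A B assume "A \<in> (\<lambda>z. ball z r \<inter> poly p -` N) ` ?Z" "B \<in> (\<lambda>z. ball z r \<inter> poly p -` N) ` ?Z"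
        and ne: "A \<noteq> B"
      then obtain z z' where z: "z \<in> ?Z" "A = ball z r \<inter> poly p -` N"
        and z': "z' \<in> ?Z" "B = ball z' r \<inter> poly p -` N" by blast
      have "2 * r \<le> dist z z'" using sep[OF z(1) z'(1)] ne z(2) z'(2) by auto
      then have "ball z r \<inter> ball z' r = {}" by (simp add: disjoint_ballI)
      then show "disjnt A B"
        using z z' by (auto simp: disjnt_def)
    qed
    fix u assume "u \<in> (\<lambda>z. ball z r \<inter> poly p -` N) ` ?Z"
    then obtain z where z: "z \<in> ?Z" "u = ball z r \<inter> poly p -` N" by auto
    then have "open u" using opv by auto
    then show "openin (top_of_set (poly p -` S)) u"
      using z by (intro open_openin_trans[OF opn]) (auto simp: N_def)
    have "N \<subseteq> poly p ` ball z r" using z by (auto simp: N_def)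
    then have "poly p ` u = N"
      unfolding z(2) by (simp add: image_Int_vimage Int_absorb1)
    moreover have "inj_on (poly p) u" using inj z by (auto intro: inj_on_subset)
    moreover have "openin (top_of_set N) (poly p ` U)" if "openin (top_of_set u) U" for U
    proof (rule open_openin_trans[OF \<open>open N\<close>])
      have "open U" using that \<open>open u\<close> openin_open_eq by blast
      then show "open (poly p ` U)" using opim[of z U] z openin_imp_subset[OF that] by auto
      show "poly p ` U \<subseteq> N" using openin_imp_subset[OF that] z by auto
    qed
    ultimately obtain q where "homeomorphism u N (poly p) q"
      using homeomorphism_injective_open_map[of u "poly p" N] continuous_on_poly[OF continuous_on_id, of u p]
      by (auto simp del: continuous_on_poly)
    then show "\<exists>q. homeomorphism u N (poly p) q" by blast
  qed
qed

section \<open>Lifting paths along iterates\<close>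

text \<open>The properties of the polynomial that the argument uses, free of its formula. Critical
  orbits in the plane end in \<open>0\<close> or \<open>q\<close>, and
  \<open>simple_critical\<close> makes \<open>f\<close> two-to-one at \<open>q\<close>, so that
  small loops around \<open>q\<close> move at most two points of a fibre.\<close>

locale exceptional_poly =
  fixes p :: "complex poly" and c q :: complex
  assumes degree_ge: "degree p \<ge> 3"
    and zeros: "poly p z = 0 \<longleftrightarrow> z = 0 \<or> z = c"
    and q_fixed: "poly p q = q"
    and nonzero: "c \<noteq> 0" "q \<noteq> 0"
    and critical: "poly (pderiv p) z = 0 \<longleftrightarrow> z = c \<or> z = q"
    and simple_critical: "poly (pderiv (pderiv p)) q \<noteq> 0"
begin

abbreviation "f \<equiv> poly p"

text \<open>The plane without the \<open>n\<close>-th preimages of the finite post-critical points,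
  covered without ramification over \<open>Om 0\<close> by \<open>f ^^ n\<close>.\<close>

definition Om :: "nat \<Rightarrow> complex set" where
  "Om n = (f ^^ n) -` (- {0, q})"

lemma Om_0: "Om 0 = - {0, q}" by (simp add: Om_def)

lemma mem_Om_add: "z \<in> Om (n + m) \<longleftrightarrow> (f ^^ m) z \<in> Om n"
  by (simp add: Om_def funpow_add)

lemma mem_Om_Suc: "z \<in> Om (Suc n) \<longleftrightarrow> f z \<in> Om n"
  using mem_Om_add[of z n 1] by simp

lemma funpow_fixed: "(f ^^ n) 0 = 0" "(f ^^ n) q = q"
  using zeros[of 0] q_fixed by (induction n) auto

text \<open>\<open>0\<close> and \<open>q\<close> are fixed, so an orbit that has reached one of
  them stays there.\<close>

lemma Om_antimono: "m \<le> n \<Longrightarrow> Om n \<subseteq> Om m"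
proof
  fix z assume "m \<le> n" "z \<in> Om n"
  then obtain k where "z \<in> Om (k + m)" by (metis le_Suc_ex add.commute)
  then have "(f ^^ m) z \<in> Om k" by (simp add: mem_Om_add)
  then have "(f ^^ m) z \<noteq> 0" "(f ^^ m) z \<noteq> q" using funpow_fixed by (auto simp: Om_def)
  then show "z \<in> Om m" by (simp add: Om_def)
qed

lemma Om_subset: "Om n \<subseteq> Om 0" by (simp add: Om_antimono)

text \<open>By the chain rule the orbit of a critical point of \<open>f ^^ n\<close> meets
  \<open>c\<close> or \<open>q\<close> before time \<open>n\<close>, so its \<open>n\<close>-th
  image is \<open>0\<close> or \<open>q\<close>.\<close>

lemma iterate_poly:
  obtains P where "poly P = f ^^ n" "degree P > 0"
    "\<And>z. z \<in> Om n \<Longrightarrow> poly (pderiv P) z \<noteq> 0"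
proof -
  have "\<exists>P. poly P = f ^^ n \<and> degree P > 0 \<and> (\<forall>z\<in>Om n. poly (pderiv P) z \<noteq> 0)"
  proof (induction n)
    case 0
    show ?case by (intro exI[of _ "[:0, 1:]"]) (auto simp: pderiv_pCons)
  next
    case (Suc n)
    then obtain P where P: "poly P = f ^^ n" "degree P > 0" "\<forall>z\<in>Om n. poly (pderiv P) z \<noteq> 0"
      by blast
    show ?case
    proof (intro exI[of _ "pcompose p P"] conjI ballI)
      show "poly (pcompose p P) = f ^^ Suc n" by (auto simp: poly_pcompose P)
      show "degree (pcompose p P) > 0" using P degree_ge by (simp add: degree_pcompose)
      fix z assume z: "z \<in> Om (Suc n)"
      have "f ((f ^^ n) z) \<noteq> 0" "f ((f ^^ n) z) \<noteq> q" using z by (auto simp: Om_def)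
      then have "(f ^^ n) z \<noteq> c" "(f ^^ n) z \<noteq> q" using zeros q_fixed by auto
      then show "poly (pderiv (pcompose p P)) z \<noteq> 0"
        using P z Om_antimono[of n "Suc n"] critical by (auto simp: pderiv_pcompose poly_pcompose)
    qed
  qed
  then show ?thesis using that by blast
qed

lemma continuous_on_iterate: "continuous_on A (f ^^ n)"
proof -
  obtain P where "poly P = f ^^ n" using iterate_poly by blast
  then show ?thesis using continuous_on_poly[OF continuous_on_id, of A P] by simp
qed

lemma covering_iterate: "covering_space (Om n) (f ^^ n) (Om 0)"
proof -
  obtain P where "poly P = f ^^ n" "degree P > 0" "\<And>z. z \<in> Om n \<Longrightarrow> poly (pderiv P) z \<noteq> 0"
    using iterate_poly by blast
  then show ?thesis
    using covering_space_poly[of P "Om 0"] by (simp add: Om_def open_Compl)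
qed

lemma surj_iterate: "\<exists>z. (f ^^ n) z = x"
proof -
  obtain P where "poly P = f ^^ n" "degree P > 0" using iterate_poly by blast
  then show ?thesis using surj_poly[of P] by simp
qed

lemma finite_iterate_vimage: "finite A \<Longrightarrow> finite ((f ^^ n) -` A)"
proof -
  assume A: "finite A"
  obtain P where "poly P = f ^^ n" "degree P > 0" using iterate_poly by blast
  then show ?thesis using finite_poly_vimage[of P A] A by simp
qed

lemma Om_compl: "- Om n = (f ^^ n) -` {0, q}" by (auto simp: Om_def)

lemma finite_Om_compl: "finite (- Om n)"
  by (simp add: finite_iterate_vimage Om_compl)

lemma path_connected_Om_diff: "open S \<Longrightarrow> connected S \<Longrightarrow> path_connected (S \<inter> Om n)"
  using path_connected_open_diff_countable[of S "- Om n"] finite_Om_compl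
  by (simp add: countable_finite Diff_eq)

lemma path_connected_Om: "path_connected (Om n)"
  using path_connected_Om_diff[of UNIV] convex_connected[OF convex_UNIV] by simp

section \<open>Lifted paths and their endpoints\<close>

definition path_in :: "complex set \<Rightarrow> (real \<Rightarrow> complex) \<Rightarrow> bool" where
  "path_in A g \<longleftrightarrow> path g \<and> path_image g \<subseteq> A"

definition lift_of :: "nat \<Rightarrow> (real \<Rightarrow> complex) \<Rightarrow> (real \<Rightarrow> complex) \<Rightarrow> bool" where
  "lift_of n g h \<longleftrightarrow> path h \<and> (\<forall>s\<in>{0..1}. (f ^^ n) (h s) = g s)"

text \<open>The action of a path on the fibre of \<open>f ^^ n\<close>. The choice of the lift does
  not matter, by uniqueness of lifts (\<open>E_lift\<close>); where no lift starts at
  \<open>w\<close> the value is meaningless.\<close>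

definition E :: "nat \<Rightarrow> (real \<Rightarrow> complex) \<Rightarrow> complex \<Rightarrow> complex" where
  "E n g w = pathfinish (SOME h. lift_of n g h \<and> pathstart h = w)"

lemma path_in_join [intro]:
  "path_in A g \<Longrightarrow> path_in A h \<Longrightarrow> pathfinish g = pathstart h \<Longrightarrow> path_in A (g +++ h)"
  by (simp add: path_in_def subset_path_image_join)

lemma path_in_reverse [intro, simp]: "path_in A (reversepath g) \<longleftrightarrow> path_in A g"
  by (simp add: path_in_def)

lemma path_in_mono: "path_in A g \<Longrightarrow> A \<subseteq> B \<Longrightarrow> path_in B g"
  by (auto simp: path_in_def)

lemma path_in_start: "path_in A g \<Longrightarrow> pathstart g \<in> A"
  by (auto simp: path_in_def)

lemma path_in_image: "path_in A g \<Longrightarrow> s \<in> {0..1} \<Longrightarrow> g s \<in> A"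
  by (auto simp: path_in_def path_image_def)

lemma path_in_iterate: "path_in (Om (n + m)) h \<Longrightarrow> path_in (Om n) ((f ^^ m) \<circ> h)"
  unfolding path_in_def
  by (auto intro!: path_continuous_image continuous_on_iterate simp: path_image_compose mem_Om_add
    simp: subset_iff)

lemma path_in_image_f: "path_in (Om (Suc n)) h \<Longrightarrow> path_in (Om n) (f \<circ> h)"
  using path_in_iterate[of n 1 h] by simp

lemma lift_path_in: "path_in (Om m) g \<Longrightarrow> lift_of n g h \<Longrightarrow> path_in (Om (m + n)) h"
  unfolding path_in_def lift_of_def path_image_def
  by (auto simp: mem_Om_add)

lemma lift_finish: "lift_of n g h \<Longrightarrow> (f ^^ n) (pathfinish h) = pathfinish g"
  by (simp add: lift_of_def pathfinish_def)

lemma lift_iterate: "path h \<Longrightarrow> lift_of n ((f ^^ n) \<circ> h) h"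
  by (simp add: lift_of_def)

lemma lift_join:
  assumes "lift_of n g g'" "lift_of n h h'" "pathfinish g' = pathstart h'"
  shows "lift_of n (g +++ h) (g' +++ h')"
  unfolding lift_of_def
proof (intro conjI ballI)
  show "path (g' +++ h')" using assms by (simp add: lift_of_def)
  show "(f ^^ n) ((g' +++ h') s) = (g +++ h) s" if "s \<in> {0..1}" for s
    using assms that by (auto simp: lift_of_def joinpaths_def)
qed

lemma lift_reverse: "lift_of n g h \<Longrightarrow> lift_of n (reversepath g) (reversepath h)"
  unfolding lift_of_def by (simp add: path_reversepath) (simp add: reversepath_def)

lemma lift_lift: "lift_of n g h \<Longrightarrow> lift_of m h k \<Longrightarrow> lift_of (n + m) g k"
  by (simp add: lift_of_def funpow_add)

lemma lift_exists:
  assumes "path_in (Om 0) g" "(f ^^ n) w = pathstart g"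
  obtains h where "lift_of n g h" "pathstart h = w"
proof -
  have "w \<in> Om n" using assms path_in_start[of "Om 0" g] mem_Om_add[of w 0 n] by simp
  then show ?thesis
    using covering_space_lift_path_strong[OF covering_iterate[of n], of w g] assms that
    unfolding path_in_def lift_of_def by metis
qed

lemma lift_homotopic:
  assumes "homotopic_paths (Om 0) g g'" "lift_of n g h" "lift_of n g' h'" "pathstart h = pathstart h'"
  shows "homotopic_paths (Om n) h h'"
proof -
  have g: "path_in (Om 0) g" "path_in (Om 0) g'"
    using assms(1) homotopic_paths_imp_path homotopic_paths_imp_subset unfolding path_in_def by blast+
  then have "path_in (Om n) h" "path_in (Om n) h'"
    using lift_path_in[of 0 _ n] assms by auto
  then show ?thesis
    using covering_space_lift_homotopic_paths[OF covering_iterate[of n], of g g' h h'] assms g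
    by (auto simp: path_in_def lift_of_def)
qed

lemma E_lift:
  assumes "path_in (Om 0) g" "lift_of n g h"
  shows "E n g (pathstart h) = pathfinish h"
proof -
  define h' where "h' = (SOME h'. lift_of n g h' \<and> pathstart h' = pathstart h)"
  have h': "lift_of n g h' \<and> pathstart h' = pathstart h"
    unfolding h'_def by (rule someI[of _ h]) (use assms in simp)
  have "homotopic_paths (Om n) h' h"
    using h' assms by (rule_tac lift_homotopic[of g g n h' h]) (auto simp: path_in_def)
  then show ?thesis
    unfolding E_def h'_def[symmetric] by (rule homotopic_paths_imp_pathfinish)
qed

lemma E_fiber:
  assumes "path_in (Om 0) g" "(f ^^ n) w = pathstart g"
  shows "(f ^^ n) (E n g w) = pathfinish g"
  by (metis assms lift_exists E_lift lift_finish)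

lemma E_homotopic:
  assumes "homotopic_paths (Om 0) g h" "(f ^^ n) w = pathstart g"
  shows "E n g w = E n h w"
proof -
  have gh: "path_in (Om 0) g" "path_in (Om 0) h" "pathstart h = pathstart g"
    using assms(1) homotopic_paths_imp_path homotopic_paths_imp_subset homotopic_paths_imp_pathstart
    unfolding path_in_def by metis+
  obtain g' h' where "lift_of n g g'" "pathstart g' = w" "lift_of n h h'" "pathstart h' = w"
    using lift_exists gh assms(2) by metis
  then show ?thesis
    using lift_homotopic[OF assms(1)] E_lift gh homotopic_paths_imp_pathfinish by metis
qed

lemma E_join:
  assumes "path_in (Om 0) g" "path_in (Om 0) h" "pathfinish g = pathstart h" "(f ^^ n) w = pathstart g"
  shows "E n (g +++ h) w = E n h (E n g w)"
proof -
  obtain g' where g': "lift_of n g g'" "pathstart g' = w" using lift_exists assms by metis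
  obtain h' where h': "lift_of n h h'" "pathstart h' = pathfinish g'"
    using lift_exists assms lift_finish[OF g'(1)] by metis
  have "E n (g +++ h) (pathstart (g' +++ h')) = pathfinish (g' +++ h')"
    using assms g' h' by (intro E_lift lift_join) auto
  then show ?thesis
    using E_lift[OF assms(1) g'(1)] E_lift[OF assms(2) h'(1)] g' h' by simp
qed

lemma E_reverse:
  assumes "path_in (Om 0) g" "(f ^^ n) w = pathstart g"
  shows "E n (reversepath g) (E n g w) = w"
proof -
  obtain g' where g': "lift_of n g g'" "pathstart g' = w" using lift_exists assms by metis
  then show ?thesis
    using E_lift[OF assms(1) g'(1)] E_lift[of "reversepath g" n "reversepath g'"] assms lift_reverse
    by simp
qed

lemma E_reverse':
  assumes "path_in (Om 0) g" "(f ^^ n) w = pathfinish g"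
  shows "E n g (E n (reversepath g) w) = w"
  using E_reverse[of "reversepath g"] assms by simp

lemma E_inj:
  assumes "path_in (Om 0) g" "(f ^^ n) w = pathstart g" "(f ^^ n) w' = pathstart g" "E n g w = E n g w'"
  shows "w = w'"
  using E_reverse assms by metis

text \<open>The formula for sections: on the subtree below a vertex \<open>(f ^^ m) w\<close> of
  level \<open>n\<close> the path acts as its own lift \<open>h\<close> that starts at this
  vertex.\<close>

lemma E_add:
  assumes "path_in (Om 0) g" "lift_of n g h" "pathstart h = (f ^^ m) w"
  shows "E (m + n) g w = E m h w"
proof -
  have h: "path_in (Om 0) h"
    using lift_path_in[OF assms(1,2)] Om_subset path_in_mono by blast
  obtain k where k: "lift_of m h k" "pathstart k = w" using lift_exists[OF h] assms(3) by metis
  then show ?thesis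
    using E_lift[OF h k(1)] E_lift[OF assms(1) lift_lift[OF assms(2) k(1)]] by (simp add: add.commute)
qed

text \<open>For loops this is compatibility with the parent map: the actions on the levels fit
  together to tree automorphisms.\<close>

lemma E_image:
  assumes "path_in (Om 0) g" "(f ^^ (m + n)) w = pathstart g"
  shows "(f ^^ m) (E (m + n) g w) = E n g ((f ^^ m) w)"
proof -
  have 1: "(f ^^ n) ((f ^^ m) w) = pathstart g"
    using assms(2) by (metis add.commute funpow_add comp_apply)
  obtain h where h: "lift_of n g h" "pathstart h = (f ^^ m) w" using lift_exists[OF assms(1) 1] by metis
  have h': "path_in (Om 0) h"
    using lift_path_in[OF assms(1) h(1)] Om_subset path_in_mono by blast
  then show ?thesis
    using E_add[OF assms(1) h] E_fiber[OF h', of m w] E_lift[OF assms(1) h(1)] h by simp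
qed

text \<open>A convex set is simply connected, so the loop contracts inside \<open>Om 0\<close> and
  acts on each level like a constant path.\<close>

lemma E_null:
  assumes "path_in B g" "convex B" "B \<subseteq> Om 0" "pathfinish g = pathstart g" "(f ^^ n) w = pathstart g"
  shows "E n g w = w"
proof -
  let ?k = "linepath (pathstart g) (pathstart g)"
  have s: "pathstart g \<in> B" using assms path_in_start by blast
  have "homotopic_paths B g ?k"
    using assms convex_imp_simply_connected[of B] s unfolding simply_connected_eq_homotopic_paths path_in_def
    by auto
  then have "homotopic_paths (Om 0) g ?k" using assms(3) homotopic_paths_subset by blast
  then have "E n g w = E n ?k w" using assms E_homotopic by blast
  moreover have "E n ?k (pathstart (linepath w w)) = pathfinish (linepath w w)"
    using assms s by (intro E_lift) (auto simp: path_in_def lift_of_def linepath_refl path_def)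
  ultimately show ?thesis by simp
qed

end

section \<open>Double transitivity on fibres\<close>

lemma path_stays:
  assumes "path h" "path_image h \<subseteq> A \<union> B" "open A" "open B" "A \<inter> B = {}" "pathstart h \<in> A"
  shows "path_image h \<subseteq> A"
proof -
  have "connected (path_image h)" using assms(1) by (rule connected_path_image)
  moreover have "pathstart h \<in> path_image h" by (rule pathstart_in_path_image)
  ultimately show ?thesis using connectedD[of "path_image h" A B] assms by blast
qed

context exceptional_poly
begin

lemma E_0: "path_in (Om 0) g \<Longrightarrow> E 0 g (pathstart g) = pathfinish g"
  by (rule E_lift) (auto simp: lift_of_def path_in_def)

lemma open_meets_Om:
  assumes "open S" "S \<noteq> {}"
  shows "S \<inter> Om n \<noteq> {}"
proof
  assume "S \<inter> Om n = {}"
  then have "finite S" using finite_subset[OF _ finite_Om_compl] by blast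
  then show False using assms finite_imp_not_open by blast
qed

text \<open>Actions are prescribed in this way from here on: a path \<open>h\<close> between two
  chosen points upstairs is the lift of its own image.\<close>

lemma E_path_image:
  assumes "path_in (Om (Suc n)) h"
  shows "E 1 (f \<circ> h) (pathstart h) = pathfinish h"
proof (rule E_lift)
  show "path_in (Om 0) (f \<circ> h)"
    using path_in_image_f[OF assms] Om_subset path_in_mono by blast
  show "lift_of 1 (f \<circ> h) h" using assms by (simp add: lift_of_def path_in_def)
qed

text \<open>Near the exceptional point \<open>0\<close> the fibre consists of one point near \<open>0\<close>, where \<open>f\<close> is
  injective, and of points near \<open>c\<close>, which can be permuted by loops around \<open>c\<close>.\<close>

lemma base_fiber:
  obtains z0 where "z0 \<in> Om (Suc n)"
    "\<And>s s'. f s = f z0 \<Longrightarrow> f s' = f z0 \<Longrightarrow> s \<noteq> z0 \<Longrightarrow> s' \<noteq> z0 \<Longrightarrow>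
       \<exists>g. path_in (Om n) g \<and> pathstart g = f z0 \<and> pathfinish g = f z0 \<and> E 1 g z0 = z0 \<and> E 1 g s = s'"
proof -
  have f0: "f 0 = 0" using zeros by simp
  have "q \<noteq> c" using q_fixed zeros nonzero by metis
  then have "poly (pderiv p) 0 \<noteq> 0" using critical nonzero by auto
  then obtain r where r: "r > 0" "inj_on f (ball 0 r)" using poly_deriv_locally_injective by blast
  define e where "e = min r (norm c / 2)"
  have e: "e > 0" "e \<le> r" "2 * e \<le> norm c" using r nonzero by (auto simp: e_def)
  have inj: "inj_on f (ball 0 e)" using r e by (auto intro: inj_on_subset)
  have disj: "ball 0 e \<inter> ball c e = {}" using e by (intro disjoint_ballI) (simp add: dist_norm)
  have fiber0: "z = 0 \<or> z = c" if "f z = 0" for z using zeros that by simp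
  have deg: "degree p > 0" using degree_ge by simp
  obtain e1 where e1: "e1 > 0" "f -` ball 0 e1 \<subseteq> ball 0 e \<union> ball c e"
  proof -
    obtain e1 where "e1 > 0" "f -` ball 0 e1 \<subseteq> (\<Union>z\<in>{z. f z = 0}. ball z e)"
      by (rule poly_fiber_neighbourhood[OF deg, of 0 "\<lambda>z. ball z e"]) (use e in auto)
    then show ?thesis using fiber0 that[of e1] by fastforce
  qed
  have "open (f -` ball 0 e1)" by (intro open_vimage continuous_intros) auto
  moreover have "c \<in> f -` ball 0 e1" using zeros[of c] e1 by simp
  ultimately obtain s where s: "s > 0" "ball c s \<subseteq> f -` ball 0 e1" by (meson openE)
  \<comment> \<open>With radius at most \<open>s\<close>, a path inside \<open>V1\<close> has its
    image in \<open>ball 0 e1\<close>, so a lift of that image starting near \<open>0\<close> cannot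
    reach the disc around \<open>c\<close>.\<close>
  define V1 where "V1 = ball c (min s e)"
  obtain e2 where e2: "e2 > 0" "f -` ball 0 e2 \<subseteq> ball 0 e \<union> V1"
  proof -
    have "open (if z = 0 then ball 0 e else V1) \<and> z \<in> (if z = 0 then ball 0 e else V1)"
      if "f z = 0" for z
      using fiber0[OF that] e s by (auto simp: V1_def)
    then obtain e2 where "e2 > 0" "f -` ball 0 e2 \<subseteq> (\<Union>z\<in>{z. f z = 0}. if z = 0 then ball 0 e else V1)"
      by (rule poly_fiber_neighbourhood[OF deg, of 0 "\<lambda>z. if z = 0 then ball 0 e else V1"]) blast
    moreover have "(\<Union>z\<in>{z. f z = 0}. if z = 0 then ball 0 e else V1) \<subseteq> ball 0 e \<union> V1" by auto
    ultimately show ?thesis using that[of e2] by blast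
  qed
  have "open (ball 0 e \<inter> f -` ball 0 e2)" by (intro open_Int open_vimage continuous_intros) auto
  moreover have "0 \<in> ball 0 e \<inter> f -` ball 0 e2" using e e2 f0 by simp
  ultimately have "ball 0 e \<inter> f -` ball 0 e2 \<inter> Om (Suc n) \<noteq> {}" using open_meets_Om[of "ball 0 e \<inter> f -` ball 0 e2" "Suc n"] by blast
  then obtain z0 where z0: "z0 \<in> ball 0 e" "f z0 \<in> ball 0 e2" "z0 \<in> Om (Suc n)" by blast
  show ?thesis
  proof (rule that[OF z0(3)])
    fix x x' assume x: "f x = f z0" "f x' = f z0" "x \<noteq> z0" "x' \<noteq> z0"
    have V1: "y \<in> V1 \<inter> Om (Suc n)" if "f y = f z0" "y \<noteq> z0" for y
    proof -
      have "y \<notin> ball 0 e" using inj z0 that by (auto simp: inj_on_def)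
      moreover have "y \<in> ball 0 e \<union> V1" using e2(2) z0(2) that(1) by (metis subsetD vimageI2)
      ultimately show ?thesis using z0(3) that(1) by (simp add: mem_Om_Suc)
    qed
    have "path_connected (V1 \<inter> Om (Suc n))"
      unfolding V1_def by (intro path_connected_Om_diff) auto
    then obtain h where h: "path h" "path_image h \<subseteq> V1 \<inter> Om (Suc n)" "pathstart h = x" "pathfinish h = x'"
      using V1 x unfolding path_connected_def by meson
    then have h': "path_in (Om (Suc n)) h" by (simp add: path_in_def)
    define g where "g = f \<circ> h"
    have g: "path_in (Om n) g" "pathstart g = f z0" "pathfinish g = f z0"
      using path_in_image_f[OF h'] h x by (simp_all add: g_def pathstart_compose pathfinish_compose)
    then have g0: "path_in (Om 0) g" using Om_subset path_in_mono by blast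
    have "E 1 g x = x'" using E_path_image[OF h'] h by (simp add: g_def)
    moreover have "E 1 g z0 = z0"
    proof -
      obtain k where k: "lift_of 1 g k" "pathstart k = z0"
        using lift_exists[OF g0, of 1 z0] g by auto
      have "path_image k \<subseteq> f -` ball 0 e1"
      proof
        fix y assume "y \<in> path_image k"
        then obtain t where t: "t \<in> {0..1}" "y = k t" by (auto simp: path_image_def)
        have "h t \<in> ball c (min s e)" using h(2) t(1) unfolding path_image_def V1_def by blast
        then have "h t \<in> ball c s" by simp
        moreover have "f y = f (h t)" using k t by (auto simp: lift_of_def g_def)
        ultimately show "y \<in> f -` ball 0 e1" using s by auto
      qed
      then have sub: "path_image k \<subseteq> ball 0 e \<union> ball c e" using e1(2) by (rule subset_trans)
      have "path k" using k(1) by (simp add: lift_of_def)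
      then have "path_image k \<subseteq> ball 0 e"
        using path_stays[OF _ sub open_ball open_ball disj] k(2) z0(1) by simp
      then have "pathfinish k \<in> ball 0 e" using pathfinish_in_path_image[of k] by blast
      moreover have "f (pathfinish k) = f z0" using lift_finish[OF k(1)] g by simp
      ultimately have "pathfinish k = z0" using inj z0 by (auto simp: inj_on_def)
      then show ?thesis using E_lift[OF g0 k(1)] k by simp
    qed
    ultimately show "\<exists>g. path_in (Om n) g \<and> pathstart g = f z0 \<and> pathfinish g = f z0 \<and>
        E 1 g z0 = z0 \<and> E 1 g x = x'" using g by blast
  qed
qed

lemma transitive_level:
  assumes "u \<in> Om (Suc n)" "y \<in> Om (Suc n)"
  obtains g where "path_in (Om n) g" "pathstart g = f u" "pathfinish g = f y" "E 1 g u = y"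
proof -
  obtain h where h: "path h" "path_image h \<subseteq> Om (Suc n)" "pathstart h = u" "pathfinish h = y"
    using path_connected_Om assms unfolding path_connected_def by meson
  then have "path_in (Om (Suc n)) h" by (simp add: path_in_def)
  then show ?thesis
    using that[of "f \<circ> h"] h path_in_image_f[of n h] E_path_image[of n h]
    by (simp add: pathstart_compose pathfinish_compose)
qed

text \<open>Transitivity on the level brings \<open>u\<close> and \<open>y\<close> to the point
  \<open>z0\<close>, whose stabiliser is transitive on the rest of its fibre by
  \<open>base_fiber\<close>. The path runs along \<open>a\<close>, then \<open>k\<close>, then
  \<open>b\<close> backwards.\<close>

lemma two_transitive:
  assumes "u \<in> Om (Suc n)" "f u' = f u" "u \<noteq> u'" "y \<in> Om (Suc n)" "f y' = f y" "y \<noteq> y'"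
  obtains g where "path_in (Om n) g" "pathstart g = f u" "pathfinish g = f y"
    "E 1 g u = y" "E 1 g u' = y'"
proof -
  obtain z0 where z0: "z0 \<in> Om (Suc n)"
    "\<And>s s'. f s = f z0 \<Longrightarrow> f s' = f z0 \<Longrightarrow> s \<noteq> z0 \<Longrightarrow> s' \<noteq> z0 \<Longrightarrow>
       \<exists>g. path_in (Om n) g \<and> pathstart g = f z0 \<and> pathfinish g = f z0 \<and> E 1 g z0 = z0 \<and> E 1 g s = s'"
    using base_fiber by blast
  have Om: "path_in (Om 0) g" if "path_in (Om n) g" for g using that Om_subset path_in_mono by blast
  obtain a where a: "path_in (Om n) a" "pathstart a = f u" "pathfinish a = f z0" "E 1 a u = z0"
    using transitive_level assms(1) z0(1) by blast
  obtain b where b: "path_in (Om n) b" "pathstart b = f y" "pathfinish b = f z0" "E 1 b y = z0"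
    using transitive_level assms(4) z0(1) by blast
  have 1: "f (E 1 a u') = f z0" "E 1 a u' \<noteq> z0"
    using E_fiber[OF Om[OF a(1)], of 1 u'] E_inj[OF Om[OF a(1)], of 1 u u'] a assms by auto
  have 2: "f (E 1 b y') = f z0" "E 1 b y' \<noteq> z0"
    using E_fiber[OF Om[OF b(1)], of 1 y'] E_inj[OF Om[OF b(1)], of 1 y y'] b assms by auto
  obtain k where k: "path_in (Om n) k" "pathstart k = f z0" "pathfinish k = f z0" "E 1 k z0 = z0"
      "E 1 k (E 1 a u') = E 1 b y'"
    using z0(2)[OF 1(1) 2(1) 1(2) 2(2)] by blast
  let ?g = "a +++ (k +++ reversepath b)"
  have kb: "path_in (Om n) (k +++ reversepath b)" using k b by auto
  have E: "E 1 ?g w = E 1 (reversepath b) (E 1 k (E 1 a w))" if "f w = f u" for w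
  proof -
    have "f (E 1 a w) = f z0" using E_fiber[OF Om[OF a(1)], of 1 w] that a by simp
    then show ?thesis
      using E_join[OF Om[OF a(1)] Om[OF kb], of 1 w] a b k that
        E_join[OF Om[OF k(1)], of "reversepath b" 1 "E 1 a w"] Om[OF b(1)] by simp
  qed
  show ?thesis
  proof (rule that[of ?g])
    show "path_in (Om n) ?g" using a kb k by auto
    show "E 1 ?g u = y" using E[of u] a k E_reverse[OF Om[OF b(1)], of 1 y] b by simp
    show "E 1 ?g u' = y'" using E[of u'] a k E_reverse[OF Om[OF b(1)], of 1 y'] b assms by simp
  qed (use a b in auto)
qed

end

section \<open>Discs around the critical fixed point\<close>

text \<open>\<open>D\<close> is a forward invariant disc around the critical fixed point \<open>q\<close>. Its preimage is covered
  by \<open>V\<close>, on which \<open>f\<close> is at most two-to-one, and the members of \<open>W\<close>, on which \<open>f\<close> is injective.\<close>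

locale exceptional_discs = exceptional_poly +
  fixes D V :: "complex set" and W :: "complex set set"
  assumes D_open: "open D" and D_connected: "connected D" and q_in_D: "q \<in> D" and D_zero: "0 \<notin> D"
    and D_invariant: "f ` D \<subseteq> D"
    and V_open: "open V" and D_subset_V: "D \<subseteq> V"
    and V_q: "z \<in> V \<Longrightarrow> f z = q \<Longrightarrow> z = q"
    and V_fiber: "x \<in> V \<Longrightarrow> y \<in> V \<Longrightarrow> z \<in> V \<Longrightarrow> f x = f z \<Longrightarrow> f y = f z \<Longrightarrow> x = y \<or> x = z \<or> y = z"
    and W_ball: "B \<in> W \<Longrightarrow> open B \<and> convex B \<and> B \<subseteq> Om 0 \<and> inj_on f B \<and> B \<inter> V = {}"
    and W_disjoint: "B \<in> W \<Longrightarrow> B' \<in> W \<Longrightarrow> B \<noteq> B' \<Longrightarrow> B \<inter> B' = {}"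
    and cover: "f -` D \<subseteq> V \<union> \<Union> W"
    and twins: "\<exists>x\<in>D. \<exists>y\<in>D. x \<noteq> y \<and> f x = f y"

context exceptional_poly
begin

text \<open>At the simple critical point \<open>f - q\<close> vanishes to order exactly two, so it
  is the square of a local coordinate \<open>g\<close>. Points with equal image are then those whose
  values of \<open>g\<close> agree up to sign.\<close>

lemma square_near_critical:
  obtains g r where "r > 0" "g holomorphic_on ball q r" "inj_on g (ball q r)" "g q = 0"
    "\<And>z. z \<in> ball q r \<Longrightarrow> f z - q = (g z)\<^sup>2"
proof -
  have d1: "deriv f = poly (pderiv p)" by (rule ext) (simp add: DERIV_imp_deriv[OF poly_DERIV])
  have d2: "deriv (poly (pderiv p)) q = poly (pderiv (pderiv p)) q"
    by (simp add: DERIV_imp_deriv[OF poly_DERIV])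
  have n0: "(deriv ^^ i) f q = 0" if "0 < i" "i < 2" for i
  proof -
    have "i = 1" using that by simp
    then show ?thesis using critical by (simp add: d1)
  qed
  have n2: "(deriv ^^ 2) f q \<noteq> 0"
    using simple_critical by (simp add: numeral_2_eq_2 d1 d2)
  obtain h r where h: "0 < r" "h holomorphic_on ball q r"
      "\<And>w. w \<in> ball q r \<Longrightarrow> f w - f q = ((w - q) * h w)\<^sup>2"
      "\<And>w. w \<in> ball q r \<Longrightarrow> h w \<noteq> 0"
    by (rule holomorphic_factor_order_of_zero_strong[of f UNIV q 2, OF holomorphic_on_poly open_UNIV _ _ n2 n0])
      auto
  define g where "g = (\<lambda>w. (w - q) * h w)"
  have hol: "g holomorphic_on ball q r" unfolding g_def by (intro holomorphic_intros h)
  have "(h has_field_derivative deriv h q) (at q)"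
    by (rule holomorphic_derivI[OF h(2)]) (use h in auto)
  then have "(g has_field_derivative h q) (at q)"
    unfolding g_def by (auto intro!: derivative_eq_intros)
  then have "deriv g q \<noteq> 0" using h(4)[of q] h(1) by (simp add: DERIV_imp_deriv)
  then obtain s where s: "s > 0" "ball q s \<subseteq> ball q r" "inj_on g (ball q s)"
    using has_complex_derivative_locally_injective[OF hol, of q] h(1) by auto
  show ?thesis
  proof (rule that[of s g])
    show "g holomorphic_on ball q s" using hol s holomorphic_on_subset by blast
    show "f z - q = (g z)\<^sup>2" if "z \<in> ball q s" for z
      using h(3)[of z] s(2) that q_fixed by (auto simp: g_def)
  qed (use s in \<open>auto simp: g_def\<close>)
qed

text \<open>The derivative vanishes at the fixed point, so \<open>f\<close> shrinks distances to
  \<open>q\<close> nearby.\<close>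

lemma attracting_critical:
  obtains r where "r > 0" "\<And>s. s \<le> r \<Longrightarrow> f ` ball q s \<subseteq> ball q s"
proof -
  have "poly (pderiv p) q = 0" using critical by blast
  then have "(f has_field_derivative 0) (at q)" using poly_DERIV[of p q] by simp
  then have "((\<lambda>z. (f z - f q) / (z - q)) \<longlongrightarrow> 0) (at q)"
    by (simp add: has_field_derivative_iff)
  from tendstoD[OF this, of 1] obtain r where r: "r > 0"
      "\<And>z. z \<noteq> q \<Longrightarrow> dist z q < r \<Longrightarrow> norm ((f z - f q) / (z - q)) < 1"
    by (auto simp: eventually_at)
  show ?thesis
  proof (rule that[OF r(1)])
    fix s assume s: "s \<le> r"
    have "f z \<in> ball q s" if z: "z \<in> ball q s" for z
    proof (cases "z = q")
      case False
      have "dist z q < r" using z s by (simp add: dist_commute)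
      then have "norm (f z - q) < norm (z - q)"
        using r(2)[OF False] False q_fixed by (simp add: norm_divide divide_simps split: if_splits)
      then show ?thesis using z by (simp add: dist_norm norm_minus_commute)
    qed (use z q_fixed in simp)
    then show "f ` ball q s \<subseteq> ball q s" by blast
  qed
qed

lemma exceptional_discs_exist: "\<exists>D V W. exceptional_discs p c q D V W"
proof -
  have deg: "degree p > 0" using degree_ge by simp
  obtain g r1 where g: "r1 > 0" "g holomorphic_on ball q r1" "inj_on g (ball q r1)" "g q = 0"
    "\<And>z. z \<in> ball q r1 \<Longrightarrow> f z - q = (g z)\<^sup>2" using square_near_critical by blast
  obtain r2 where r2: "r2 > 0" "\<And>s. s \<le> r2 \<Longrightarrow> f ` ball q s \<subseteq> ball q s"
    using attracting_critical by blast
  let ?Z = "{z. f z = q}"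
  have f0: "f 0 \<noteq> q" "f c \<noteq> q" using zeros nonzero by auto
  have fin: "finite ?Z" by (rule finite_poly_fiber[OF deg])
  \<comment> \<open>The demands on the common radius of the discs around the preimages of
    \<open>q\<close>: room for the square coordinate at \<open>q\<close>, injectivity elsewhere,
    \<open>0\<close> outside, disjointness.\<close>
  define P where "P z s \<longleftrightarrow> (if z = q then s \<le> r1 else inj_on f (ball z s)) \<and> s \<le> norm z \<and>
    (\<forall>z'\<in>?Z. z' \<noteq> z \<longrightarrow> 2 * s \<le> dist z z')" for z s
  have "\<exists>r>0. \<forall>s\<in>{0<..r}. P z s" if z: "z \<in> ?Z" for z
  proof -
    have "\<exists>r>0. \<forall>s\<in>{0<..r}. if z = q then s \<le> r1 else inj_on f (ball z s)"
    proof (cases "z = q")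
      case False
      then have "poly (pderiv p) z \<noteq> 0" using critical z f0 by auto
      then obtain r where "r > 0" "inj_on f (ball z r)" using poly_deriv_locally_injective by blast
      moreover have "inj_on f (ball z s)" if "s \<in> {0<..r}" for s
        using \<open>inj_on f (ball z r)\<close> that by (meson greaterThanAtMost_iff inj_on_subset subset_ball)
      ultimately show ?thesis using False by (intro exI[of _ r]) simp
    next
      case True
      then show ?thesis using g(1) by (intro exI[of _ r1]) simp
    qed
    then obtain r where r: "r > 0" "\<forall>s\<in>{0<..r}. if z = q then s \<le> r1 else inj_on f (ball z s)"
      by blast
    obtain d where d: "d > 0" "\<forall>z'\<in>?Z. z' \<noteq> z \<longrightarrow> d \<le> dist z z'"
      using finite_set_avoid[OF fin] by blast
    have "z \<noteq> 0" using z f0 by auto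
    show ?thesis
    proof (intro exI[of _ "min (norm z) (min r (d/2))"] conjI ballI)
      show "0 < min (norm z) (min r (d/2))" using r d \<open>z \<noteq> 0\<close> by simp
      fix s assume "s \<in> {0<..min (norm z) (min r (d/2))}"
      then have s: "0 < s" "s \<le> norm z" "s \<le> r" "2 * s \<le> d" by auto
      have "2 * s \<le> dist z z'" if "z' \<in> ?Z" "z' \<noteq> z" for z'
        using d(2) that s(4) by (meson order_trans)
      then show "P z s" using r(2) s unfolding P_def by auto
    qed
  qed
  then obtain s where s: "s > 0" "\<And>z t. z \<in> ?Z \<Longrightarrow> 0 < t \<Longrightarrow> t \<le> s \<Longrightarrow> P z t"
    using finite_common_radius[OF fin, of P] by blast
  have P: "P z s" if "z \<in> ?Z" for z using s that by simp
  have qZ: "q \<in> ?Z" using q_fixed by simp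
  have sep: "ball z s \<inter> ball z' s = {}" if "z \<in> ?Z" "z' \<in> ?Z" "z \<noteq> z'" for z z'
  proof -
    have "2 * s \<le> dist z z'" using P[OF that(1)] that unfolding P_def by auto
    then show ?thesis by (intro disjoint_ballI) simp
  qed
  obtain e where e: "e > 0" "f -` ball q e \<subseteq> (\<Union>z\<in>?Z. ball z s)"
    by (rule poly_fiber_neighbourhood[OF deg, of q "\<lambda>z. ball z s"]) (use s in auto)
  \<comment> \<open>The radius of \<open>D\<close>: \<open>s\<close> puts it inside
    \<open>V\<close>, \<open>e\<close> lets the discs cover its preimage, and \<open>r2\<close>
    makes it forward invariant.\<close>
  define r where "r = min s (min e r2)"
  have r: "r > 0" "r \<le> s" "r \<le> e" "r \<le> r2" using s e r2 by (auto simp: r_def)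
  have sr1: "s \<le> r1" "s \<le> norm q" using P[OF qZ] by (simp_all add: P_def)
  have sub: "ball q s \<subseteq> ball q r1" "ball q r \<subseteq> ball q s" using sr1 r by auto
  have inj: "inj_on g (ball q s)" using g(3) sub inj_on_subset by blast
  have sq: "f z - q = (g z)\<^sup>2" if "z \<in> ball q s" for z using g(5) sub that by blast
  have "exceptional_discs p c q (ball q r) (ball q s) ((\<lambda>z. ball z s) ` (?Z - {q}))"
  proof unfold_locales
    show "f ` ball q r \<subseteq> ball q r" using r2 r by blast
    show "0 \<notin> ball q r" using sr1 r by simp
    show "z = q" if "z \<in> ball q s" "f z = q" for z
    proof -
      have "g z = g q" using sq[OF that(1)] that g(4) by simp
      then show ?thesis using inj that s(1) by (auto simp: inj_on_def)
    qed
    show "x = y \<or> x = z \<or> y = z"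
      if "x \<in> ball q s" "y \<in> ball q s" "z \<in> ball q s" "f x = f z" "f y = f z" for x y z
    proof -
      have "(g x)\<^sup>2 = (g z)\<^sup>2" "(g y)\<^sup>2 = (g z)\<^sup>2" using sq that by metis+
      then have "g x = g y \<or> g x = g z \<or> g y = g z" by (auto simp: power2_eq_iff)
      then show ?thesis using inj that unfolding inj_on_def by blast
    qed
    show "open B \<and> convex B \<and> B \<subseteq> Om 0 \<and> inj_on f B \<and> B \<inter> ball q s = {}"
      if B: "B \<in> (\<lambda>z. ball z s) ` (?Z - {q})" for B
    proof -
      obtain z where z: "z \<in> ?Z" "z \<noteq> q" "B = ball z s" using B by blast
      have disj: "ball z s \<inter> ball q s = {}" using sep[OF z(1) qZ z(2)] .
      then have "q \<notin> ball z s" using s(1) by (meson centre_in_ball disjoint_iff)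
      moreover have "0 \<notin> ball z s" "inj_on f (ball z s)" using P[OF z(1)] z(2) by (simp_all add: P_def)
      ultimately show ?thesis using disj z(3) unfolding Om_0 by blast
    qed
    show "B \<inter> B' = {}" if "B \<in> (\<lambda>z. ball z s) ` (?Z - {q})" "B' \<in> (\<lambda>z. ball z s) ` (?Z - {q})" "B \<noteq> B'" for B B'
      using that sep by blast
    show "f -` ball q r \<subseteq> ball q s \<union> \<Union> ((\<lambda>z. ball z s) ` (?Z - {q}))"
    proof
      fix x assume "x \<in> f -` ball q r"
      then have "x \<in> f -` ball q e" using r by auto
      then show "x \<in> ball q s \<union> \<Union> ((\<lambda>z. ball z s) ` (?Z - {q}))" using e(2) by blast
    qed
    show "\<exists>x\<in>ball q r. \<exists>y\<in>ball q r. x \<noteq> y \<and> f x = f y"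
    proof -
      have "open (g ` ball q r)"
        using g(2) inj sub by (intro open_mapping_thm3) (auto intro: holomorphic_on_subset inj_on_subset)
      moreover have "0 \<in> g ` ball q r" using g(4) r(1) by (intro image_eqI[of _ g q]) auto
      ultimately obtain d where d: "d > 0" "ball 0 d \<subseteq> g ` ball q r" by (meson openE)
      \<comment> \<open>Opposite values of \<open>g\<close> have the same square, which yields two
        points of \<open>D\<close> with the same image.\<close>
      have "of_real (d/2) \<in> ball (0::complex) d" "- of_real (d/2) \<in> ball (0::complex) d"
        using d(1) by (simp_all add: norm_divide)
      then have "of_real (d/2) \<in> g ` ball q r" "- of_real (d/2) \<in> g ` ball q r" using d(2) by blast+
      then obtain x y where xy: "x \<in> ball q r" "y \<in> ball q r" "g x = of_real (d/2)" "g y = - of_real (d/2)"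
        by (elim imageE) (erule that; simp)
      have "f x - q = f y - q" using sq[of x] sq[of y] xy subsetD[OF sub(2)] by simp
      moreover have "x \<noteq> y" using xy d(1) by auto
      ultimately show ?thesis using xy(1,2) by (intro bexI[of _ x] bexI[of _ y]) auto
    qed
  qed (use r s in auto)
  then show ?thesis by blast
qed

end

section \<open>Sections of loops\<close>

context exceptional_poly
begin

text \<open>The index \<open>n\<close> leaves room for \<open>n\<close> pushes, as \<open>f\<close>
  maps paths in \<open>Om (Suc n)\<close> to paths in \<open>Om n\<close>. For the action alone the
  index \<open>0\<close> suffices.\<close>

definition loop_in :: "nat \<Rightarrow> complex \<Rightarrow> (real \<Rightarrow> complex) \<Rightarrow> bool" where
  "loop_in n v g \<longleftrightarrow> path_in (Om n) g \<and> pathstart g = v \<and> pathfinish g = v"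

definition comm_loop :: "(real \<Rightarrow> complex) \<Rightarrow> (real \<Rightarrow> complex) \<Rightarrow> real \<Rightarrow> complex" where
  "comm_loop a b = a +++ (b +++ (reversepath a +++ reversepath b))"

text \<open>\<open>section_at a v b\<close>: the loop \<open>a\<close> at \<open>f v\<close> fixes the child \<open>v\<close> and acts on the subtree below it
  as the loop \<open>b\<close> at \<open>v\<close>.\<close>

definition section_at :: "(real \<Rightarrow> complex) \<Rightarrow> complex \<Rightarrow> (real \<Rightarrow> complex) \<Rightarrow> bool" where
  "section_at a v b \<longleftrightarrow> (\<forall>m w. (f ^^ m) w = v \<longrightarrow> E (Suc m) a w = E m b w)"

definition trivial_at :: "(real \<Rightarrow> complex) \<Rightarrow> complex \<Rightarrow> bool" where
  "trivial_at a v \<longleftrightarrow> (\<forall>m w. (f ^^ m) w = v \<longrightarrow> E (Suc m) a w = w)"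

lemma path_in_Om_0: "path_in (Om n) g \<Longrightarrow> path_in (Om 0) g"
  using Om_subset path_in_mono by blast

lemma loop_in_0: "loop_in n v g \<Longrightarrow> loop_in 0 v g"
  unfolding loop_in_def using path_in_Om_0 by blast

lemma loop_in_reverse [simp]: "loop_in n v (reversepath g) \<longleftrightarrow> loop_in n v g"
  by (auto simp: loop_in_def)

lemma loop_in_join: "loop_in n v g \<Longrightarrow> loop_in n v h \<Longrightarrow> loop_in n v (g +++ h)"
  by (auto simp: loop_in_def)

lemma loop_in_comm: "loop_in n v a \<Longrightarrow> loop_in n v b \<Longrightarrow> loop_in n v (comm_loop a b)"
  by (simp add: comm_loop_def loop_in_join)

lemma E_loop_join:
  assumes "loop_in 0 v g" "loop_in 0 v h" "(f ^^ m) w = v"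
  shows "E m (g +++ h) w = E m h (E m g w)"
  using assms E_join unfolding loop_in_def by simp

lemma E_loop_fiber: "loop_in 0 v g \<Longrightarrow> (f ^^ m) w = v \<Longrightarrow> (f ^^ m) (E m g w) = v"
  using E_fiber unfolding loop_in_def by simp

lemma E_loop_reverse: "loop_in 0 v g \<Longrightarrow> (f ^^ m) w = v \<Longrightarrow> E m (reversepath g) (E m g w) = w"
  using E_reverse unfolding loop_in_def by simp

lemma E_loop_reverse': "loop_in 0 v g \<Longrightarrow> (f ^^ m) w = v \<Longrightarrow> E m g (E m (reversepath g) w) = w"
  using E_reverse' unfolding loop_in_def by simp

lemma E_loop_reverse_eq: "loop_in 0 v g \<Longrightarrow> (f ^^ m) w = v \<Longrightarrow> E m g w = w' \<Longrightarrow> E m (reversepath g) w' = w"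
  using E_loop_reverse by blast

lemma E_comm:
  assumes "loop_in 0 v a" "loop_in 0 v b" "(f ^^ m) w = v"
  shows "E m (comm_loop a b) w =
    E m (reversepath b) (E m (reversepath a) (E m b (E m a w)))"
  unfolding comm_loop_def using assms by (simp add: E_loop_join E_loop_fiber loop_in_join)

lemma E_Suc_parent:
  assumes "path_in (Om 0) g" "(f ^^ m) w = u" "f u = pathstart g"
  shows "(f ^^ m) (E (Suc m) g w) = E 1 g u"
  using E_image[OF assms(1), of m 1 w] assms by simp

lemma section_at_reverse:
  assumes "loop_in 0 (f v) a" "loop_in 0 v b" "section_at a v b"
  shows "section_at (reversepath a) v (reversepath b)"
  unfolding section_at_def
proof (intro allI impI)
  fix m w assume w: "(f ^^ m) w = v"
  let ?y = "E m (reversepath b) w"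
  have y: "(f ^^ m) ?y = v" using E_loop_fiber[of v "reversepath b" m w] assms w by simp
  have "E (Suc m) a ?y = w"
    using assms(3) y E_loop_reverse'[OF assms(2) w] by (simp add: section_at_def)
  then show "E (Suc m) (reversepath a) w = ?y"
    using E_loop_reverse_eq[OF assms(1), of "Suc m" ?y w] y by simp
qed

lemma section_at_comm:
  assumes "loop_in 0 (f v) a" "loop_in 0 (f v) b" "loop_in 0 v a'" "loop_in 0 v b'"
    "section_at a v a'" "section_at b v b'"
  shows "section_at (comm_loop a b) v (comm_loop a' b')"
  unfolding section_at_def
proof (intro allI impI)
  fix m w assume w: "(f ^^ m) w = v"
  have rev: "section_at (reversepath a) v (reversepath a')" "section_at (reversepath b) v (reversepath b')"
    using section_at_reverse assms by blast+
  have fib: "(f ^^ m) (E m a' w) = v" "(f ^^ m) (E m b' (E m a' w)) = v"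
    "(f ^^ m) (E m (reversepath a') (E m b' (E m a' w))) = v"
    using E_loop_fiber assms w by simp_all
  show "E (Suc m) (comm_loop a b) w = E m (comm_loop a' b') w"
    using assms(5,6) rev fib w
    by (simp add: E_comm[OF assms(1,2)] E_comm[OF assms(3,4)] section_at_def)
qed

lemma trivial_at_fixed: "trivial_at a v \<Longrightarrow> E 1 a v = v"
  unfolding trivial_at_def by (metis One_nat_def funpow_0)

lemma trivial_at_reverse:
  assumes "loop_in 0 (f v) a" "trivial_at a v"
  shows "trivial_at (reversepath a) v"
  unfolding trivial_at_def
proof (intro allI impI)
  fix m w assume w: "(f ^^ m) w = v"
  then show "E (Suc m) (reversepath a) w = w"
    using E_loop_reverse_eq[OF assms(1), of "Suc m" w w] assms(2) by (simp add: trivial_at_def)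
qed

text \<open>Both loops fix \<open>u\<close>, so the section of the commutator at \<open>u\<close> is
  the commutator of the sections, which cancels when one of them is trivial.\<close>

lemma trivial_at_comm:
  assumes "loop_in 0 (f u) a" "loop_in 0 (f u) b" "E 1 a u = u" "E 1 b u = u"
    "trivial_at a u \<or> trivial_at b u"
  shows "trivial_at (comm_loop a b) u"
  unfolding trivial_at_def
proof (intro allI impI)
  fix m w assume w: "(f ^^ m) w = u"
  have a: "path_in (Om 0) a" "pathstart a = f u" and b: "path_in (Om 0) b" "pathstart b = f u"
    using assms by (auto simp: loop_in_def)
  have wa: "(f ^^ m) (E (Suc m) a w) = u" using E_Suc_parent[OF a(1) w] a assms by simp
  have wb: "(f ^^ m) (E (Suc m) b w) = u" using E_Suc_parent[OF b(1) w] b assms by simp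
  have Sw: "(f ^^ Suc m) w = f u" using w by simp
  have comm: "E (Suc m) (comm_loop a b) w =
    E (Suc m) (reversepath b) (E (Suc m) (reversepath a) (E (Suc m) b (E (Suc m) a w)))"
    by (rule E_comm[OF assms(1,2) Sw])
  from assms(5) show "E (Suc m) (comm_loop a b) w = w"
  proof
    assume t: "trivial_at a u"
    have 1: "E (Suc m) a w = w" using t w by (simp add: trivial_at_def)
    have 2: "E (Suc m) (reversepath a) (E (Suc m) b w) = E (Suc m) b w"
      using trivial_at_reverse[OF assms(1) t] wb by (simp add: trivial_at_def)
    show ?thesis unfolding comm 1 2 by (rule E_loop_reverse[OF assms(2) Sw])
  next
    assume t: "trivial_at b u"
    have 1: "E (Suc m) b (E (Suc m) a w) = E (Suc m) a w" using t wa by (simp add: trivial_at_def)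
    have 2: "E (Suc m) (reversepath a) (E (Suc m) a w) = w" by (rule E_loop_reverse[OF assms(1) Sw])
    show ?thesis unfolding comm 1 2
      using trivial_at_reverse[OF assms(2) t] w by (simp add: trivial_at_def)
  qed
qed

text \<open>The critical values in the plane are \<open>0\<close> and \<open>q\<close>, so over
  \<open>v\<close> all roots are simple.\<close>

lemma card_fiber:
  assumes "v \<in> Om 0"
  shows "card {u. f u = v} = degree p"
proof -
  let ?P = "p + [:- v:]"
  have deg: "degree ?P = degree p" using degree_ge by (intro degree_add_eq_left) simp
  have "rsquarefree ?P" unfolding rsquarefree_roots
  proof (intro allI notI)
    fix a assume a: "poly ?P a = 0 \<and> poly (pderiv ?P) a = 0"
    then have "f a = v" "a = c \<or> a = q" using critical by (simp_all add: pderiv_add pderiv_pCons)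
    then show False using assms zeros q_fixed by (auto simp: Om_0)
  qed
  then have "degree (smult (lead_coeff ?P) (\<Prod>z|poly ?P z = 0. [:-z, 1:])) = degree p"
    using complex_poly_decompose_rsquarefree[of ?P] deg by simp
  moreover have "lead_coeff ?P \<noteq> 0"
  proof
    assume "lead_coeff ?P = 0"
    then have "degree ?P = 0" by (simp only: leading_coeff_0_iff degree_0)
    then show False using deg degree_ge by linarith
  qed
  ultimately have "degree (\<Prod>z|poly ?P z = 0. [:-z, 1:]) = degree p"
    by (simp only: degree_smult_eq if_False)
  moreover have "degree (\<Prod>z|poly ?P z = 0. [:-z, 1:]) = (\<Sum>z|poly ?P z = 0. 1)"
    by (subst degree_prod_sum_eq) auto
  moreover have "{z. poly ?P z = 0} = {u. f u = v}" by auto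
  ultimately show ?thesis by simp
qed

text \<open>Degree at least three enters here. The spare child completes three-cycles and gives room
  to move one section away from another.\<close>

lemma third_child:
  assumes "v \<in> Om 0"
  obtains u where "f u = v" "u \<noteq> a" "u \<noteq> b"
proof -
  have "card {a, b} \<le> 2" by (simp add: card_insert_if)
  then have "\<not> {u. f u = v} \<subseteq> {a, b}"
    using card_mono[of "{a, b}" "{u. f u = v}"] card_fiber[OF assms] degree_ge by auto
  then show ?thesis using that by blast
qed

end

context exceptional_discs
begin

section \<open>Loops that run to the critical fixed point and turn there\<close>

definition conj_loop :: "(real \<Rightarrow> complex) \<Rightarrow> (real \<Rightarrow> complex) \<Rightarrow> real \<Rightarrow> complex" where
  "conj_loop \<alpha> \<kappa> = \<alpha> +++ (\<kappa> +++ reversepath \<alpha>)"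

text \<open>Only the tail needs the depth index, since \<open>D - {q}\<close> lies in every
  \<open>Om n\<close>. The turn \<open>\<kappa>\<close> is an arbitrary loop rather than one circle,
  because each push by \<open>f\<close> doubles its winding number around \<open>q\<close>.\<close>

definition tail_loop :: "nat \<Rightarrow> complex \<Rightarrow> (real \<Rightarrow> complex) \<Rightarrow> (real \<Rightarrow> complex) \<Rightarrow> bool" where
  "tail_loop n v \<alpha> \<kappa> \<longleftrightarrow> path_in (Om n) \<alpha> \<and> pathstart \<alpha> = v \<and> path_in (D - {q}) \<kappa> \<and>
     pathstart \<kappa> = pathfinish \<alpha> \<and> pathfinish \<kappa> = pathfinish \<alpha>"

lemma f_punctured: "x \<in> D - {q} \<Longrightarrow> f x \<in> D - {q}"
  using V_q D_subset_V D_invariant by blast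

text \<open>\<open>D\<close> is forward invariant and avoids \<open>0\<close>, and inside
  \<open>V\<close> only \<open>q\<close> itself maps to \<open>q\<close>.\<close>

lemma punctured_subset_Om: "D - {q} \<subseteq> Om n"
proof
  fix x show "x \<in> D - {q} \<Longrightarrow> x \<in> Om n"
  proof (induction n arbitrary: x)
    case 0 then show ?case using D_zero by (auto simp: Om_0)
  next
    case (Suc n)
    then show ?case using f_punctured mem_Om_Suc by blast
  qed
qed

lemma tail_path: "tail_loop n v \<alpha> \<kappa> \<Longrightarrow> path_in (Om n) \<kappa>"
  using punctured_subset_Om path_in_mono unfolding tail_loop_def by blast

lemma tail_loop_in: "tail_loop n v \<alpha> \<kappa> \<Longrightarrow> loop_in n v (conj_loop \<alpha> \<kappa>)"
  using tail_path[of n v \<alpha> \<kappa>] unfolding loop_in_def conj_loop_def tail_loop_def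
  by (auto intro!: path_in_join)

lemma E_conj:
  assumes "tail_loop n v \<alpha> \<kappa>" "(f ^^ m) w = v"
  shows "E m (conj_loop \<alpha> \<kappa>) w = E m (reversepath \<alpha>) (E m \<kappa> (E m \<alpha> w))"
proof -
  have a: "path_in (Om 0) \<alpha>" "pathstart \<alpha> = v" and k: "path_in (Om 0) \<kappa>" "pathstart \<kappa> = pathfinish \<alpha>"
    "pathfinish \<kappa> = pathfinish \<alpha>"
    using assms(1) tail_path path_in_Om_0 unfolding tail_loop_def by blast+
  have ka: "path_in (Om 0) (\<kappa> +++ reversepath \<alpha>)" using a k by (intro path_in_join) auto
  have "(f ^^ m) (E m \<alpha> w) = pathfinish \<alpha>" using E_fiber[OF a(1)] a assms by simp
  then show ?thesis unfolding conj_loop_def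
    using E_join[OF a(1) ka, of m w] E_join[OF k(1), of "reversepath \<alpha>" m "E m \<alpha> w"] a k assms by simp
qed

text \<open>By connectedness the lift cannot leave the member of \<open>W\<close> in which it
  starts, and injectivity of \<open>f\<close> there makes it close up.\<close>

lemma lift_outside_V_closed:
  assumes "path_in (D - {q}) \<kappa>" "pathfinish \<kappa> = pathstart \<kappa>" "f y = pathstart \<kappa>" "y \<notin> V"
    "lift_of 1 \<kappa> h" "pathstart h = y"
  obtains B where "B \<in> W" "path_in B h" "pathfinish h = y"
proof -
  have h: "path h" "\<And>s. s \<in> {0..1} \<Longrightarrow> f (h s) = \<kappa> s" using assms(5) by (simp_all add: lift_of_def)
  have im: "path_image h \<subseteq> f -` D"
    using h(2) path_in_image[OF assms(1)] by (auto simp: path_image_def)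
  have "y \<in> f -` D" using im assms(6) pathstart_in_path_image by blast
  then obtain B where B: "B \<in> W" "y \<in> B" using cover assms(4) by blast
  have "path_image h \<subseteq> B \<union> (V \<union> \<Union> (W - {B}))" using im cover by blast
  moreover have "open (V \<union> \<Union> (W - {B}))" using V_open W_ball by blast
  moreover have "B \<inter> (V \<union> \<Union> (W - {B})) = {}" using W_disjoint W_ball B by blast
  ultimately have hB: "path_image h \<subseteq> B"
    using path_stays[of h B "V \<union> \<Union> (W - {B})"] h(1) W_ball B assms(6) by blast
  moreover have "f (pathfinish h) = f y"
    using lift_finish[OF assms(5)] assms by simp
  ultimately have "pathfinish h = y"
    using W_ball[OF B(1)] B(2) pathfinish_in_path_image unfolding inj_on_def by blast
  then show ?thesis using that B h(1) hB by (simp add: path_in_def)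
qed

text \<open>The tail takes \<open>u\<close> into a convex member of \<open>W\<close>, where the turn
  lifts to a null-homotopic loop. So the turn fixes everything below, and the tail is merely
  retraced.\<close>

lemma tail_loop_trivial:
  assumes "tail_loop n v \<alpha> \<kappa>" "f u = v" "E 1 \<alpha> u \<notin> V"
  shows "trivial_at (conj_loop \<alpha> \<kappa>) u"
  unfolding trivial_at_def
proof (intro allI impI)
  fix m w assume w: "(f ^^ m) w = u"
  have a: "path_in (Om 0) \<alpha>" "pathstart \<alpha> = v" and k: "path_in (Om 0) \<kappa>" "pathstart \<kappa> = pathfinish \<alpha>"
    "pathfinish \<kappa> = pathfinish \<alpha>" "path_in (D - {q}) \<kappa>"
    using assms(1) tail_path path_in_Om_0 unfolding tail_loop_def by blast+
  let ?y = "E 1 \<alpha> u" and ?w = "E (Suc m) \<alpha> w"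
  have y: "f ?y = pathstart \<kappa>" using E_fiber[OF a(1), of 1 u] a k assms by simp
  have w1: "(f ^^ m) ?w = ?y" using E_Suc_parent[OF a(1) w] a assms by simp
  obtain h where h: "lift_of 1 \<kappa> h" "pathstart h = ?y" using lift_exists[OF k(1), of 1 ?y] y by auto
  obtain B where B: "B \<in> W" "path_in B h" "pathfinish h = ?y"
    using lift_outside_V_closed[OF k(4) _ y assms(3) h] k by metis
  have "E (m + 1) \<kappa> ?w = E m h ?w" using E_add[OF k(1) h(1), of m ?w] h w1 by simp
  also have "\<dots> = ?w" using W_ball[OF B(1)] B h w1 by (intro E_null[of B]) auto
  finally have "E (Suc m) \<kappa> ?w = ?w" by simp
  then show "E (Suc m) (conj_loop \<alpha> \<kappa>) w = w"
    using E_conj[OF assms(1), of "Suc m" w] w assms(2) E_reverse[OF a(1), of "Suc m" w] a by simp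
qed

lemma f_conj_loop: "f \<circ> conj_loop \<alpha> \<kappa> = conj_loop (f \<circ> \<alpha>) (f \<circ> \<kappa>)"
  by (simp add: conj_loop_def path_compose_join path_compose_reversepath)

text \<open>\<open>f\<close> maps \<open>D - {q}\<close> into itself, so the image is a loop of the
  same kind one level nearer to the root, and the original loop is its lift starting at
  \<open>v\<close>.\<close>

lemma tail_loop_push:
  assumes "tail_loop (Suc n) v \<alpha> \<kappa>"
  shows "tail_loop n (f v) (f \<circ> \<alpha>) (f \<circ> \<kappa>)"
    and "section_at (conj_loop (f \<circ> \<alpha>) (f \<circ> \<kappa>)) v (conj_loop \<alpha> \<kappa>)"
proof -
  have "path_image (f \<circ> \<kappa>) \<subseteq> D - {q}"
    using assms f_punctured by (auto simp: tail_loop_def path_in_def path_image_compose)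
  moreover have "path (f \<circ> \<kappa>)"
    using assms by (auto simp: tail_loop_def path_in_def intro!: path_continuous_image continuous_intros)
  ultimately show t: "tail_loop n (f v) (f \<circ> \<alpha>) (f \<circ> \<kappa>)"
    using assms path_in_image_f by (auto simp: tail_loop_def path_in_def[of "D - {q}"] pathstart_compose pathfinish_compose)
  show "section_at (conj_loop (f \<circ> \<alpha>) (f \<circ> \<kappa>)) v (conj_loop \<alpha> \<kappa>)"
    unfolding section_at_def
  proof (intro allI impI)
    fix m w assume w: "(f ^^ m) w = v"
    have l: "loop_in (Suc n) v (conj_loop \<alpha> \<kappa>)" by (rule tail_loop_in[OF assms])
    have "path_in (Om 0) (conj_loop (f \<circ> \<alpha>) (f \<circ> \<kappa>))"
      using tail_loop_in[OF t] path_in_Om_0 unfolding loop_in_def by blast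
    moreover have "lift_of 1 (conj_loop (f \<circ> \<alpha>) (f \<circ> \<kappa>)) (conj_loop \<alpha> \<kappa>)"
      using lift_iterate[of "conj_loop \<alpha> \<kappa>" 1] l unfolding f_conj_loop[symmetric]
      by (simp add: loop_in_def path_in_def)
    ultimately have "E (m + 1) (conj_loop (f \<circ> \<alpha>) (f \<circ> \<kappa>)) w = E m (conj_loop \<alpha> \<kappa>) w"
      using l w by (intro E_add) (auto simp: loop_in_def)
    then show "E (Suc m) (conj_loop (f \<circ> \<alpha>) (f \<circ> \<kappa>)) w = E m (conj_loop \<alpha> \<kappa>) w" by simp
  qed
qed

text \<open>Besides \<open>v\<close>, the tail carries at most one sibling \<open>u'\<close> into
  \<open>V\<close>, because \<open>f\<close> is at most two-to-one there. A permutation of the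
  children that fixes all of them except possibly \<open>u'\<close> also fixes
  \<open>u'\<close>.\<close>

lemma tail_loop_push_trivial:
  assumes "tail_loop (Suc n) v \<alpha> \<kappa>"
  obtains u' where "\<And>u. f u = f v \<Longrightarrow> u \<noteq> v \<Longrightarrow> u \<noteq> u' \<Longrightarrow> trivial_at (conj_loop (f \<circ> \<alpha>) (f \<circ> \<kappa>)) u"
    "\<And>u. f u = f v \<Longrightarrow> E 1 (conj_loop (f \<circ> \<alpha>) (f \<circ> \<kappa>)) u = u"
proof -
  let ?\<alpha> = "f \<circ> \<alpha>" and ?g = "conj_loop (f \<circ> \<alpha>) (f \<circ> \<kappa>)"
  have t: "tail_loop n (f v) ?\<alpha> (f \<circ> \<kappa>)" by (rule tail_loop_push[OF assms])
  have a: "path_in (Om 0) ?\<alpha>" "pathstart ?\<alpha> = f v"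
    using t path_in_Om_0 by (auto simp: tail_loop_def)
  have l: "loop_in 0 (f v) ?g" using tail_loop_in[OF t] loop_in_0 by blast
  have "E 1 ?\<alpha> v = pathfinish \<alpha>"
    using E_path_image[of n \<alpha>] assms by (simp add: tail_loop_def)
  moreover have "pathfinish \<alpha> \<in> D"
    using assms path_in_start[of "D - {q}" \<kappa>] by (simp add: tail_loop_def)
  ultimately have v: "E 1 ?\<alpha> v \<in> V" using D_subset_V by auto
  obtain u' where u': "\<And>u. f u = f v \<Longrightarrow> u \<noteq> v \<Longrightarrow> E 1 ?\<alpha> u \<in> V \<Longrightarrow> u = u'"
  proof -
    have "u1 = u2" if "f u1 = f v" "u1 \<noteq> v" "E 1 ?\<alpha> u1 \<in> V" "f u2 = f v" "u2 \<noteq> v" "E 1 ?\<alpha> u2 \<in> V" for u1 u2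
    proof -
      have fib: "f (E 1 ?\<alpha> u) = pathfinish ?\<alpha>" if "f u = f v" for u
        using E_fiber[OF a(1), of 1 u] a(2) that by simp
      have inj: "u = x" if "f u = f v" "f x = f v" "E 1 ?\<alpha> u = E 1 ?\<alpha> x" for u x
        using E_inj[OF a(1), of 1 u x] a(2) that by simp
      show ?thesis
        using V_fiber[OF that(3) that(6) v] fib that inj by metis
    qed
    then show ?thesis using that by metis
  qed
  have triv: "trivial_at ?g u" if "f u = f v" "u \<noteq> v" "u \<noteq> u'" for u
    using tail_loop_trivial[OF t] u' that by blast
  have gv: "E 1 ?g v = v"
  proof -
    have 0: "E 0 (conj_loop \<alpha> \<kappa>) v = v"
      using E_0[of "conj_loop \<alpha> \<kappa>"] tail_loop_in[OF assms] path_in_Om_0 by (metis loop_in_def)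
    show ?thesis using tail_loop_push(2)[OF assms] 0 unfolding section_at_def
      by (metis One_nat_def funpow_0)
  qed
  have fixed: "E 1 ?g u = u" if "f u = f v" for u
  proof (rule ccontr)
    assume ne: "E 1 ?g u \<noteq> u"
    have inj: "x = y" if "f x = f v" "f y = f v" "E 1 ?g x = E 1 ?g y" for x y
      using E_inj[of ?g 1 x y] l that by (simp add: loop_in_def)
    have fib: "f (E 1 ?g u) = f v" using E_loop_fiber[OF l, of 1 u] that by simp
    have fx: "E 1 ?g x = x" if "f x = f v" "x \<noteq> u'" for x
      using triv[OF that(1)] gv that trivial_at_fixed by metis
    have "u = u'" using fx that ne by blast
    then have "E 1 ?g (E 1 ?g u) = E 1 ?g u" using fx fib ne by blast
    then show False using inj fib that ne by blast
  qed
  show ?thesis using that triv fixed by blast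
qed

text \<open>The turn is the image of a path in \<open>D - {q}\<close> between two points
  \<open>x\<close>, \<open>y\<close> with equal image, an odd number of half turns in the square
  coordinate. It carries \<open>x\<close> to \<open>y\<close>, so \<open>y\<close> can only go to
  \<open>x\<close>, the other point of its fibre in \<open>V\<close>. Double transitivity supplies a
  tail that takes \<open>u\<close>, \<open>u'\<close> to \<open>x\<close>, \<open>y\<close>.\<close>

lemma transposition_loop:
  assumes "u \<in> Om (Suc n)" "f u' = f u" "u \<noteq> u'"
  obtains \<alpha> \<kappa> where "tail_loop n (f u) \<alpha> \<kappa>" "E 1 (conj_loop \<alpha> \<kappa>) u = u'" "E 1 (conj_loop \<alpha> \<kappa>) u' = u"
    "\<And>x. f x = f u \<Longrightarrow> x \<noteq> u \<Longrightarrow> x \<noteq> u' \<Longrightarrow> trivial_at (conj_loop \<alpha> \<kappa>) x"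
proof -
  obtain x y where xy: "x \<in> D" "y \<in> D" "x \<noteq> y" "f x = f y" using twins by blast
  have "x \<noteq> q"
  proof
    assume "x = q"
    then have "f y = q" using xy(4) q_fixed by simp
    then show False using V_q[of y] xy(2,3) D_subset_V \<open>x = q\<close> by auto
  qed
  moreover have "y \<noteq> q"
  proof
    assume "y = q"
    then have "f x = q" using xy(4) q_fixed by simp
    then show False using V_q[of x] xy(1,3) D_subset_V \<open>y = q\<close> by auto
  qed
  ultimately have xyD: "x \<in> D - {q}" "y \<in> D - {q}" using xy by auto
  have pc: "path_connected (D - {q})"
    using path_connected_open_diff_countable[of D "{q}"] D_open D_connected by simp
  have xV: "x \<in> V" "y \<in> V" using xy D_subset_V by blast+
  obtain h where h: "path h" "path_image h \<subseteq> D - {q}" "pathstart h = x" "pathfinish h = y"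
    using pc xyD unfolding path_connected_def by meson
  obtain \<alpha> where \<alpha>: "path_in (Om n) \<alpha>" "pathstart \<alpha> = f u" "pathfinish \<alpha> = f x" "E 1 \<alpha> u = x" "E 1 \<alpha> u' = y"
  proof (rule two_transitive[of u n u' x y])
    show "x \<in> Om (Suc n)" using xyD punctured_subset_Om by blast
  qed (use assms xy in auto)
  define \<kappa> where "\<kappa> = f \<circ> h"
  have hOm: "path_in (Om (Suc n)) h" using h(1,2) punctured_subset_Om by (auto simp: path_in_def)
  have "path_image \<kappa> \<subseteq> D - {q}" using h f_punctured by (auto simp: \<kappa>_def path_image_compose)
  then have t: "tail_loop n (f u) \<alpha> \<kappa>"
    using \<alpha> path_in_image_f[OF hOm] h xy
    by (auto simp: tail_loop_def path_in_def \<kappa>_def pathstart_compose pathfinish_compose)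
  have \<alpha>0: "path_in (Om 0) \<alpha>" and \<kappa>0: "path_in (Om 0) \<kappa>"
    using \<alpha>(1) path_in_Om_0 tail_path[OF t] by blast+
  have ks: "pathstart \<kappa> = f x" "pathfinish \<kappa> = f x"
    using h xy by (simp_all add: \<kappa>_def pathstart_compose pathfinish_compose)
  have rev: "E 1 (reversepath \<alpha>) x = u" "E 1 (reversepath \<alpha>) y = u'"
    using E_reverse[OF \<alpha>0, of 1 u] E_reverse[OF \<alpha>0, of 1 u'] \<alpha> assms by auto
  have kx: "E 1 \<kappa> x = y" using E_path_image[OF hOm] h by (simp add: \<kappa>_def)
  have ky: "E 1 \<kappa> y = x"
  proof -
    obtain k where k: "lift_of 1 \<kappa> k" "pathstart k = y" using lift_exists[OF \<kappa>0, of 1 y] ks xy by auto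
    have kf: "E 1 \<kappa> y = pathfinish k" using E_lift[OF \<kappa>0 k(1)] k by simp
    have "path_image k \<subseteq> f -` D"
      using k(1) \<open>path_image \<kappa> \<subseteq> D - {q}\<close> by (fastforce simp: lift_of_def path_image_def)
    then have "path_image k \<subseteq> V \<union> \<Union> W" using cover by blast
    moreover have "open (\<Union> W)" "V \<inter> \<Union> W = {}" using W_ball by blast+
    moreover have "path k" using k by (simp add: lift_of_def)
    moreover have "pathstart k \<in> V" using k xy D_subset_V by blast
    ultimately have "path_image k \<subseteq> V" using path_stays[of k V "\<Union> W"] V_open by blast
    then have fV: "pathfinish k \<in> V" using pathfinish_in_path_image[of k] by blast
    have "f (pathfinish k) = f x" using lift_finish[OF k(1)] ks by simp
    then have "pathfinish k = x \<or> pathfinish k = y"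
      using V_fiber[OF fV xV(2) xV(1) _ xy(4)[symmetric]] xy(3) by blast
    moreover have "pathfinish k \<noteq> y"
    proof
      assume "pathfinish k = y"
      then have "E 1 \<kappa> x = E 1 \<kappa> y" using kx kf by simp
      moreover have "(f ^^ 1) x = pathstart \<kappa>" "(f ^^ 1) y = pathstart \<kappa>" using ks(1) xy(4) by simp_all
      ultimately show False using E_inj[OF \<kappa>0] xy(3) by blast
    qed
    ultimately show ?thesis using kf by simp
  qed
  show ?thesis
  proof (rule that[OF t])
    show "E 1 (conj_loop \<alpha> \<kappa>) u = u'" using E_conj[OF t, of 1 u] \<alpha> kx rev by simp
    show "E 1 (conj_loop \<alpha> \<kappa>) u' = u" using E_conj[OF t, of 1 u'] \<alpha> ky rev assms by simp
    fix z assume z: "f z = f u" "z \<noteq> u" "z \<noteq> u'"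
    have "E 1 \<alpha> z \<notin> V"
    proof
      assume "E 1 \<alpha> z \<in> V"
      moreover have "f (E 1 \<alpha> z) = f x" using E_fiber[OF \<alpha>0, of 1 z] \<alpha> z by simp
      ultimately have "E 1 \<alpha> z = x \<or> E 1 \<alpha> z = y"
        using V_fiber[OF _ xV(2) xV(1) _ xy(4)[symmetric]] xy(3) by blast
      moreover have "(f ^^ 1) z = pathstart \<alpha>" "(f ^^ 1) u = pathstart \<alpha>" "(f ^^ 1) u' = pathstart \<alpha>"
        using \<alpha>(2) z(1) assms(2) by simp_all
      ultimately show False using E_inj[OF \<alpha>0, of 1 z] \<alpha>(4,5) z(2,3) by metis
    qed
    then show "trivial_at (conj_loop \<alpha> \<kappa>) z" using tail_loop_trivial[OF t z(1)] by blast
  qed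
qed

end

section \<open>Loops supported below a vertex\<close>

context exceptional_discs
begin

text \<open>The action of \<open>b\<close> below \<open>v\<close>, extended by the identity, is
  realised by the loop \<open>g\<close> at the root. Levels from \<open>n\<close> on are enough, as
  they determine those nearer to the root.\<close>

definition acts_below :: "nat \<Rightarrow> complex \<Rightarrow> (real \<Rightarrow> complex) \<Rightarrow> complex \<Rightarrow> (real \<Rightarrow> complex) \<Rightarrow> bool" where
  "acts_below n v b t g \<longleftrightarrow> loop_in 0 t g \<and>
     (\<forall>m w. (f ^^ (m + n)) w = t \<longrightarrow> E (m + n) g w = (if (f ^^ m) w = v then E m b w else w))"

text \<open>Prepending a loop to the tail conjugates by it, so conjugates stay within the class of
  loops considered.\<close>

lemma conj_loop_join:
  assumes "tail_loop n v \<alpha> \<kappa>" "loop_in n v g"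
  shows "tail_loop n v (g +++ \<alpha>) \<kappa>"
    and "(f ^^ m) w = v \<Longrightarrow> E m (conj_loop (g +++ \<alpha>) \<kappa>) w = E m (reversepath g) (E m (conj_loop \<alpha> \<kappa>) (E m g w))"
proof -
  show t: "tail_loop n v (g +++ \<alpha>) \<kappa>"
    using assms by (auto simp: tail_loop_def loop_in_def)
  have g: "loop_in 0 v g" using assms loop_in_0 by blast
  have a: "path_in (Om 0) \<alpha>" "pathstart \<alpha> = v" and k: "path_in (Om 0) \<kappa>" "pathstart \<kappa> = pathfinish \<alpha>"
    "pathfinish \<kappa> = pathfinish \<alpha>"
    using assms(1) tail_path path_in_Om_0 unfolding tail_loop_def by blast+
  assume w: "(f ^^ m) w = v"
  have gw: "(f ^^ m) (E m g w) = v" using E_loop_fiber[OF g w] .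
  have rev: "reversepath (g +++ \<alpha>) = reversepath \<alpha> +++ reversepath g"
    using a g by (simp add: reversepath_joinpaths loop_in_def)
  have j: "E m (g +++ \<alpha>) w = E m \<alpha> (E m g w)"
  proof (rule E_join)
    show "(f ^^ m) w = pathstart g" "path_in (Om 0) g" "pathfinish g = pathstart \<alpha>"
      using g a w by (simp_all add: loop_in_def)
  qed (rule a)
  have aw: "(f ^^ m) (E m \<alpha> (E m g w)) = pathfinish \<alpha>" using E_fiber[OF a(1)] a gw by simp
  then have "(f ^^ m) (E m \<kappa> (E m \<alpha> (E m g w))) = pathfinish \<alpha>" using E_fiber[OF k(1)] k by simp
  then show "E m (conj_loop (g +++ \<alpha>) \<kappa>) w = E m (reversepath g) (E m (conj_loop \<alpha> \<kappa>) (E m g w))"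
    unfolding E_conj[OF t w] E_conj[OF assms(1) gw] j rev
    by (intro E_join) (use a g in \<open>simp_all add: loop_in_def\<close>)
qed

text \<open>Besides \<open>v\<close>, the pushed loop is nontrivial at one child at most. If that is \<open>x\<close>, it is moved
  away from \<open>x\<close> by conjugation with a transposition of children that is trivial at \<open>v\<close>.\<close>

lemma separate_sections:
  assumes v: "v \<in> Om (Suc n)" and t: "tail_loop (Suc n) v \<alpha> \<kappa>"
  obtains \<alpha>' \<kappa>' where "tail_loop n (f v) \<alpha>' \<kappa>'" "section_at (conj_loop \<alpha>' \<kappa>') v (conj_loop \<alpha> \<kappa>)"
    "\<And>u. f u = f v \<Longrightarrow> E 1 (conj_loop \<alpha>' \<kappa>') u = u"
    "\<And>u. f u = f v \<Longrightarrow> u \<noteq> v \<Longrightarrow> u = x \<Longrightarrow> trivial_at (conj_loop \<alpha>' \<kappa>') u"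
proof -
  let ?A = "f \<circ> \<alpha>" and ?K = "f \<circ> \<kappa>"
  note push = tail_loop_push[OF t]
  obtain u' where u': "\<And>u. f u = f v \<Longrightarrow> u \<noteq> v \<Longrightarrow> u \<noteq> u' \<Longrightarrow> trivial_at (conj_loop ?A ?K) u"
    "\<And>u. f u = f v \<Longrightarrow> E 1 (conj_loop ?A ?K) u = u"
    using tail_loop_push_trivial[OF t] by blast
  show ?thesis
  proof (cases "u' = x \<and> f x = f v \<and> x \<noteq> v")
    case False
    then show ?thesis using that[OF push u'(2)] u'(1) by blast
  next
    case True
    then have x: "u' = x" "f x = f v" "x \<noteq> v" by auto
    have fv: "f v \<in> Om n" "f v \<in> Om 0" using v mem_Om_Suc Om_subset by blast+
    obtain y where y: "f y = f v" "y \<noteq> v" "y \<noteq> x" using third_child[OF fv(2)] by blast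
    have xOm: "x \<in> Om (Suc n)" using fv x by (simp add: mem_Om_Suc)
    have yx: "f y = f x" "x \<noteq> y" "f v = f x" "v \<noteq> x" "v \<noteq> y" using y x by auto
    obtain \<beta> \<mu> where b: "tail_loop n (f x) \<beta> \<mu>" "E 1 (conj_loop \<beta> \<mu>) x = y"
      "\<And>z. f z = f x \<Longrightarrow> z \<noteq> x \<Longrightarrow> z \<noteq> y \<Longrightarrow> trivial_at (conj_loop \<beta> \<mu>) z"
      using transposition_loop[OF xOm yx(1,2)] by metis
    define g where "g = conj_loop \<beta> \<mu>"
    have gv: "trivial_at g v" unfolding g_def using b(3) yx by blast
    have lg: "loop_in n (f v) g" using tail_loop_in[OF b(1)] x by (simp add: g_def)
    then have lg0: "loop_in 0 (f v) g" by (rule loop_in_0)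
    then have pg: "path_in (Om 0) g" "pathstart g = f v" by (auto simp: loop_in_def)
    note j = conj_loop_join[OF push(1) lg]
    have l: "loop_in 0 v (conj_loop \<alpha> \<kappa>)" using tail_loop_in[OF t] loop_in_0 by blast
    show ?thesis
    proof (rule that[OF j(1)])
      show "section_at (conj_loop (g +++ ?A) ?K) v (conj_loop \<alpha> \<kappa>)"
        unfolding section_at_def
      proof (intro allI impI)
        fix m w assume w: "(f ^^ m) w = v"
        have 1: "E (Suc m) g w = w" using gv w by (simp add: trivial_at_def)
        have 2: "E (Suc m) (conj_loop ?A ?K) w = E m (conj_loop \<alpha> \<kappa>) w"
          using push(2) w by (simp add: section_at_def)
        have 3: "(f ^^ m) (E m (conj_loop \<alpha> \<kappa>) w) = v" by (rule E_loop_fiber[OF l w])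
        have "E (Suc m) (conj_loop (g +++ ?A) ?K) w = E (Suc m) (reversepath g) (E m (conj_loop \<alpha> \<kappa>) w)"
          using j(2)[of "Suc m" w] w 1 2 by simp
        also have "\<dots> = E m (conj_loop \<alpha> \<kappa>) w"
          using trivial_at_reverse[OF lg0 gv] 3 by (simp add: trivial_at_def)
        finally show "E (Suc m) (conj_loop (g +++ ?A) ?K) w = E m (conj_loop \<alpha> \<kappa>) w" .
      qed
      show "E 1 (conj_loop (g +++ ?A) ?K) u = u" if u: "f u = f v" for u
      proof -
        have "f (E 1 g u) = f v" using E_loop_fiber[OF lg0, of 1 u] u by simp
        then show ?thesis using j(2)[of 1 u] u u'(2) E_loop_reverse[OF lg0, of 1 u] by simp
      qed
      show "trivial_at (conj_loop (g +++ ?A) ?K) u" if u: "f u = f v" "u \<noteq> v" "u = x" for u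
        unfolding trivial_at_def
      proof (intro allI impI)
        fix m w assume w: "(f ^^ m) w = u"
        \<comment> \<open>The conjugating loop first carries the subtree below \<open>x\<close> to
          that below \<open>y\<close>, where the pushed loop is trivial.\<close>
        have "E 1 g u = y" using b(2) u by (simp add: g_def)
        then have "(f ^^ m) (E (Suc m) g w) = y" using E_Suc_parent[OF pg(1) w] pg(2) u by simp
        moreover have "trivial_at (conj_loop ?A ?K) y" using u'(1) y x by blast
        ultimately have "E (Suc m) (conj_loop ?A ?K) (E (Suc m) g w) = E (Suc m) g w"
          by (simp add: trivial_at_def)
        then show "E (Suc m) (conj_loop (g +++ ?A) ?K) w = w"
          using j(2)[of "Suc m" w] w u E_loop_reverse[OF lg0, of "Suc m" w] by simp
      qed
    qed
  qed
qed

text \<open>Induction towards the root. The two loops at \<open>v\<close> are sections of pushed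
  loops at \<open>f v\<close>, chosen such that at each sibling of \<open>v\<close> one of them is
  trivial. Hence the loop that the induction hypothesis gives for \<open>f v\<close> serves for
  \<open>v\<close> unchanged.\<close>

lemma commutator_acts_below:
  assumes "(f ^^ n) v = t" "t \<in> Om 0" "tail_loop n v \<alpha> \<kappa>" "tail_loop n v \<beta> \<mu>"
  shows "\<exists>g. acts_below n v (comm_loop (conj_loop \<alpha> \<kappa>) (conj_loop \<beta> \<mu>)) t g"
  using assms
proof (induction n arbitrary: v \<alpha> \<kappa> \<beta> \<mu>)
  case 0
  then show ?case
    by (intro exI[of _ "comm_loop (conj_loop \<alpha> \<kappa>) (conj_loop \<beta> \<mu>)"])
      (auto simp: acts_below_def intro!: loop_in_comm tail_loop_in)
next
  case (Suc n)
  let ?a = "conj_loop (f \<circ> \<alpha>) (f \<circ> \<kappa>)"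
  let ?a' = "conj_loop \<alpha> \<kappa>" and ?b' = "conj_loop \<beta> \<mu>"
  note push = tail_loop_push[OF Suc.prems(3)]
  have v: "v \<in> Om (Suc n)" using Suc.prems by (auto simp: Om_def)
  obtain x where x: "\<And>u. f u = f v \<Longrightarrow> u \<noteq> v \<Longrightarrow> u \<noteq> x \<Longrightarrow> trivial_at ?a u"
    "\<And>u. f u = f v \<Longrightarrow> E 1 ?a u = u"
    using tail_loop_push_trivial[OF Suc.prems(3)] by blast
  obtain \<beta>' \<mu>' where b: "tail_loop n (f v) \<beta>' \<mu>'" "section_at (conj_loop \<beta>' \<mu>') v ?b'"
    "\<And>u. f u = f v \<Longrightarrow> E 1 (conj_loop \<beta>' \<mu>') u = u"
    "\<And>u. f u = f v \<Longrightarrow> u \<noteq> v \<Longrightarrow> u = x \<Longrightarrow> trivial_at (conj_loop \<beta>' \<mu>') u"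
    using separate_sections[OF v Suc.prems(4), of x] by blast
  let ?b = "conj_loop \<beta>' \<mu>'"
  have la: "loop_in 0 (f v) ?a" and lb: "loop_in 0 (f v) ?b"
    using tail_loop_in[OF push(1)] tail_loop_in[OF b(1)] loop_in_0 by blast+
  have la': "loop_in 0 v ?a'" and lb': "loop_in 0 v ?b'"
    using tail_loop_in[OF Suc.prems(3)] tail_loop_in[OF Suc.prems(4)] loop_in_0 by blast+
  have "(f ^^ n) (f v) = t" using Suc.prems(1) by (simp add: funpow_swap1)
  then obtain g where g: "acts_below n (f v) (comm_loop ?a ?b) t g"
    using Suc.IH[OF _ Suc.prems(2) push(1) b(1)] by blast
  have "acts_below (Suc n) v (comm_loop ?a' ?b') t g"
    unfolding acts_below_def
  proof (intro conjI allI impI)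
    show "loop_in 0 t g" using g by (simp add: acts_below_def)
    fix m w assume w: "(f ^^ (m + Suc n)) w = t"
    then have eq: "E (m + Suc n) g w = (if (f ^^ Suc m) w = f v then E (Suc m) (comm_loop ?a ?b) w else w)"
      using g unfolding acts_below_def by (metis add_Suc_shift)
    show "E (m + Suc n) g w = (if (f ^^ m) w = v then E m (comm_loop ?a' ?b') w else w)"
    proof (cases "(f ^^ m) w = v")
      case True
      then show ?thesis
        using section_at_comm[OF la lb la' lb' push(2) b(2)] eq by (simp add: section_at_def)
    next
      case False
      show ?thesis
      proof (cases "f ((f ^^ m) w) = f v")
        case True
        let ?u = "(f ^^ m) w"
        have "trivial_at (comm_loop ?a ?b) ?u"
        proof (rule trivial_at_comm)
          show "trivial_at ?a ?u \<or> trivial_at ?b ?u" using x(1) b(4) True False by blast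
        qed (use la lb True x b in simp_all)
        then show ?thesis using eq False True by (simp add: trivial_at_def)
      qed (use eq False in simp)
    qed
  qed
  then show ?case by blast
qed

text \<open>The commutator of two transpositions with exactly one common point, here
  \<open>x\<close>, is a three-cycle.\<close>

lemma three_cycle_below:
  assumes v: "(f ^^ n) v = t" "t \<in> Om 0"
    and xyz: "f x = v" "f y = v" "f z = v" "x \<noteq> y" "x \<noteq> z" "y \<noteq> z"
  obtains g b where "acts_below n v b t g" "loop_in 0 v b" "E 1 b x = z" "E 1 b z = y" "E 1 b y = x"
    "\<And>u. f u = v \<Longrightarrow> u \<noteq> x \<Longrightarrow> u \<noteq> y \<Longrightarrow> u \<noteq> z \<Longrightarrow> E 1 b u = u"
proof -
  have vOm: "v \<in> Om n" using v by (auto simp: Om_def)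
  have xOm: "x \<in> Om (Suc n)" using vOm xyz by (simp add: mem_Om_Suc)
  obtain \<alpha> \<kappa> where a: "tail_loop n v \<alpha> \<kappa>" "E 1 (conj_loop \<alpha> \<kappa>) x = y" "E 1 (conj_loop \<alpha> \<kappa>) y = x"
    "\<And>u. f u = v \<Longrightarrow> u \<noteq> x \<Longrightarrow> u \<noteq> y \<Longrightarrow> trivial_at (conj_loop \<alpha> \<kappa>) u"
    using transposition_loop[OF xOm, of y] xyz by metis
  obtain \<beta> \<mu> where b: "tail_loop n v \<beta> \<mu>" "E 1 (conj_loop \<beta> \<mu>) x = z" "E 1 (conj_loop \<beta> \<mu>) z = x"
    "\<And>u. f u = v \<Longrightarrow> u \<noteq> x \<Longrightarrow> u \<noteq> z \<Longrightarrow> trivial_at (conj_loop \<beta> \<mu>) u"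
    using transposition_loop[OF xOm, of z] xyz by metis
  let ?a = "conj_loop \<alpha> \<kappa>" and ?b = "conj_loop \<beta> \<mu>"
  obtain g where g: "acts_below n v (comm_loop ?a ?b) t g"
    using commutator_acts_below[OF v a(1) b(1)] by blast
  have la: "loop_in 0 v ?a" and lb: "loop_in 0 v ?b"
    using tail_loop_in[OF a(1)] tail_loop_in[OF b(1)] loop_in_0 by blast+
  have az: "E 1 ?a z = z" using a(4)[of z] xyz trivial_at_fixed by metis
  have b_y: "E 1 ?b y = y" using b(4)[of y] xyz trivial_at_fixed by metis
  have ra: "E 1 (reversepath ?a) w' = w" if "f w = v" "E 1 ?a w = w'" for w w'
    using E_loop_reverse_eq[OF la, of 1 w] that by simp
  have rb: "E 1 (reversepath ?b) w' = w" if "f w = v" "E 1 ?b w = w'" for w w'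
    using E_loop_reverse_eq[OF lb, of 1 w] that by simp
  have comm: "E 1 (comm_loop ?a ?b) w = E 1 (reversepath ?b) (E 1 (reversepath ?a) (E 1 ?b (E 1 ?a w)))"
    if "f w = v" for w using E_comm[OF la lb, of 1 w] that by simp
  note rev = ra[OF xyz(1) a(2)] ra[OF xyz(2) a(3)] ra[OF xyz(3) az]
    rb[OF xyz(1) b(2)] rb[OF xyz(3) b(3)] rb[OF xyz(2) b_y]
  show ?thesis
  proof (rule that[OF g])
    show "loop_in 0 v (comm_loop ?a ?b)" using la lb loop_in_comm by blast
    show "E 1 (comm_loop ?a ?b) x = z" using comm[OF xyz(1)] a b az b_y rev by simp
    show "E 1 (comm_loop ?a ?b) z = y" using comm[OF xyz(3)] a b az b_y rev by simp
    show "E 1 (comm_loop ?a ?b) y = x" using comm[OF xyz(2)] a b az b_y rev by simp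
    fix u assume u: "f u = v" "u \<noteq> x" "u \<noteq> y" "u \<noteq> z"
    have au: "E 1 ?a u = u" using a(4)[of u] u trivial_at_fixed by metis
    have bu: "E 1 ?b u = u" using b(4)[of u] u trivial_at_fixed by metis
    show "E 1 (comm_loop ?a ?b) u = u" using comm[OF u(1)] au bu ra[OF u(1) au] rb[OF u(1) bu] by simp
  qed
qed

text \<open>The loop \<open>?a\<close> is pushed down from \<open>u\<close>, so it fixes the
  children of \<open>v\<close> and acts at \<open>u\<close> as the transposition. The loop
  \<open>?b\<close> moves \<open>u\<close> to a sibling \<open>u3\<close> where \<open>?a\<close> is
  trivial, so in the commutator the inverse of \<open>?a\<close> has no effect below
  \<open>u\<close> and the odd permutation survives.\<close>

lemma child_transposition_below:
  assumes v: "(f ^^ n) v = t" "t \<in> Om 0"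
    and u: "f u = v" and yz: "f y = u" "f z = u" "y \<noteq> z"
  obtains g b where "acts_below n v b t g" "loop_in 0 v b" "\<And>u'. f u' = v \<Longrightarrow> E 1 b u' = u'"
    "E 2 b y = z" "E 2 b z = y" "\<And>x. f x = u \<Longrightarrow> x \<noteq> y \<Longrightarrow> x \<noteq> z \<Longrightarrow> E 2 b x = x"
proof -
  have vOm: "v \<in> Om n" using v by (auto simp: Om_def)
  have v0: "v \<in> Om 0" using vOm Om_subset by blast
  have uOm: "u \<in> Om (Suc n)" using vOm u by (simp add: mem_Om_Suc)
  have yOm: "y \<in> Om (Suc (Suc n))" using uOm yz by (simp add: mem_Om_Suc)
  obtain \<alpha> \<kappa> where a: "tail_loop (Suc n) u \<alpha> \<kappa>" "E 1 (conj_loop \<alpha> \<kappa>) y = z" "E 1 (conj_loop \<alpha> \<kappa>) z = y"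
    "\<And>x. f x = u \<Longrightarrow> x \<noteq> y \<Longrightarrow> x \<noteq> z \<Longrightarrow> trivial_at (conj_loop \<alpha> \<kappa>) x"
    using transposition_loop[OF yOm, of z] yz by metis
  let ?a' = "conj_loop \<alpha> \<kappa>" and ?a = "conj_loop (f \<circ> \<alpha>) (f \<circ> \<kappa>)"
  have push: "tail_loop n v (f \<circ> \<alpha>) (f \<circ> \<kappa>)" "section_at ?a u ?a'" using tail_loop_push[OF a(1)] u by simp_all
  obtain u2 where u2: "\<And>x. f x = v \<Longrightarrow> x \<noteq> u \<Longrightarrow> x \<noteq> u2 \<Longrightarrow> trivial_at ?a x"
    "\<And>x. f x = v \<Longrightarrow> E 1 ?a x = x"
    using tail_loop_push_trivial[OF a(1)] u by metis
  obtain u3 where u3: "f u3 = v" "u3 \<noteq> u" "u3 \<noteq> u2" using third_child[OF v0] by blast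
  obtain \<beta> \<mu> where b: "tail_loop n v \<beta> \<mu>" "E 1 (conj_loop \<beta> \<mu>) u = u3"
    using transposition_loop[OF uOm, of u3] u u3 by metis
  let ?b = "conj_loop \<beta> \<mu>"
  obtain g where g: "acts_below n v (comm_loop ?a ?b) t g"
    using commutator_acts_below[OF v push(1) b(1)] by blast
  have la: "loop_in 0 v ?a" and lb: "loop_in 0 v ?b"
    using tail_loop_in[OF push(1)] tail_loop_in[OF b(1)] loop_in_0 by blast+
  have la': "loop_in 0 u ?a'" using tail_loop_in[OF a(1)] loop_in_0 by blast
  have pb: "path_in (Om 0) ?b" "pathstart ?b = v" using lb by (auto simp: loop_in_def)
  have sect: "E 2 (comm_loop ?a ?b) x = E 1 ?a' x" if x: "f x = u" for x
  proof -
    let ?x = "E 1 ?a' x"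
    have x2: "(f ^^ 2) x = v" using x u by (simp add: numeral_2_eq_2)
    have 1: "E 2 ?a x = ?x" using push(2) x unfolding section_at_def numeral_2_eq_2 by (metis One_nat_def funpow_0 funpow_simps_right(2) comp_apply)
    have fx: "f ?x = u" using E_loop_fiber[OF la', of 1 x] x by simp
    have x2': "(f ^^ 2) ?x = v" using fx u by (simp add: numeral_2_eq_2)
    have "(f ^^ 1) (E (Suc 1) ?b ?x) = E 1 ?b u"
      by (rule E_Suc_parent[OF pb(1)]) (use fx u pb in simp_all)
    then have "f (E 2 ?b ?x) = u3" using b(2) by (simp add: numeral_2_eq_2)
    moreover have "trivial_at (reversepath ?a) u3"
      using trivial_at_reverse[of u3 ?a] u2(1) u3 la by blast
    ultimately have "E 2 (reversepath ?a) (E 2 ?b ?x) = E 2 ?b ?x"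
      unfolding trivial_at_def numeral_2_eq_2 by (metis One_nat_def funpow_0 funpow_simps_right(2) comp_apply)
    then show ?thesis using E_comm[OF la lb x2] 1 E_loop_reverse[OF lb x2'] by simp
  qed
  show ?thesis
  proof (rule that[OF g])
    show "loop_in 0 v (comm_loop ?a ?b)" using la lb loop_in_comm by blast
    show "E 1 (comm_loop ?a ?b) u' = u'" if u': "f u' = v" for u'
    proof -
      have fb: "f (E 1 ?b u') = v" using E_loop_fiber[OF lb, of 1 u'] u' by simp
      have 1: "E 1 ?a (E 1 ?b u') = E 1 ?b u'" by (rule u2(2)[OF fb])
      have "E 1 (reversepath ?a) (E 1 ?b u') = E 1 ?b u'"
        using E_loop_reverse_eq[OF la, of 1 "E 1 ?b u'"] fb 1 by simp
      then show ?thesis using E_comm[OF la lb, of 1 u'] u' u2(2) E_loop_reverse[OF lb, of 1 u'] by simp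
    qed
    show "E 2 (comm_loop ?a ?b) y = z" "E 2 (comm_loop ?a ?b) z = y" using sect yz a by simp_all
    show "E 2 (comm_loop ?a ?b) x = x" if "f x = u" "x \<noteq> y" "x \<noteq> z" for x
      using sect[OF that(1)] trivial_at_fixed a(4)[OF that] by simp
  qed
qed

section \<open>Removing fixed points below a vertex\<close>

definition supported_below :: "nat \<Rightarrow> complex \<Rightarrow> complex \<Rightarrow> (real \<Rightarrow> complex) \<Rightarrow> bool" where
  "supported_below n v t g \<longleftrightarrow> loop_in 0 t g \<and>
     (\<forall>m w. (f ^^ (m + n)) w = t \<longrightarrow> (f ^^ m) w \<noteq> v \<longrightarrow> E (m + n) g w = w)"

lemma acts_below_supported: "acts_below n v b t g \<Longrightarrow> supported_below n v t g"
  by (simp add: acts_below_def supported_below_def)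

lemma supported_below_join:
  assumes "supported_below n v t g" "supported_below n v t h"
  shows "supported_below n v t (g +++ h)"
  using assms by (auto simp: supported_below_def E_loop_join intro: loop_in_join)

text \<open>Joins of paths are associative only up to reparametrisation; the action does not see the
  difference.\<close>

lemma E_loop_assoc:
  assumes "loop_in 0 t a" "loop_in 0 t b" "loop_in 0 t h" "(f ^^ m) w = t"
  shows "E m ((a +++ b) +++ h) w = E m (a +++ (b +++ h)) w"
  using E_loop_join[OF loop_in_join[OF assms(1,2)] assms(3,4)] E_loop_join[OF assms(1,2,4)]
    E_loop_join[OF assms(1) loop_in_join[OF assms(2,3)] assms(4)]
    E_loop_join[OF assms(2,3) E_loop_fiber[OF assms(1,4)]] by simp

text \<open>All vertices of the level other than \<open>v\<close> are fixed by definition, and a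
  permutation cannot move exactly one point.\<close>

lemma supported_below_fixes_level:
  assumes k: "supported_below n v t k" and w: "(f ^^ n) w = t"
  shows "E n k w = w"
proof (rule ccontr)
  assume ne: "E n k w \<noteq> w"
  have l: "loop_in 0 t k" using k by (simp add: supported_below_def)
  have fx: "E n k x = x" if "(f ^^ n) x = t" "x \<noteq> v" for x
    using k that unfolding supported_below_def by (metis add_0 funpow_0)
  have fib: "(f ^^ n) (E n k w) = t" by (rule E_loop_fiber[OF l w])
  have "w = v" using fx w ne by blast
  then have "E n k (E n k w) = E n k w" using fx fib ne by blast
  then have "E n k w = w" using E_inj[of k n "E n k w" w] l fib w by (simp add: loop_in_def)
  then show False using ne by blast
qed

lemma supported_below_parent:
  assumes k: "supported_below (Suc n) u t k"
  shows "supported_below n (f u) t k"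
  unfolding supported_below_def
proof (intro conjI allI impI)
  show l: "loop_in 0 t k" using k by (simp add: supported_below_def)
  fix m w assume w: "(f ^^ (m + n)) w = t" "(f ^^ m) w \<noteq> f u"
  show "E (m + n) k w = w"
  proof (cases m)
    case 0
    \<comment> \<open>The hypothesis starts on level \<open>Suc n\<close> only; level
      \<open>n\<close> is reached through a child \<open>w'\<close> of \<open>w\<close>, which is
      fixed.\<close>
    obtain w' where w': "f w' = w" using surj_iterate[of 1 w] by auto
    have Sw: "(f ^^ Suc n) w' = t" using w w' 0 by (simp add: funpow_swap1)
    have "E (Suc n) k w' = w'" by (rule supported_below_fixes_level[OF k Sw])
    then have "w = E n k w"
      using E_image[of k 1 n w'] l Sw w' by (simp add: loop_in_def)
    then show ?thesis using 0 by simp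
  next
    case (Suc m')
    then have "(f ^^ m') w \<noteq> u" using w(2) by auto
    then have "E (m' + Suc n) k w = w"
      using k w(1) Suc unfolding supported_below_def by simp
    then show ?thesis using Suc by simp
  qed
qed

lemma constant_supported: "t \<in> Om 0 \<Longrightarrow> supported_below n v t (linepath t t)"
  unfolding supported_below_def loop_in_def
  by (auto simp: path_in_def intro!: E_null[of "{t}"])

text \<open>While two children \<open>x\<close>, \<open>y\<close> are fixed, a three-cycle sending
  \<open>x\<close> to \<open>z\<close>, \<open>z\<close> to \<open>y\<close> and \<open>y\<close> to
  \<open>x\<close> is put before \<open>g\<close>. Then none of \<open>x\<close>, \<open>y\<close>,
  \<open>z\<close> is fixed and the other children behave as before, so the number of fixed children
  drops.\<close>

lemma reduce_fixed_children:
  assumes v: "(f ^^ n) v = t" "t \<in> Om 0" and g: "loop_in 0 t g"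
  shows "\<exists>k. supported_below n v t k \<and>
    (\<forall>x y. f x = v \<longrightarrow> f y = v \<longrightarrow> E (Suc n) (k +++ g) x = x \<longrightarrow> E (Suc n) (k +++ g) y = y \<longrightarrow> x = y)"
  using g
proof (induction "card {u. f u = v \<and> E (Suc n) g u = u}" arbitrary: g rule: less_induct)
  case less
  let ?Fix = "\<lambda>g. {u. f u = v \<and> E (Suc n) g u = u}"
  have vOm: "v \<in> Om 0" using v Om_subset[of n] by (auto simp: Om_def)
  have fin: "finite (?Fix h)" for h
    using finite_poly_fiber[of p v] degree_ge by (auto intro: finite_subset)
  have lev: "(f ^^ Suc n) u = t" if "f u = v" for u using that v by (simp add: funpow_swap1)
  show ?case
  proof (cases "\<exists>x y. x \<in> ?Fix g \<and> y \<in> ?Fix g \<and> x \<noteq> y")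
    case False
    have "E (Suc n) (linepath t t +++ g) x = E (Suc n) g x" if "f x = v" for x
    proof -
      have c: "supported_below (Suc n) x t (linepath t t)" by (rule constant_supported[OF v(2)])
      then have "loop_in 0 t (linepath t t)" by (simp add: supported_below_def)
      then show ?thesis
        using E_loop_join[of t "linepath t t" g "Suc n" x] less.prems lev[OF that]
          supported_below_fixes_level[OF c lev[OF that]] by simp
    qed
    then show ?thesis
      using False constant_supported[OF v(2), of n v] by (intro exI[of _ "linepath t t"]) auto
  next
    case True
    then obtain x y where xy: "f x = v" "E (Suc n) g x = x" "f y = v" "E (Suc n) g y = y" "x \<noteq> y" by blast
    obtain z where z: "f z = v" "z \<noteq> x" "z \<noteq> y" using third_child[OF vOm] by blast
    obtain h b where h: "acts_below n v b t h" and b: "E 1 b x = z" "E 1 b z = y" "E 1 b y = x"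
      "\<And>u. f u = v \<Longrightarrow> u \<noteq> x \<Longrightarrow> u \<noteq> y \<Longrightarrow> u \<noteq> z \<Longrightarrow> E 1 b u = u"
      using three_cycle_below[OF v xy(1,3) z(1)] xy z by metis
    have lh: "loop_in 0 t h" using h by (simp add: acts_below_def)
    have hb: "E (Suc n) h u = E 1 b u" if "f u = v" for u
    proof -
      have "E (1 + n) h u = (if (f ^^ 1) u = v then E 1 b u else u)"
        using h lev[OF that] unfolding acts_below_def by (metis plus_1_eq_Suc)
      then show ?thesis using that by simp
    qed
    have hg: "E (Suc n) (h +++ g) u = E (Suc n) g (E 1 b u)" if "f u = v" for u
      using E_loop_join[OF lh less.prems lev[OF that]] hb[OF that] by simp
    have "E (Suc n) g z \<noteq> x"
      using E_inj[of g "Suc n" z x] less.prems lev xy z unfolding loop_in_def by metis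
    then have not_x: "E (Suc n) (h +++ g) x \<noteq> x" using hg[OF xy(1)] b by simp
    have not_y: "E (Suc n) (h +++ g) y \<noteq> y" using hg[OF xy(3)] b xy by simp
    have not_z: "E (Suc n) (h +++ g) z \<noteq> z" using hg[OF z(1)] b xy z by simp
    have "?Fix (h +++ g) \<subseteq> ?Fix g - {x}"
    proof
      fix u assume u: "u \<in> ?Fix (h +++ g)"
      then have "u \<noteq> x" "u \<noteq> y" "u \<noteq> z" using not_x not_y not_z by auto
      then show "u \<in> ?Fix g - {x}" using u hg[of u] b(4)[of u] by simp
    qed
    moreover have "x \<in> ?Fix g" using xy by simp
    ultimately have "?Fix (h +++ g) \<subset> ?Fix g" by blast
    then have "card (?Fix (h +++ g)) < card (?Fix g)" using fin psubset_card_mono by blast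
    then obtain k where k: "supported_below n v t k"
      "\<And>x y. f x = v \<Longrightarrow> f y = v \<Longrightarrow> E (Suc n) (k +++ (h +++ g)) x = x \<Longrightarrow>
        E (Suc n) (k +++ (h +++ g)) y = y \<Longrightarrow> x = y"
      using less.hyps loop_in_join[OF lh less.prems] by blast
    have lk: "loop_in 0 t k" using k(1) by (simp add: supported_below_def)
    have "E (Suc n) ((k +++ h) +++ g) u = E (Suc n) (k +++ (h +++ g)) u" if "f u = v" for u
      by (rule E_loop_assoc[OF lk lh less.prems lev[OF that]])
    then show ?thesis
      using k supported_below_join[OF k(1) acts_below_supported[OF h]] by (intro exI[of _ "k +++ h"]) simp
  qed
qed

text \<open>Below \<open>v\<close> the fixed points can be destroyed within two levels: three-cycles leave at most one
  fixed child \<open>u\<close>, three-cycles below \<open>u\<close> leave at most one fixed child \<open>y\<close> of \<open>u\<close>, and a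
  transposition of the children of \<open>u\<close> moves \<open>y\<close>.\<close>

lemma destroy_fixed_points:
  assumes v: "(f ^^ n) v = t" "t \<in> Om 0" and g: "loop_in 0 t g"
  obtains k where "supported_below n v t k"
    "\<And>w. f (f w) = v \<Longrightarrow> E (Suc (Suc n)) (k +++ g) w \<noteq> w"
proof -
  have lev1: "(f ^^ Suc n) u = t" if "f u = v" for u using that v by (simp add: funpow_swap1)
  have lev2: "(f ^^ Suc (Suc n)) w = t" if "f (f w) = v" for w
    using that v by (simp add: funpow_swap1)
  have par: "E (Suc n) h (f w) = f w" if "loop_in 0 t h" "f (f w) = v" "E (Suc (Suc n)) h w = w" for h w
    using E_image[of h 1 "Suc n" w] that lev2[OF that(2)] by (simp add: loop_in_def)
  have loop: "loop_in 0 t k" if "supported_below m x t k" for m x k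
    using that by (simp add: supported_below_def)
  obtain k1 where k1: "supported_below n v t k1"
    "\<And>x y. f x = v \<Longrightarrow> f y = v \<Longrightarrow> E (Suc n) (k1 +++ g) x = x \<Longrightarrow> E (Suc n) (k1 +++ g) y = y \<Longrightarrow> x = y"
    using reduce_fixed_children[OF v g] by metis
  let ?g1 = "k1 +++ g"
  have l1: "loop_in 0 t ?g1" using loop_in_join loop[OF k1(1)] g by blast
  show ?thesis
  proof (cases "\<exists>u. f u = v \<and> E (Suc n) ?g1 u = u")
    case False
    have "E (Suc (Suc n)) ?g1 w \<noteq> w" if "f (f w) = v" for w
      using par[OF l1 that] False that by blast
    then show ?thesis using that k1(1) by blast
  next
    case True
    then obtain u where u: "f u = v" "E (Suc n) ?g1 u = u" by blast
    have uOm: "u \<in> Om 0" using lev1[OF u(1)] v(2) Om_subset[of "Suc n"] by (auto simp: Om_def)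
    obtain k2 where k2: "supported_below (Suc n) u t k2"
      "\<And>x y. f x = u \<Longrightarrow> f y = u \<Longrightarrow> E (Suc (Suc n)) (k2 +++ ?g1) x = x \<Longrightarrow>
        E (Suc (Suc n)) (k2 +++ ?g1) y = y \<Longrightarrow> x = y"
      using reduce_fixed_children[OF lev1[OF u(1)] v(2) l1] by metis
    let ?g2 = "k2 +++ ?g1"
    have l2: "loop_in 0 t ?g2" using loop_in_join loop[OF k2(1)] l1 by blast
    have k2v: "supported_below n v t k2" using supported_below_parent[OF k2(1)] u by simp
    have s12: "supported_below n v t (k2 +++ k1)" by (rule supported_below_join[OF k2v k1(1)])
    have g2: "E (Suc n) ?g2 x = E (Suc n) ?g1 x" if "f x = v" for x
      using E_loop_join[OF loop[OF k2(1)] l1 lev1[OF that]] supported_below_fixes_level[OF k2(1) lev1[OF that]]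
      by simp
    \<comment> \<open>Corrections that leave the action on the children of \<open>v\<close>
      unchanged can leave fixed points only below \<open>u\<close>, whatever they do below the
      siblings of \<open>u\<close>.\<close>
    have only_u: "f w = u" if "f (f w) = v" "E (Suc n) h (f w) = E (Suc n) ?g2 (f w)"
      "loop_in 0 t h" "E (Suc (Suc n)) h w = w" for h w
      using par[OF that(3,1,4)] that(2) g2[OF that(1)] k1(2)[OF that(1) u(1)] u(2) by simp
    show ?thesis
    proof (cases "\<exists>y. f y = u \<and> E (Suc (Suc n)) ?g2 y = y")
      case False
      have "E (Suc (Suc n)) ((k2 +++ k1) +++ g) w \<noteq> w" if w: "f (f w) = v" for w
        using only_u[OF w _ l2] False E_loop_assoc[OF loop[OF k2(1)] loop[OF k1(1)] g lev2[OF w]] by metis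
      then show ?thesis using that s12 by blast
    next
      case True
      then obtain y where y: "f y = u" "E (Suc (Suc n)) ?g2 y = y" by blast
      obtain z where z: "f z = u" "z \<noteq> y" using third_child[OF uOm] by metis
      obtain k3 b where k3: "acts_below n v b t k3" and b: "\<And>x. f x = v \<Longrightarrow> E 1 b x = x"
        "E 2 b y = z" "E 2 b z = y" "\<And>x. f x = u \<Longrightarrow> x \<noteq> y \<Longrightarrow> x \<noteq> z \<Longrightarrow> E 2 b x = x"
        using child_transposition_below[OF v u(1) y(1) z(1)] z(2) by metis
      have s3: "supported_below n v t k3" by (rule acts_below_supported[OF k3])
      let ?g3 = "k3 +++ ?g2"
      have l3: "loop_in 0 t ?g3" using loop_in_join loop[OF s3] l2 by blast
      have k3_1: "E (Suc n) k3 x = x" if "f x = v" for x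
      proof -
        have "E (1 + n) k3 x = (if (f ^^ 1) x = v then E 1 b x else x)"
          using k3 lev1[OF that] unfolding acts_below_def by (metis plus_1_eq_Suc)
        then show ?thesis using that b(1) by simp
      qed
      have k3_2: "E (Suc (Suc n)) k3 x = E 2 b x" if "f x = u" for x
      proof -
        have "f (f x) = v" using that u by simp
        then have "E (2 + n) k3 x = (if (f ^^ 2) x = v then E 2 b x else x)"
          using k3 lev2 unfolding acts_below_def by (metis add_2_eq_Suc)
        then show ?thesis using that u by (simp add: numeral_2_eq_2)
      qed
      have g3: "E (Suc (Suc n)) ?g3 x = E (Suc (Suc n)) ?g2 (E 2 b x)" if "f x = u" for x
        using E_loop_join[OF loop[OF s3] l2 lev2[of x]] k3_2[OF that] that u by simp
      have no_fix: "E (Suc (Suc n)) ?g3 w \<noteq> w" if w: "f (f w) = v" for w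
      proof
        assume fx: "E (Suc (Suc n)) ?g3 w = w"
        have "E (Suc n) ?g3 (f w) = E (Suc n) ?g2 (f w)"
          using E_loop_join[OF loop[OF s3] l2 lev1[OF w]] k3_1[OF w] by simp
        then have wu: "f w = u" using only_u[OF w _ l3 fx] by blast
        have eq: "E (Suc (Suc n)) ?g2 (E 2 b w) = w" using g3[OF wu] fx by simp
        \<comment> \<open>The transposition acts before \<open>?g2\<close>, which fixes
          \<open>y\<close> and no other child of \<open>u\<close>: \<open>y\<close> goes to
          \<open>z\<close> and from there not to \<open>y\<close>, \<open>z\<close> goes to
          \<open>y\<close> and stays there, and the other children were not fixed.\<close>
        consider "w = y" | "w = z" | "w \<noteq> y" "w \<noteq> z" by blast
        then show False
        proof cases
          case 1
          then have "E (Suc (Suc n)) ?g2 z = E (Suc (Suc n)) ?g2 y" using eq b y by simp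
          moreover have "(f ^^ Suc (Suc n)) z = t" "(f ^^ Suc (Suc n)) y = t"
            using lev2 z y u by simp_all
          ultimately show False using E_inj[of ?g2 "Suc (Suc n)" z y] l2 z(2) unfolding loop_in_def by metis
        next
          case 2
          then show False using eq b y z by simp
        next
          case 3
          then have "E (Suc (Suc n)) ?g2 w = w" using eq b(4)[OF wu] by simp
          then show False using k2(2)[OF wu y(1)] y(2) 3 by blast
        qed
      qed
      have "E (Suc (Suc n)) ((k3 +++ (k2 +++ k1)) +++ g) w = E (Suc (Suc n)) ?g3 w" if "f (f w) = v" for w
      proof -
        note l = loop[OF s3] loop[OF k2(1)] loop[OF k1(1)] g lev2[OF that]
        have "E (Suc (Suc n)) ((k3 +++ (k2 +++ k1)) +++ g) w = E (Suc (Suc n)) (k3 +++ ((k2 +++ k1) +++ g)) w"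
          by (rule E_loop_assoc[OF l(1) loop_in_join[OF l(2,3)] l(4,5)])
        also have "\<dots> = E (Suc (Suc n)) ?g3 w"
          using E_loop_join[OF l(1) loop_in_join[OF loop_in_join[OF l(2,3)] l(4)] l(5)]
            E_loop_join[OF l(1) l2 l(5)] E_loop_assoc[OF l(2,3,4) E_loop_fiber[OF l(1,5)]] by simp
        finally show ?thesis .
      qed
      then show ?thesis
        using that[OF supported_below_join[OF s3 s12]] no_fix by simp
    qed
  qed
qed

end

section \<open>Fixed points of actions on trees\<close>

text \<open>The sequence converges, so its losses tend to 0 and the estimate becomes
  \<open>L \<le> 1/M\<close> in the limit. \<open>C\<close> may depend on \<open>M\<close> but not
  on \<open>n\<close>.\<close>

lemma decseq_tendsto_0:
  fixes a :: "nat \<Rightarrow> real"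
  assumes nonneg: "\<And>n. a n \<ge> 0" and dec: "\<And>n. a (Suc n) \<le> a n"
    and loss: "\<And>M. M > 0 \<Longrightarrow> \<exists>C. \<forall>n. a n - 1 / real M \<le> C * (a n - a (Suc n))"
  shows "a \<longlonglongrightarrow> 0"
proof -
  have "decseq a" using dec by (simp add: decseq_Suc_iff)
  then obtain L where L: "a \<longlonglongrightarrow> L" using decseq_convergent[of a 0] nonneg by blast
  have L0: "L \<ge> 0" using LIMSEQ_le_const[OF L] nonneg by blast
  have "L \<le> 1 / real M" if M: "M > 0" for M
  proof -
    obtain C where C: "\<And>n. a n - 1 / real M \<le> C * (a n - a (Suc n))" using loss[OF M] by blast
    have "(\<lambda>n. a n - 1 / real M) \<longlonglongrightarrow> L - 1 / real M" by (intro tendsto_intros L)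
    moreover have "(\<lambda>n. C * (a n - a (Suc n))) \<longlonglongrightarrow> C * (L - L)"
      by (intro tendsto_intros L LIMSEQ_Suc)
    ultimately have "L - 1 / real M \<le> C * (L - L)" using LIMSEQ_le C by blast
    then show ?thesis by simp
  qed
  then have "\<forall>n. L \<le> 1 / real (Suc n)" by (metis zero_less_Suc)
  then have "L \<le> 0" using LIMSEQ_le_const[OF LIMSEQ_inverse_real_of_nat, of L]
    by (auto simp: inverse_eq_divide)
  then show ?thesis using L L0 by simp
qed

lemma card_le_fibers:
  assumes "finite A" "finite B" "f ` A \<subseteq> B" "\<And>b. b \<in> B \<Longrightarrow> card {a \<in> A. f a = b} \<le> C"
  shows "card A \<le> C * card B"
proof -
  have "A = (\<Union>b\<in>B. {a \<in> A. f a = b})" using assms by blast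
  then have "card A \<le> (\<Sum>b\<in>B. card {a \<in> A. f a = b})"
    using card_UN_le[OF assms(2), of "\<lambda>b. {a \<in> A. f a = b}"] by simp
  also have "\<dots> \<le> (\<Sum>b\<in>B. C)" using assms by (intro sum_mono) auto
  finally show ?thesis by (simp add: mult.commute)
qed

text \<open>\<open>par\<close> is the parent map, and \<open>mult g h\<close> acts by \<open>g\<close> first, like the concatenation of loops.\<close>

locale tree_action =
  fixes S :: "nat \<Rightarrow> 'a set" and par :: "'a \<Rightarrow> 'a" and G :: "'g set"
    and mult :: "'g \<Rightarrow> 'g \<Rightarrow> 'g" and inv :: "'g \<Rightarrow> 'g" and act :: "nat \<Rightarrow> 'g \<Rightarrow> 'a \<Rightarrow> 'a" and B :: nat
  assumes S_finite: "finite (S n)" and S_nonempty: "S n \<noteq> {}"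
    and par_S: "w \<in> S (Suc n) \<Longrightarrow> par w \<in> S n"
    and par_surj: "v \<in> S n \<Longrightarrow> \<exists>w\<in>S (Suc n). par w = v"
    and card_grandchildren: "v \<in> S n \<Longrightarrow> card {w \<in> S (Suc (Suc n)). par (par w) = v} \<le> B"
    and mult_G: "g \<in> G \<Longrightarrow> h \<in> G \<Longrightarrow> mult g h \<in> G"
    and inv_G: "g \<in> G \<Longrightarrow> inv g \<in> G"
    and act_S: "g \<in> G \<Longrightarrow> w \<in> S n \<Longrightarrow> act n g w \<in> S n"
    and act_mult: "g \<in> G \<Longrightarrow> h \<in> G \<Longrightarrow> w \<in> S n \<Longrightarrow> act n (mult g h) w = act n h (act n g w)"
    and act_inv: "g \<in> G \<Longrightarrow> w \<in> S n \<Longrightarrow> act n (inv g) (act n g w) = w"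
    and act_par: "g \<in> G \<Longrightarrow> w \<in> S (Suc n) \<Longrightarrow> par (act (Suc n) g w) = act n g (par w)"
    and transitive: "v \<in> S n \<Longrightarrow> w \<in> S n \<Longrightarrow> \<exists>g\<in>G. act n g v = w"
    and destroy: "g \<in> G \<Longrightarrow> v \<in> S n \<Longrightarrow> \<exists>k\<in>G. (\<forall>w\<in>S n. act n k w = w) \<and>
      (\<forall>w\<in>S (Suc (Suc n)). if par (par w) = v then act (Suc (Suc n)) (mult k g) w \<noteq> w
         else act (Suc (Suc n)) k w = w)"
begin

text \<open>Only level \<open>n\<close> is recorded instead of the tree down to it; the action on a
  level determines those above, so the proportions agree.\<close>

definition H :: "nat \<Rightarrow> ('a \<Rightarrow> 'a) set" where
  "H n = (\<lambda>g. restrict (act n g) (S n)) ` G"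

definition Fix :: "nat \<Rightarrow> ('a \<Rightarrow> 'a) \<Rightarrow> 'a set" where
  "Fix n h = {v \<in> S n. h v = v}"

text \<open>On elements of \<open>H (n + 2)\<close> the choice of the vertex above \<open>v\<close> is immaterial.\<close>

definition R :: "nat \<Rightarrow> ('a \<Rightarrow> 'a) \<Rightarrow> 'a \<Rightarrow> 'a" where
  "R n h = restrict (\<lambda>v. par (par (h (SOME w. w \<in> S (Suc (Suc n)) \<and> par (par w) = v)))) (S n)"

lemma G_nonempty: "G \<noteq> {}"
  using S_nonempty[of 0] transitive by fast

lemma H_undefined: "h \<in> H n \<Longrightarrow> w \<notin> S n \<Longrightarrow> h w = undefined"
  by (auto simp: H_def)

lemma H_nonempty: "H n \<noteq> {}"
  using G_nonempty by (simp add: H_def)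

lemma H_finite: "finite (H n)"
proof (rule finite_subset)
  show "H n \<subseteq> S n \<rightarrow>\<^sub>E S n" by (auto simp: H_def act_S)
  show "finite (S n \<rightarrow>\<^sub>E S n)" by (intro finite_PiE S_finite)
qed

lemma card_H_pos: "card (H n) > 0"
  using H_finite H_nonempty card_gt_0_iff by blast

lemma Fix_finite: "finite (Fix n h)"
  by (simp add: Fix_def S_finite)

lemma act_inj: "g \<in> G \<Longrightarrow> v \<in> S n \<Longrightarrow> w \<in> S n \<Longrightarrow> act n g v = act n g w \<Longrightarrow> v = w"
  using act_inv by metis

lemma act_surj:
  assumes "g \<in> G" "w \<in> S n"
  obtains v where "v \<in> S n" "act n g v = w"
proof -
  have "inj_on (act n g) (S n)" using act_inj[OF assms(1)] by (auto intro: inj_onI)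
  moreover have "act n g ` S n \<subseteq> S n" using act_S assms by blast
  ultimately have "act n g ` S n = S n" using endo_inj_surj[OF S_finite] by blast
  then show ?thesis using assms that by (metis imageE)
qed

lemma act_inv': "g \<in> G \<Longrightarrow> w \<in> S n \<Longrightarrow> act n g (act n (inv g) w) = w"
  by (metis act_surj act_inv)

lemma act_par2: "g \<in> G \<Longrightarrow> w \<in> S (Suc (Suc n)) \<Longrightarrow> par (par (act (Suc (Suc n)) g w)) = act n g (par (par w))"
  using act_par par_S by simp

lemma grandchild: "v \<in> S n \<Longrightarrow> \<exists>w. w \<in> S (Suc (Suc n)) \<and> par (par w) = v"
  using par_surj by metis

lemma R_act:
  assumes "g \<in> G"
  shows "R n (restrict (act (Suc (Suc n)) g) (S (Suc (Suc n)))) = restrict (act n g) (S n)"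
proof
  fix v
  show "R n (restrict (act (Suc (Suc n)) g) (S (Suc (Suc n)))) v = restrict (act n g) (S n) v"
  proof (cases "v \<in> S n")
    case True
    then show ?thesis
      using someI_ex[OF grandchild[OF True]] assms by (simp add: R_def act_par2)
  qed (simp add: R_def)
qed

lemma R_par:
  assumes "h \<in> H (Suc (Suc n))" "w \<in> S (Suc (Suc n))"
  shows "par (par (h w)) = R n h (par (par w))"
  using assms by (auto simp: H_def R_act act_par2 par_S)

section \<open>Counting by translations\<close>

definition shift :: "nat \<Rightarrow> 'g \<Rightarrow> ('a \<Rightarrow> 'a) \<Rightarrow> 'a \<Rightarrow> 'a" where
  "shift n k h = restrict (\<lambda>w. h (act n k w)) (S n)"

lemma shift_act:
  assumes "k \<in> G" "g \<in> G"
  shows "shift n k (restrict (act n g) (S n)) = restrict (act n (mult k g)) (S n)"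
  using assms by (auto simp: shift_def act_mult act_S intro!: restrict_ext)

lemma shift_H: "k \<in> G \<Longrightarrow> h \<in> H n \<Longrightarrow> shift n k h \<in> H n"
  by (auto simp: H_def shift_act mult_G)

lemma shift_inj: "k \<in> G \<Longrightarrow> inj_on (shift n k) (H n)"
proof (rule inj_onI)
  fix h h' assume k: "k \<in> G" and h: "h \<in> H n" "h' \<in> H n" and eq: "shift n k h = shift n k h'"
  have "h w = h' w" for w
  proof (cases "w \<in> S n")
    case True
    obtain v where v: "v \<in> S n" "act n k v = w" using act_surj[OF k True] by blast
    then show ?thesis using fun_cong[OF eq, of v] by (simp add: shift_def)
  next
    case False
    then show ?thesis using h H_undefined by metis
  qed
  then show "h = h'" by blast
qed

text \<open>Fibres of the restriction homomorphism are cosets. Translation by \<open>k\<close>,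
  which acts as \<open>g1\<close> followed by the inverse of \<open>g0\<close>, turns elements over
  \<open>h0\<close> into elements over \<open>h1\<close>.\<close>

lemma card_R_fiber_le:
  assumes "h0 \<in> H n" "h1 \<in> H n"
  shows "card {x \<in> H (Suc (Suc n)). R n x = h0} \<le> card {x \<in> H (Suc (Suc n)). R n x = h1}"
proof -
  let ?N = "Suc (Suc n)"
  obtain g0 g1 where g: "g0 \<in> G" "g1 \<in> G" "h0 = restrict (act n g0) (S n)" "h1 = restrict (act n g1) (S n)"
    using assms by (auto simp: H_def)
  define k where "k = mult g1 (inv g0)"
  have k: "k \<in> G" using g by (simp add: k_def mult_G inv_G)
  show ?thesis
  proof (rule card_inj_on_le)
    show "inj_on (shift ?N k) {x \<in> H ?N. R n x = h0}"
      using shift_inj[OF k] by (rule inj_on_subset) auto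
    show "finite {x \<in> H ?N. R n x = h1}" using H_finite by simp
    show "shift ?N k ` {x \<in> H ?N. R n x = h0} \<subseteq> {x \<in> H ?N. R n x = h1}"
    proof clarify
      fix x assume x: "x \<in> H ?N" "h0 = R n x"
      then obtain g' where g': "g' \<in> G" "x = restrict (act ?N g') (S ?N)" by (auto simp: H_def)
      have "R n (shift ?N k x) = restrict (act n (mult k g')) (S n)"
        unfolding g'(2) using k g' by (simp add: shift_act R_act mult_G)
      also have "\<dots> = h1" unfolding g(4)
      proof (rule restrict_ext)
        fix v assume v: "v \<in> S n"
        have kv: "act n k v = act n (inv g0) (act n g1 v)"
          using g v by (simp add: k_def act_mult inv_G)
        have kS: "act n k v \<in> S n" using act_S k v by blast
        have "restrict (act n g') (S n) = restrict (act n g0) (S n)"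
          using x g g' R_act[OF g'(1)] by simp
        then have "act n g' (act n k v) = act n g0 (act n k v)"
          using kS by (metis restrict_apply')
        then show "act n (mult k g') v = act n g1 v"
          using act_mult[OF k g'(1) v] kv act_inv'[OF g(1)] act_S[OF g(2) v] by simp
      qed
      finally show "shift ?N k x \<in> H ?N \<and> R n (shift ?N k x) = h1" using shift_H[OF k x(1)] by simp
    qed
  qed
qed

lemma R_H: "h \<in> H (Suc (Suc n)) \<Longrightarrow> R n h \<in> H n"
  by (auto simp: H_def R_act)

text \<open>All fibres of \<open>R\<close> have the same size, so proportions computed on level
  \<open>n\<close> may be computed two levels further on.\<close>

lemma card_R_vimage:
  "card {x \<in> H (Suc (Suc n)). P (R n x)} * card (H n) = card {h \<in> H n. P h} * card (H (Suc (Suc n)))"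
proof -
  let ?N = "Suc (Suc n)"
  obtain h0 where h0: "h0 \<in> H n" using H_nonempty by blast
  define c where "c = card {x \<in> H ?N. R n x = h0}"
  have c: "card {x \<in> H ?N. R n x = h} = c" if "h \<in> H n" for h
    using card_R_fiber_le[OF that h0] card_R_fiber_le[OF h0 that] by (simp add: c_def)
  have gen: "card {x \<in> H ?N. Q (R n x)} = card {h \<in> H n. Q h} * c" for Q
  proof -
    have "{x \<in> H ?N. Q (R n x)} = (\<Union>h\<in>{h \<in> H n. Q h}. {x \<in> H ?N. R n x = h})"
      using R_H by auto
    then have "card {x \<in> H ?N. Q (R n x)} = (\<Sum>h\<in>{h \<in> H n. Q h}. card {x \<in> H ?N. R n x = h})"
      using H_finite by (simp only:) (rule card_UN_disjoint; auto)
    also have "\<dots> = (\<Sum>h\<in>{h \<in> H n. Q h}. c)" using c by (intro sum.cong) auto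
    finally show ?thesis by simp
  qed
  show ?thesis using gen[of P] gen[of "\<lambda>_. True"] by simp
qed

text \<open>Burnside: a transitive action has one fixed point on average.\<close>

lemma sum_card_Fix_le: "(\<Sum>h\<in>H n. card (Fix n h)) \<le> card (H n)"
proof -
  obtain v0 where v0: "v0 \<in> S n" using S_nonempty by blast
  have "(\<Sum>h\<in>H n. card (Fix n h)) = (\<Sum>h\<in>H n. \<Sum>v\<in>S n. if h v = v then 1 else 0)"
    by (intro sum.cong) (auto simp: Fix_def sum.If_cases S_finite Int_def)
  also have "\<dots> = (\<Sum>v\<in>S n. \<Sum>h\<in>H n. if h v = v then 1 else 0)" by (rule sum.swap)
  also have "\<dots> = (\<Sum>v\<in>S n. card {h \<in> H n. h v = v})"
    by (intro sum.cong) (auto simp: sum.If_cases H_finite Int_def)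
  \<comment> \<open>Translation by an element carrying \<open>v0\<close> to \<open>v\<close> embeds
    the stabiliser of \<open>v\<close> into the elements that map \<open>v0\<close> to
    \<open>v\<close>; for distinct \<open>v\<close> these sets are disjoint.\<close>
  also have "\<dots> \<le> (\<Sum>v\<in>S n. card {h \<in> H n. h v0 = v})"
  proof (rule sum_mono)
    fix v assume v: "v \<in> S n"
    obtain k where k: "k \<in> G" "act n k v0 = v" using transitive[OF v0 v] by blast
    show "card {h \<in> H n. h v = v} \<le> card {h \<in> H n. h v0 = v}"
    proof (rule card_inj_on_le)
      show "inj_on (shift n k) {h \<in> H n. h v = v}"
        using shift_inj[OF k(1)] by (rule inj_on_subset) auto
      show "shift n k ` {h \<in> H n. h v = v} \<subseteq> {h \<in> H n. h v0 = v}"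
        using shift_H[OF k(1)] k v0 by (auto simp: shift_def)
    qed (simp add: H_finite)
  qed
  also have "\<dots> = card (\<Union>v\<in>S n. {h \<in> H n. h v0 = v})"
    using S_finite H_finite by (subst card_UN_disjoint) auto
  also have "\<dots> \<le> card (H n)" using H_finite by (intro card_mono) auto
  finally show ?thesis .
qed

text \<open>Markov's inequality for the number of fixed points.\<close>

lemma card_many_fixed_le: "M * card {h \<in> H n. M \<le> card (Fix n h)} \<le> card (H n)"
proof -
  have "M * card {h \<in> H n. M \<le> card (Fix n h)} = (\<Sum>h\<in>{h \<in> H n. M \<le> card (Fix n h)}. M)" by simp
  also have "\<dots> \<le> (\<Sum>h\<in>{h \<in> H n. M \<le> card (Fix n h)}. card (Fix n h))" by (intro sum_mono) auto
  also have "\<dots> \<le> (\<Sum>h\<in>H n. card (Fix n h))" using H_finite by (intro sum_mono2) auto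
  also have "\<dots> \<le> card (H n)" by (rule sum_card_Fix_le)
  finally show ?thesis .
qed

text \<open>One vertex of \<open>W\<close> is treated at a time. The correction \<open>k\<close> is
  chosen for the element already modified, and since it acts first and fixes everything not below
  \<open>v\<close>, earlier corrections survive.\<close>

lemma destroy_all:
  assumes g: "g \<in> G" and W: "finite W" "W \<subseteq> S n"
  shows "\<exists>g'\<in>G. (\<forall>v\<in>S n. act n g' v = act n g v) \<and>
    (\<forall>w\<in>S (Suc (Suc n)). if par (par w) \<in> W then act (Suc (Suc n)) g' w \<noteq> w
       else act (Suc (Suc n)) g' w = act (Suc (Suc n)) g w)"
  using W
proof (induction rule: finite_induct)
  case empty
  then show ?case using g by auto
next
  case (insert v W)
  let ?N = "Suc (Suc n)"
  obtain g' where g': "g' \<in> G" "\<forall>v\<in>S n. act n g' v = act n g v"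
    "\<forall>w\<in>S ?N. if par (par w) \<in> W then act ?N g' w \<noteq> w else act ?N g' w = act ?N g w"
    using insert by auto
  obtain k where k: "k \<in> G" "\<forall>w\<in>S n. act n k w = w"
    "\<forall>w\<in>S ?N. if par (par w) = v then act ?N (mult k g') w \<noteq> w else act ?N k w = w"
    using destroy[OF g'(1), of v n] insert.prems by auto
  show ?case
  proof (intro bexI[of _ "mult k g'"] conjI ballI)
    show "mult k g' \<in> G" using k g' mult_G by blast
    show "act n (mult k g') v = act n g v" if "v \<in> S n" for v
      using that k g' by (simp add: act_mult)
    show "if par (par w) \<in> insert v W then act ?N (mult k g') w \<noteq> w
      else act ?N (mult k g') w = act ?N g w" if w: "w \<in> S ?N" for w
    proof (cases "par (par w) = v")
      case True
      then show ?thesis using k(3) w by simp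
    next
      case False
      then have "act ?N (mult k g') w = act ?N g' w" using k w g' act_mult[of k g' w ?N] by simp
      then show ?thesis using False g'(3) w by simp
    qed
  qed
qed

text \<open>A fixed point two levels down lies below a vertex fixed on level \<open>n\<close>, so it
  is enough to apply \<open>destroy_all\<close> to these vertices.\<close>

lemma exists_fixed_point_free:
  assumes h: "h \<in> H (Suc (Suc n))"
  obtains h' where "h' \<in> H (Suc (Suc n))" "R n h' = R n h" "Fix (Suc (Suc n)) h' = {}"
    "\<And>w. par (par w) \<notin> Fix n (R n h) \<Longrightarrow> h' w = h w"
proof -
  let ?N = "Suc (Suc n)"
  obtain g where g: "g \<in> G" "h = restrict (act ?N g) (S ?N)" using h by (auto simp: H_def)
  let ?W = "Fix n (R n h)"
  have Wsub: "?W \<subseteq> S n" by (auto simp: Fix_def)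
  obtain g' where g': "g' \<in> G" "\<forall>v\<in>S n. act n g' v = act n g v"
    "\<forall>w\<in>S ?N. if par (par w) \<in> ?W then act ?N g' w \<noteq> w else act ?N g' w = act ?N g w"
    using destroy_all[OF g(1) Fix_finite Wsub] by blast
  let ?h = "restrict (act ?N g') (S ?N)"
  show ?thesis
  proof (rule that)
    show h': "?h \<in> H ?N" using g' by (auto simp: H_def)
    show R: "R n ?h = R n h"
      using g' g by (auto simp: R_act intro!: restrict_ext)
    show "?h w = h w" if "par (par w) \<notin> ?W" for w using that g'(3) g by auto
    show "Fix ?N ?h = {}"
    proof -
      have False if w: "w \<in> S ?N" "?h w = w" for w
      proof -
        have "R n h (par (par w)) = par (par w)" using R_par[OF h' w(1)] w(2) R by simp
        moreover have "par (par w) \<in> S n" using w(1) par_S by blast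
        ultimately have "par (par w) \<in> ?W" by (simp add: Fix_def)
        then show False using g'(3) w by auto
      qed
      then show ?thesis by (auto simp: Fix_def)
    qed
  qed
qed

text \<open>An element is changed only above its fewer than \<open>M\<close> fixed vertices, hence at no more than \<open>M * B\<close>
  vertices two levels further down; this bounds the number of elements with the same modification.\<close>

lemma card_few_fixed_le:
  shows "card {h \<in> H (Suc (Suc n)). Fix n (R n h) \<noteq> {} \<and> card (Fix n (R n h)) < M} \<le>
    (M * B) ^ (M * B) * card {h \<in> H (Suc (Suc n)). Fix n (R n h) \<noteq> {} \<and> Fix (Suc (Suc n)) h = {}}"
    (is "card ?A \<le> _ * card ?B")
proof -
  let ?N = "Suc (Suc n)"
  have "\<forall>h\<in>H ?N. \<exists>h'. h' \<in> H ?N \<and> R n h' = R n h \<and> Fix ?N h' = {} \<and>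
    (\<forall>w. par (par w) \<notin> Fix n (R n h) \<longrightarrow> h' w = h w)"
    using exists_fixed_point_free by metis
  then obtain F where F: "\<And>h. h \<in> H ?N \<Longrightarrow> F h \<in> H ?N \<and> R n (F h) = R n h \<and> Fix ?N (F h) = {} \<and>
    (\<forall>w. par (par w) \<notin> Fix n (R n h) \<longrightarrow> F h w = h w)" by metis
  show ?thesis
  proof (rule card_le_fibers[of _ _ F])
    show "finite ?A" "finite ?B" using H_finite by auto
    show "F ` ?A \<subseteq> ?B" using F by auto
    fix b assume b: "b \<in> ?B"
    let ?W = "Fix n (R n b)"
    define U where "U = {w \<in> S ?N. par (par w) \<in> ?W}"
    have finU: "finite U" using S_finite by (simp add: U_def)
    show "card {a \<in> ?A. F a = b} \<le> (M * B) ^ (M * B)"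
    proof (cases "card ?W < M")
      case False
      then have "{a \<in> ?A. F a = b} = {}" using F by fastforce
      then show ?thesis by (simp only: card.empty)
    next
      case True
      have "U = (\<Union>v\<in>?W. {w \<in> S ?N. par (par w) = v})" by (auto simp: U_def)
      then have "card U \<le> (\<Sum>v\<in>?W. card {w \<in> S ?N. par (par w) = v})"
        using card_UN_le[OF Fix_finite[of n "R n b"], of "\<lambda>v. {w \<in> S ?N. par (par w) = v}"] by simp
      also have "\<dots> \<le> (\<Sum>v\<in>?W. B)" by (intro sum_mono card_grandchildren) (simp add: Fix_def)
      also have "\<dots> \<le> M * B" using True by simp
      finally have cU: "card U \<le> M * B" .
      \<comment> \<open>Nonemptiness of \<open>U\<close> makes the base \<open>M * B\<close> at
        least 1, so that the exponent may be enlarged in the last estimate.\<close>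
      obtain v where v: "v \<in> ?W" using b by blast
      then have "\<exists>w. w \<in> S ?N \<and> par (par w) = v" using grandchild by (simp add: Fix_def)
      then have "U \<noteq> {}" using v by (auto simp: U_def)
      then have cU1: "1 \<le> card U" using finU by (simp add: Suc_leI card_gt_0_iff)
      \<comment> \<open>An element with modification \<open>b\<close> agrees with \<open>b\<close>
        off \<open>U\<close>, and it maps \<open>U\<close> to itself because it fixes the
        grandparents of \<open>U\<close>. So it is determined by a self-map of
        \<open>U\<close>.\<close>
      have "card {a \<in> ?A. F a = b} \<le> card (U \<rightarrow>\<^sub>E U)"
      proof (rule card_inj_on_le)
        show "finite (U \<rightarrow>\<^sub>E U)" using finU by (intro finite_PiE)
        show "(\<lambda>a. restrict a U) ` {a \<in> ?A. F a = b} \<subseteq> U \<rightarrow>\<^sub>E U"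
        proof clarify
          fix a assume a: "a \<in> H ?N" "b = F a"
          have Rb: "R n b = R n a" using F a by simp
          show "restrict a U \<in> U \<rightarrow>\<^sub>E U"
          proof (rule restrict_PiE_iff[THEN iffD2], rule ballI)
            fix w assume w: "w \<in> U"
            then have wS: "w \<in> S ?N" and wW: "par (par w) \<in> ?W" by (auto simp: U_def)
            have "par (par (a w)) = par (par w)" using R_par[OF a(1) wS] wW Rb by (simp add: Fix_def)
            moreover have "a w \<in> S ?N" using a(1) wS act_S by (auto simp: H_def)
            ultimately show "a w \<in> U" using wW by (simp add: U_def)
          qed
        qed
        show "inj_on (\<lambda>a. restrict a U) {a \<in> ?A. F a = b}"
        proof (rule inj_onI)
          fix a a' assume a: "a \<in> {a \<in> ?A. F a = b}" "a' \<in> {a \<in> ?A. F a = b}"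
            and eq: "restrict a U = restrict a' U"
          have off: "x w = b w" if "x \<in> {a \<in> ?A. F a = b}" "par (par w) \<notin> ?W" for x w
            using F[of x] that by auto
          have "a w = a' w" for w
          proof (cases "w \<in> U")
            case True
            then show ?thesis using fun_cong[OF eq, of w] by simp
          next
            case False
            then have "w \<notin> S ?N \<or> par (par w) \<notin> ?W" by (auto simp: U_def)
            then show ?thesis
            proof
              assume "w \<notin> S ?N"
              moreover have "a \<in> H ?N" "a' \<in> H ?N" using a by blast+
              ultimately show ?thesis using H_undefined by metis
            next
              assume "par (par w) \<notin> ?W"
              then show ?thesis using off[OF a(1)] off[OF a(2)] by simp
            qed
          qed
          then show "a = a'" by blast
        qed
      qed
      also have "\<dots> = card U ^ card U" using finU by (simp add: card_PiE)
      also have "\<dots> \<le> (M * B) ^ card U" using cU by (rule power_mono) simp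
      also have "\<dots> \<le> (M * B) ^ (M * B)" by (rule power_increasing[OF cU order_trans[OF cU1 cU]])
      finally show ?thesis .
    qed
  qed
qed

section \<open>Decay of the fixed-point proportion\<close>

definition fpp :: "nat \<Rightarrow> real" where
  "fpp n = real (card {h \<in> H n. Fix n h \<noteq> {}}) / real (card (H n))"

lemma proportion_R:
  "real (card {x \<in> H (Suc (Suc n)). P (R n x)}) / real (card (H (Suc (Suc n)))) =
   real (card {h \<in> H n. P h}) / real (card (H n))"
  using card_R_vimage[where P = P and n = n] card_H_pos[of n] card_H_pos[of "Suc (Suc n)"]
  by (simp add: divide_simps flip: of_nat_mult)

lemma Fix_R:
  assumes "h \<in> H (Suc (Suc n))" "Fix (Suc (Suc n)) h \<noteq> {}"
  shows "Fix n (R n h) \<noteq> {}"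
proof -
  obtain w where w: "w \<in> S (Suc (Suc n))" "h w = w" using assms by (auto simp: Fix_def)
  then have "par (par w) \<in> Fix n (R n h)" using R_par[OF assms(1) w(1)] par_S by (simp add: Fix_def)
  then show ?thesis by blast
qed

text \<open>\<open>fpp n\<close> is counted in \<open>H (Suc (Suc n))\<close> through
  \<open>R\<close>. A fixed point there has a fixed grandparent, so the difference counts the
  elements that lose all their fixed points.\<close>

lemma fpp_step:
  "fpp n - fpp (Suc (Suc n)) =
    real (card {h \<in> H (Suc (Suc n)). Fix n (R n h) \<noteq> {} \<and> Fix (Suc (Suc n)) h = {}}) / real (card (H (Suc (Suc n))))"
proof -
  let ?N = "Suc (Suc n)"
  have "{h \<in> H ?N. Fix n (R n h) \<noteq> {}} =
    {h \<in> H ?N. Fix n (R n h) \<noteq> {} \<and> Fix ?N h = {}} \<union> {h \<in> H ?N. Fix ?N h \<noteq> {}}"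
    using Fix_R by blast
  then have "card {h \<in> H ?N. Fix n (R n h) \<noteq> {}} =
    card {h \<in> H ?N. Fix n (R n h) \<noteq> {} \<and> Fix ?N h = {}} + card {h \<in> H ?N. Fix ?N h \<noteq> {}}"
    using H_finite by (simp only:) (rule card_Un_disjoint; auto)
  moreover have "fpp n = real (card {h \<in> H ?N. Fix n (R n h) \<noteq> {}}) / real (card (H ?N))"
    unfolding fpp_def by (rule proportion_R[symmetric])
  ultimately show ?thesis by (simp add: fpp_def add_divide_distrib)
qed

text \<open>Elements with at least \<open>M\<close> fixed points have proportion at most
  \<open>1/M\<close>. The others are bounded by a constant times those that become fixed-point free,
  which is the loss.\<close>

lemma fpp_loss:
  assumes "M > 0"
  shows "fpp n - 1 / real M \<le> real ((M * B) ^ (M * B)) * (fpp n - fpp (Suc (Suc n)))"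
proof -
  let ?N = "Suc (Suc n)"
  have "{h \<in> H n. Fix n h \<noteq> {}} \<subseteq>
    {h \<in> H n. Fix n h \<noteq> {} \<and> card (Fix n h) < M} \<union> {h \<in> H n. M \<le> card (Fix n h)}" by auto
  then have "card {h \<in> H n. Fix n h \<noteq> {}} \<le>
    card ({h \<in> H n. Fix n h \<noteq> {} \<and> card (Fix n h) < M} \<union> {h \<in> H n. M \<le> card (Fix n h)})"
    using H_finite by (intro card_mono) auto
  also have "\<dots> \<le> card {h \<in> H n. Fix n h \<noteq> {} \<and> card (Fix n h) < M} + card {h \<in> H n. M \<le> card (Fix n h)}"
    by (rule card_Un_le)
  finally have "fpp n \<le> (real (card {h \<in> H n. Fix n h \<noteq> {} \<and> card (Fix n h) < M}) +
      real (card {h \<in> H n. M \<le> card (Fix n h)})) / real (card (H n))"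
    unfolding fpp_def by (intro divide_right_mono) (simp_all flip: of_nat_add)
  also have "\<dots> = real (card {h \<in> H n. Fix n h \<noteq> {} \<and> card (Fix n h) < M}) / real (card (H n)) +
      real (card {h \<in> H n. M \<le> card (Fix n h)}) / real (card (H n))" by (rule add_divide_distrib)
  also have "real (card {h \<in> H n. M \<le> card (Fix n h)}) / real (card (H n)) \<le> 1 / real M"
  proof -
    have "real M * real (card {h \<in> H n. M \<le> card (Fix n h)}) \<le> real (card (H n))"
      using card_many_fixed_le[of M n] by (simp flip: of_nat_mult)
    then show ?thesis using assms card_H_pos[of n] by (simp add: divide_simps mult.commute)
  qed
  also have "real (card {h \<in> H n. Fix n h \<noteq> {} \<and> card (Fix n h) < M}) / real (card (H n)) =
    real (card {h \<in> H ?N. Fix n (R n h) \<noteq> {} \<and> card (Fix n (R n h)) < M}) / real (card (H ?N))"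
    by (rule proportion_R[symmetric])
  also have "\<dots> \<le> real ((M * B) ^ (M * B) * card {h \<in> H ?N. Fix n (R n h) \<noteq> {} \<and> Fix ?N h = {}}) / real (card (H ?N))"
    using card_few_fixed_le[of n M] by (intro divide_right_mono of_nat_mono) simp_all
  also have "\<dots> = real ((M * B) ^ (M * B)) * (fpp n - fpp ?N)" by (simp add: fpp_step)
  finally show ?thesis by simp
qed

lemma fpp_tendsto_0: "fpp \<longlonglongrightarrow> 0"
proof -
  have nonneg: "fpp n \<ge> 0" for n by (simp add: fpp_def)
  have dec: "fpp (Suc (Suc n)) \<le> fpp n" for n using fpp_step[of n] by (smt (verit) divide_nonneg_nonneg of_nat_0_le_iff)
  \<comment> \<open>The loss compares levels \<open>n\<close> and \<open>n + 2\<close>, so even and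
    odd levels are treated as separate sequences.\<close>
  have sub: "(\<lambda>k. fpp (2 * k + i)) \<longlonglongrightarrow> 0" for i
  proof (rule decseq_tendsto_0)
    show "\<exists>C. \<forall>k. fpp (2 * k + i) - 1 / real M \<le> C * (fpp (2 * k + i) - fpp (2 * Suc k + i))"
      if "M > 0" for M
      using fpp_loss[OF that] by (intro exI[of _ "real ((M * B) ^ (M * B))"]) simp
  qed (use nonneg dec in simp_all)
  show ?thesis
  proof (rule LIMSEQ_I)
    fix r :: real assume r: "r > 0"
    obtain a where a: "\<And>k. k \<ge> a \<Longrightarrow> fpp (2 * k) < r" using LIMSEQ_D[OF sub[of 0] r] nonneg by auto
    obtain b where b: "\<And>k. k \<ge> b \<Longrightarrow> fpp (2 * k + 1) < r" using LIMSEQ_D[OF sub[of 1] r] nonneg by auto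
    have "fpp n < r" if "n \<ge> 2 * a + 2 * b" for n
    proof (cases "even n")
      case True
      then obtain k where "n = 2 * k" by blast
      then show ?thesis using a[of k] that by simp
    next
      case False
      then obtain k where "n = 2 * k + 1" by (rule oddE)
      then show ?thesis using b[of k] that by simp
    qed
    then show "\<exists>n0. \<forall>n\<ge>n0. norm (fpp n - 0) < r" using nonneg by auto
  qed
qed

end

section \<open>The iterated monodromy group\<close>

text \<open>Infinity is post-critical, so loops and lifts avoid it, and the plane embeds openly in
  its compactification. Everything thus reduces to paths in the plane.\<close>

lemma pathin_sphere_iff:
  assumes "None \<in> A"
  shows "pathin (subtopology riemann_sphere (- A)) \<gamma> \<longleftrightarrow>
    (\<exists>g. path g \<and> (\<forall>s\<in>{0..1}. \<gamma> s = Some (g s) \<and> Some (g s) \<notin> A))"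
proof
  assume "pathin (subtopology riemann_sphere (- A)) \<gamma>"
  then have cont: "continuous_map (top_of_set {0..1}) riemann_sphere \<gamma>"
    and out: "\<And>s. s \<in> {0..1} \<Longrightarrow> \<gamma> s \<notin> A"
    by (auto simp: pathin_def continuous_map_in_subtopology)
  have Some: "\<gamma> s = Some (the (\<gamma> s))" if "s \<in> {0..1}" for s
    using out[OF that] assms by (cases "\<gamma> s") auto
  have "continuous_map (top_of_set {0..1}) euclidean (\<lambda>s. the (\<gamma> s))"
    unfolding continuous_map_def
  proof (intro conjI allI impI)
    fix U :: "complex set" assume "openin euclidean U"
    then have "openin riemann_sphere (Some ` U)" by (simp add: riemann_sphere_def)
    then have "openin (top_of_set {0..1}) {s \<in> topspace (top_of_set {0..1}). \<gamma> s \<in> Some ` U}"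
      using cont openin_continuous_map_preimage by blast
    moreover have "{s \<in> topspace (top_of_set {0..1}). \<gamma> s \<in> Some ` U} =
      {s \<in> topspace (top_of_set {0..1}). the (\<gamma> s) \<in> U}"
    proof (intro Collect_cong conj_cong refl)
      fix s :: real assume "s \<in> topspace (top_of_set {0..1})"
      then have "\<gamma> s = Some (the (\<gamma> s))" using Some by simp
      then show "\<gamma> s \<in> Some ` U \<longleftrightarrow> the (\<gamma> s) \<in> U" by (metis image_eqI imageE option.sel)
    qed
    ultimately show "openin (top_of_set {0..1}) {s \<in> topspace (top_of_set {0..1}). the (\<gamma> s) \<in> U}" by simp
  qed simp
  then have "path (\<lambda>s. the (\<gamma> s))" by (simp add: path_def)
  then show "\<exists>g. path g \<and> (\<forall>s\<in>{0..1}. \<gamma> s = Some (g s) \<and> Some (g s) \<notin> A)"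
    using Some out by (intro exI[of _ "\<lambda>s. the (\<gamma> s)"]) simp
next
  assume "\<exists>g. path g \<and> (\<forall>s\<in>{0..1}. \<gamma> s = Some (g s) \<and> Some (g s) \<notin> A)"
  then obtain g where g: "path g" "\<And>s. s \<in> {0..1} \<Longrightarrow> \<gamma> s = Some (g s) \<and> Some (g s) \<notin> A" by blast
  have "continuous_map (top_of_set {0..1}) euclidean g" using g(1) by (simp add: path_def)
  then have "continuous_map (top_of_set {0..1}) riemann_sphere (Some \<circ> g)"
    unfolding riemann_sphere_def by (rule continuous_map_compose[OF _ continuous_map_Some])
  then have "continuous_map (top_of_set {0..1}) riemann_sphere \<gamma>"
    by (rule continuous_map_eq) (use g in simp)
  then show "pathin (subtopology riemann_sphere (- A)) \<gamma>"
    using g(2) by (auto simp: pathin_def continuous_map_in_subtopology)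
qed

lemma sphere_map_iterate: "(sphere_map p ^^ n) (Some z) = Some ((poly p ^^ n) z)"
  by (induction n) (auto simp: sphere_map_def)

lemma sphere_map_iterate_infinity: "(sphere_map p ^^ n) None = None"
  by (induction n) (auto simp: sphere_map_def)

text \<open>The order of the root \<open>z\<close> of \<open>p - p(z)\<close> exceeds the order of
  \<open>z\<close> as a root of the derivative by one.\<close>

lemma Some_in_critical_points:
  assumes "degree p > 0"
  shows "Some z \<in> critical_points p \<longleftrightarrow> poly (pderiv p) z = 0"
proof -
  let ?P = "p - [:poly p z:]"
  have P: "?P \<noteq> 0" using assms by (metis degree_pCons_0 eq_iff_diff_eq_0 less_numeral_extra(3))
  have d: "pderiv ?P = pderiv p" by (simp add: pderiv_diff pderiv_pCons)
  have "pderiv p \<noteq> 0" using assms by (simp add: pderiv_eq_0_iff)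
  then show ?thesis
    using order_pderiv[OF P, of z] order_root[of "pderiv p" z]
    by (simp add: critical_points_def local_degree_def d)
qed

context exceptional_poly
begin

lemma deg_pos: "degree p > 0"
  using degree_ge by simp

lemma critical_points_eq: "critical_points p = {None, Some c, Some q}"
proof -
  have "x \<in> critical_points p \<longleftrightarrow> x \<in> {None, Some c, Some q}" for x
    using infinity_in_critical_points[of p] degree_ge Some_in_critical_points[OF deg_pos] critical
    by (cases x) auto
  then show ?thesis by blast
qed

lemma f_c_iterate: "n \<ge> 1 \<Longrightarrow> (f ^^ n) c = 0"
  using zeros[of c] funpow_fixed by (cases n) (auto simp: funpow_swap1)

lemma post_critical_set_eq: "post_critical_set p = {None, Some 0, Some q}"
proof
  show "post_critical_set p \<subseteq> {None, Some 0, Some q}"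
    by (auto simp: post_critical_set_def critical_points_eq sphere_map_iterate
        sphere_map_iterate_infinity f_c_iterate funpow_fixed)
  have "x \<in> post_critical_set p" if "y \<in> critical_points p" "sphere_map p y = x" for x y
    unfolding post_critical_set_def using that by (auto intro!: exI[of _ y] exI[of _ 1])
  moreover have "sphere_map p None = None" "sphere_map p (Some c) = Some 0" "sphere_map p (Some q) = Some q"
    using zeros q_fixed by (simp_all add: sphere_map_def)
  ultimately show "{None, Some 0, Some q} \<subseteq> post_critical_set p"
    unfolding critical_points_eq by blast
qed

lemma zero_exceptional: "exceptional_set p {Some 0}"
proof -
  have "x \<in> sphere_map p -` {Some 0} - critical_points p \<longleftrightarrow> x = Some 0" for x
    using zeros nonzero by (cases x) (auto simp: sphere_map_def critical_points_eq)
  then show ?thesis unfolding exceptional_set_def by blast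
qed

lemma loops_at_iff:
  "\<gamma> \<in> loops_at p (Some t) \<longleftrightarrow> (\<exists>g. loop_in 0 t g \<and> (\<forall>s\<in>{0..1}. \<gamma> s = Some (g s)))"
proof -
  have "\<gamma> \<in> loops_at p (Some t) \<longleftrightarrow>
    (\<exists>g. path g \<and> (\<forall>s\<in>{0..1}. \<gamma> s = Some (g s) \<and> Some (g s) \<notin> post_critical_set p)) \<and> \<gamma> 0 = Some t \<and> \<gamma> 1 = Some t"
    unfolding loops_at_def by (simp add: pathin_sphere_iff post_critical_set_eq)
  also have "\<dots> \<longleftrightarrow> (\<exists>g. loop_in 0 t g \<and> (\<forall>s\<in>{0..1}. \<gamma> s = Some (g s)))"
    by (fastforce simp: loop_in_def path_in_def path_image_def pathstart_def pathfinish_def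
        post_critical_set_eq Om_0)
  finally show ?thesis .
qed

lemma is_lift_iff:
  assumes g: "path_in (Om 0) g" "\<And>s. s \<in> {0..1} \<Longrightarrow> \<gamma> s = Some (g s)"
  shows "is_lift p n \<gamma> h \<longleftrightarrow> (\<exists>h'. lift_of n g h' \<and> (\<forall>s\<in>{0..1}. h s = Some (h' s)))"
proof -
  have N: "None \<in> (sphere_map p ^^ n) -` post_critical_set p"
    by (simp add: sphere_map_iterate_infinity post_critical_set_eq)
  have S: "Some z \<notin> (sphere_map p ^^ n) -` post_critical_set p \<longleftrightarrow> z \<in> Om n" for z
    by (simp add: sphere_map_iterate post_critical_set_eq Om_def)
  show ?thesis
  proof
    assume "is_lift p n \<gamma> h"
    then obtain h' where h': "path h'" "\<forall>s\<in>{0..1}. h s = Some (h' s)"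
      and l: "\<forall>s\<in>{0..1}. (sphere_map p ^^ n) (h s) = \<gamma> s"
      unfolding is_lift_def pathin_sphere_iff[OF N] by blast
    have "(f ^^ n) (h' s) = g s" if "s \<in> {0..1}" for s
    proof -
      have "Some ((f ^^ n) (h' s)) = Some (g s)"
        using l h'(2) g(2) that sphere_map_iterate[of n p "h' s"] by metis
      then show ?thesis by simp
    qed
    then show "\<exists>h'. lift_of n g h' \<and> (\<forall>s\<in>{0..1}. h s = Some (h' s))"
      using h' by (auto simp: lift_of_def)
  next
    assume "\<exists>h'. lift_of n g h' \<and> (\<forall>s\<in>{0..1}. h s = Some (h' s))"
    then obtain h' where h': "lift_of n g h'" "\<And>s. s \<in> {0..1} \<Longrightarrow> h s = Some (h' s)" by blast
    have "path_in (Om n) h'" using lift_path_in[OF g(1) h'(1)] by simp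
    then have "path h'" "\<And>s. s \<in> {0..1} \<Longrightarrow> Some (h' s) \<notin> (sphere_map p ^^ n) -` post_critical_set p"
      using S path_in_image by (auto simp: path_in_def)
    moreover have "(sphere_map p ^^ n) (h s) = \<gamma> s" if "s \<in> {0..1}" for s
      using h' g(2) that by (simp add: sphere_map_iterate lift_of_def)
    ultimately show "is_lift p n \<gamma> h"
      unfolding is_lift_def pathin_sphere_iff[OF N] using h'(2) by blast
  qed
qed

lemma lift_endpoint_eq:
  assumes g: "path_in (Om 0) g" "\<And>s. s \<in> {0..1} \<Longrightarrow> \<gamma> s = Some (g s)" and w: "(f ^^ n) w = pathstart g"
  shows "lift_endpoint p n \<gamma> (Some w) = Some (E n g w)"
  unfolding lift_endpoint_def
proof (rule the_equality)
  obtain h where h: "lift_of n g h" "pathstart h = w" using lift_exists[OF g(1) w] by blast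
  have "is_lift p n \<gamma> (\<lambda>s. Some (h s))" using is_lift_iff[OF g] h(1) by blast
  moreover have "h 1 = E n g w" using E_lift[OF g(1) h(1)] h(2) by (simp add: pathfinish_def)
  ultimately show "\<exists>h. is_lift p n \<gamma> h \<and> h 0 = Some w \<and> h 1 = Some (E n g w)"
    using h(2) by (intro exI[of _ "\<lambda>s. Some (h s)"]) (simp add: pathstart_def)
next
  fix z assume "\<exists>h. is_lift p n \<gamma> h \<and> h 0 = Some w \<and> h 1 = z"
  then obtain h where h: "is_lift p n \<gamma> h" "h 0 = Some w" "h 1 = z" by blast
  obtain h' where h': "lift_of n g h'" "\<And>s. s \<in> {0..1} \<Longrightarrow> h s = Some (h' s)"
    using is_lift_iff[OF g, of n h] h(1) by blast
  have "pathstart h' = w" "Some (pathfinish h') = z"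
    using h h'(2)[of 0] h'(2)[of 1] by (simp_all add: pathstart_def pathfinish_def)
  then show "z = Some (E n g w)" using E_lift[OF g(1) h'(1)] by simp
qed

lemma monodromy_eq:
  assumes "loop_in 0 t g" "\<And>s. s \<in> {0..1} \<Longrightarrow> \<gamma> s = Some (g s)" "(f ^^ n) w = t"
  shows "monodromy p (Some t) \<gamma> (n, Some w) = (n, Some (E n g w))"
  using lift_endpoint_eq[of g \<gamma> n w] assms
  by (simp add: monodromy_def preimage_tree_def sphere_map_iterate loop_in_def)

lemma verts_preimage_tree: "x \<in> verts (preimage_tree p (Some t)) \<longleftrightarrow> (\<exists>n w. x = (n, Some w) \<and> (f ^^ n) w = t)"
proof -
  have "(sphere_map p ^^ n) y = Some t \<longleftrightarrow> (\<exists>w. y = Some w \<and> (f ^^ n) w = t)" for n y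
    by (cases y) (auto simp: sphere_map_iterate sphere_map_iterate_infinity)
  then show ?thesis by (cases x) (simp add: preimage_tree_def)
qed

lemma level_preimage_tree_Some:
  "x \<in> level (preimage_tree p (Some t)) n \<longleftrightarrow> (\<exists>w. x = (n, Some w) \<and> (f ^^ n) w = t)"
proof -
  have "(sphere_map p ^^ n) y = Some t \<longleftrightarrow> (\<exists>w. y = Some w \<and> (f ^^ n) w = t)" for y
    by (cases y) (auto simp: sphere_map_iterate sphere_map_iterate_infinity)
  then show ?thesis by (cases x) (auto simp: level_preimage_tree)
qed

lemma truncation_preimage_tree:
  "x \<in> truncation (preimage_tree p (Some t)) n \<longleftrightarrow> (\<exists>k w. x = (k, Some w) \<and> k \<le> n \<and> (f ^^ k) w = t)"
proof -
  have "depth (preimage_tree p (Some t)) (k, Some w) = k" if "(f ^^ k) w = t" for k w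
    using level_preimage_tree_Some[of "(k, Some w)" t k] that by (simp add: level_def)
  then show ?thesis by (auto simp: truncation_def verts_preimage_tree)
qed

end

context exceptional_discs
begin

text \<open>The loops themselves serve as group elements. They do not form a group under joining,
  which is why \<open>tree_action\<close> states the group laws only for the action.\<close>

lemma tree_action_loops:
  assumes t: "t \<in> Om 0"
  shows "tree_action (\<lambda>n. {w. (f ^^ n) w = t}) f {g. loop_in 0 t g} (+++) reversepath E (degree p * degree p)"
proof unfold_locales
  have fibOm: "w \<in> Om n" if "(f ^^ n) w = t" for n w using t that by (auto simp: Om_def)
  show "finite {w. (f ^^ n) w = t}" for n
    using finite_iterate_vimage[of "{t}" n] by (simp add: vimage_def)
  show "{w. (f ^^ n) w = t} \<noteq> {}" for n using surj_iterate[of n t] by auto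
  show "f w \<in> {w. (f ^^ n) w = t}" if "w \<in> {w. (f ^^ Suc n) w = t}" for w n
    using that by (simp add: funpow_swap1)
  show "\<exists>w\<in>{w. (f ^^ Suc n) w = t}. f w = v" if "v \<in> {w. (f ^^ n) w = t}" for v n
    using surj_iterate[of 1 v] that by (auto simp: funpow_swap1)
  show "card {w \<in> {w. (f ^^ Suc (Suc n)) w = t}. f (f w) = v} \<le> degree p * degree p"
    if v: "v \<in> {w. (f ^^ n) w = t}" for v n
  proof -
    have v0: "v \<in> Om 0" using fibOm v Om_subset by blast
    have fin: "finite {u. f u = x}" for x by (rule finite_poly_fiber[OF deg_pos])
    have "{w \<in> {w. (f ^^ Suc (Suc n)) w = t}. f (f w) = v} \<subseteq> (\<Union>u\<in>{u. f u = v}. {w. f w = u})" by auto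
    then have "card {w \<in> {w. (f ^^ Suc (Suc n)) w = t}. f (f w) = v} \<le> card (\<Union>u\<in>{u. f u = v}. {w. f w = u})"
      using fin by (intro card_mono) auto
    also have "\<dots> \<le> (\<Sum>u\<in>{u. f u = v}. card {w. f w = u})" by (rule card_UN_le[OF fin])
    also have "\<dots> = (\<Sum>u\<in>{u. f u = v}. degree p)"
    proof (rule sum.cong[OF refl])
      fix u assume "u \<in> {u. f u = v}"
      then have "u \<in> Om (Suc 0)" using v0 by (simp add: mem_Om_Suc)
      then have "u \<in> Om 0" using Om_subset by blast
      then show "card {w. f w = u} = degree p" by (rule card_fiber)
    qed
    also have "\<dots> = degree p * degree p" using card_fiber[OF v0] by simp
    finally show ?thesis .
  qed
  show "g +++ h \<in> {g. loop_in 0 t g}" if "g \<in> {g. loop_in 0 t g}" "h \<in> {g. loop_in 0 t g}" for g h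
    using that by (simp add: loop_in_join)
  show "reversepath g \<in> {g. loop_in 0 t g}" if "g \<in> {g. loop_in 0 t g}" for g using that by simp
  show "E n g w \<in> {w. (f ^^ n) w = t}" if "g \<in> {g. loop_in 0 t g}" "w \<in> {w. (f ^^ n) w = t}" for n g w
    using that E_loop_fiber by simp
  show "E n (g +++ h) w = E n h (E n g w)"
    if "g \<in> {g. loop_in 0 t g}" "h \<in> {g. loop_in 0 t g}" "w \<in> {w. (f ^^ n) w = t}" for n g h w
    using that E_loop_join by simp
  show "E n (reversepath g) (E n g w) = w" if "g \<in> {g. loop_in 0 t g}" "w \<in> {w. (f ^^ n) w = t}" for n g w
    using that E_loop_reverse by simp
  show "f (E (Suc n) g w) = E n g (f w)" if "g \<in> {g. loop_in 0 t g}" "w \<in> {w. (f ^^ Suc n) w = t}" for n g w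
    using that E_image[of g 1 n w] by (simp add: loop_in_def)
  \<comment> \<open>Any path in the connected set \<open>Om n\<close> between two points over
    \<open>t\<close> projects to a loop at \<open>t\<close>.\<close>
  show "\<exists>g\<in>{g. loop_in 0 t g}. E n g v = w" if "v \<in> {w. (f ^^ n) w = t}" "w \<in> {w. (f ^^ n) w = t}" for n v w
  proof -
    have vw: "v \<in> Om n" "w \<in> Om n" using that fibOm by auto
    obtain h where h: "path h" "path_image h \<subseteq> Om n" "pathstart h = v" "pathfinish h = w"
      using path_connected_Om[of n] vw unfolding path_connected_def by meson
    then have hOm: "path_in (Om (0 + n)) h" by (simp add: path_in_def)
    have g: "path_in (Om 0) ((f ^^ n) \<circ> h)" by (rule path_in_iterate[OF hOm])
    then have "loop_in 0 t ((f ^^ n) \<circ> h)"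
      using h that by (simp add: loop_in_def pathstart_compose pathfinish_compose)
    moreover have "E n ((f ^^ n) \<circ> h) v = w" using E_lift[OF g lift_iterate[OF h(1)]] h by simp
    ultimately show ?thesis by blast
  qed
  show "\<exists>k\<in>{g. loop_in 0 t g}. (\<forall>w\<in>{w. (f ^^ n) w = t}. E n k w = w) \<and>
      (\<forall>w\<in>{w. (f ^^ Suc (Suc n)) w = t}. if f (f w) = v then E (Suc (Suc n)) (k +++ g) w \<noteq> w
        else E (Suc (Suc n)) k w = w)"
    if g: "g \<in> {g. loop_in 0 t g}" and v: "v \<in> {w. (f ^^ n) w = t}" for n g v
  proof -
    have v': "(f ^^ n) v = t" and g': "loop_in 0 t g" using v g by auto
    obtain k where k: "supported_below n v t k"
      "\<And>w. f (f w) = v \<Longrightarrow> E (Suc (Suc n)) (k +++ g) w \<noteq> w"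
      using destroy_fixed_points[OF v' t g'] by blast
    have off: "E (Suc (Suc n)) k w = w" if w: "(f ^^ Suc (Suc n)) w = t" "f (f w) \<noteq> v" for w
    proof -
      have "(f ^^ (2 + n)) w = t" "(f ^^ 2) w \<noteq> v" using w by (simp_all add: numeral_2_eq_2)
      then have "E (2 + n) k w = w" using k(1) unfolding supported_below_def by blast
      then show ?thesis by simp
    qed
    have "loop_in 0 t k" using k(1) by (simp add: supported_below_def)
    then show ?thesis using supported_below_fixes_level[OF k(1)] k(2) off
      by (intro bexI[of _ k]) auto
  qed
qed

lemma FPP_IMG_eq_0:
  assumes "t \<in> Om 0"
  shows "FPP (preimage_tree p (Some t)) (IMG p (Some t)) = 0"
proof -
  let ?S = "\<lambda>n. {w. (f ^^ n) w = t}" and ?T = "preimage_tree p (Some t)"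
  interpret tree_action ?S f "{g. loop_in 0 t g}" "(+++)" reversepath E "degree p * degree p"
    by (rule tree_action_loops[OF assms])
  let ?RL = "\<lambda>n. restricted_to_level ?T n (IMG p (Some t))"
  \<comment> \<open>Reads off the permutation of level \<open>n\<close>. Nothing is lost: each
    vertex nearer to the root has a descendant on level \<open>n\<close>, whose image determines its
    own.\<close>
  define \<phi> where "\<phi> n F = restrict (\<lambda>w. the (snd (F (n, Some w)))) (?S n)" for n and F :: "nat \<times> sphere_point \<Rightarrow> nat \<times> sphere_point"
  have RL: "\<exists>g. loop_in 0 t g \<and> (\<forall>k\<le>n. \<forall>w\<in>?S k. F (k, Some w) = (k, Some (E k g w))) \<and> F \<in> extensional (truncation ?T n)"
    if F: "F \<in> ?RL n" for n F
  proof -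
    obtain \<gamma> where \<gamma>: "\<gamma> \<in> loops_at p (Some t)" "F = restrict (monodromy p (Some t) \<gamma>) (truncation ?T n)"
      using F by (auto simp: restricted_to_level_def IMG_def)
    obtain g where g: "loop_in 0 t g" "\<And>s. s \<in> {0..1} \<Longrightarrow> \<gamma> s = Some (g s)"
      using loops_at_iff[of \<gamma> t] \<gamma>(1) by blast
    have "F (k, Some w) = (k, Some (E k g w))" if "k \<le> n" "w \<in> ?S k" for k w
      using monodromy_eq[OF g, of k w] that truncation_preimage_tree[of "(k, Some w)" t n] by (simp add: \<gamma>(2))
    then show ?thesis using g(1) \<gamma>(2) by auto
  qed
  have \<phi>: "\<phi> n F = restrict (E n g) (?S n)"
    if "\<forall>k\<le>n. \<forall>w\<in>?S k. F (k, Some w) = (k, Some (E k g w))" for n F g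
    using that by (auto simp: \<phi>_def intro!: restrict_ext)
  have inj: "inj_on (\<phi> n) (?RL n)" for n
  proof (rule inj_onI)
    fix F F' assume F: "F \<in> ?RL n" "F' \<in> ?RL n" and eq: "\<phi> n F = \<phi> n F'"
    obtain g where g: "loop_in 0 t g" "\<forall>k\<le>n. \<forall>w\<in>?S k. F (k, Some w) = (k, Some (E k g w))"
      "F \<in> extensional (truncation ?T n)" using RL[OF F(1)] by blast
    obtain g' where g': "loop_in 0 t g'" "\<forall>k\<le>n. \<forall>w\<in>?S k. F' (k, Some w) = (k, Some (E k g' w))"
      "F' \<in> extensional (truncation ?T n)" using RL[OF F(2)] by blast
    have En: "E n g w = E n g' w" if "w \<in> ?S n" for w
      using fun_cong[OF eq, of w] that unfolding \<phi>[OF g(2)] \<phi>[OF g'(2)] by simp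
    have Ek: "E k g w = E k g' w" if k: "k \<le> n" "w \<in> ?S k" for k w
    proof -
      obtain m where m: "n = m + k" using k(1) by (metis le_add_diff_inverse2)
      obtain w' where w': "(f ^^ m) w' = w" using surj_iterate by blast
      have "(f ^^ (k + m)) w' = (f ^^ k) ((f ^^ m) w')" by (simp add: funpow_add)
      then have wn: "(f ^^ (m + k)) w' = t" using k(2) unfolding w' by (simp add: add.commute)
      have "E k h w = (f ^^ m) (E n h w')" if h: "loop_in 0 t h" for h
      proof -
        have "path_in (Om 0) h" "(f ^^ (m + k)) w' = pathstart h" using h wn by (simp_all add: loop_in_def)
        from E_image[OF this] show ?thesis unfolding w' m by (rule sym)
      qed
      moreover have "w' \<in> ?S n" using wn unfolding m by simp
      ultimately show ?thesis using En g(1) g'(1) by simp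
    qed
    show "F = F'"
    proof (rule extensionalityI[OF g(3) g'(3)])
      fix x assume "x \<in> truncation ?T n"
      then obtain k w where "x = (k, Some w)" "k \<le> n" "w \<in> ?S k" by (auto simp: truncation_preimage_tree)
      then show "F x = F' x" using g(2) g'(2) Ek by simp
    qed
  qed
  have img: "\<phi> n ` ?RL n = H n" for n
  proof
    show "\<phi> n ` ?RL n \<subseteq> H n"
    proof clarify
      fix F assume "F \<in> ?RL n"
      from RL[OF this] obtain g where g: "loop_in 0 t g" "\<forall>k\<le>n. \<forall>w\<in>?S k. F (k, Some w) = (k, Some (E k g w))"
        by blast
      then show "\<phi> n F \<in> H n" unfolding H_def \<phi>[OF g(2)] by blast
    qed
    show "H n \<subseteq> \<phi> n ` ?RL n"
    proof
      fix h assume "h \<in> H n"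
      then obtain g where g: "loop_in 0 t g" "h = restrict (E n g) (?S n)" by (auto simp: H_def)
      define \<gamma> where "\<gamma> = (\<lambda>s. Some (g s))"
      let ?F = "restrict (monodromy p (Some t) \<gamma>) (truncation ?T n)"
      have "\<gamma> \<in> loops_at p (Some t)" using loops_at_iff[of \<gamma> t] g(1) \<gamma>_def by auto
      then have "?F \<in> ?RL n" by (auto simp: restricted_to_level_def IMG_def)
      moreover have "\<phi> n ?F = h" unfolding g(2)
      proof (rule \<phi>, intro allI impI ballI)
        fix k w assume "k \<le> n" "w \<in> ?S k"
        then show "?F (k, Some w) = (k, Some (E k g w))"
          using monodromy_eq[OF g(1), of \<gamma> k w] truncation_preimage_tree[of "(k, Some w)" t n]
          by (simp add: \<gamma>_def)
      qed
      ultimately show "h \<in> \<phi> n ` ?RL n" by blast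
    qed
  qed
  have fix_iff: "(\<exists>v\<in>level ?T n. F v = v) \<longleftrightarrow> Fix n (\<phi> n F) \<noteq> {}" if "F \<in> ?RL n" for n F
  proof -
    obtain g where g: "\<forall>k\<le>n. \<forall>w\<in>?S k. F (k, Some w) = (k, Some (E k g w))" using RL[OF \<open>F \<in> ?RL n\<close>] by blast
    have "(\<exists>v\<in>level ?T n. F v = v) \<longleftrightarrow> (\<exists>w\<in>?S n. F (n, Some w) = (n, Some w))"
      by (auto simp: level_preimage_tree_Some)
    also have "\<dots> \<longleftrightarrow> (\<exists>w\<in>?S n. E n g w = w)" using g by simp
    also have "\<dots> \<longleftrightarrow> Fix n (\<phi> n F) \<noteq> {}" unfolding \<phi>[OF g] Fix_def by auto
    finally show ?thesis .
  qed
  have "real (card {F \<in> ?RL n. \<exists>v\<in>level ?T n. F v = v}) / real (card (?RL n)) = fpp n" for n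
  proof -
    have "{h \<in> H n. Fix n h \<noteq> {}} = \<phi> n ` {F \<in> ?RL n. \<exists>v\<in>level ?T n. F v = v}"
      unfolding img[of n, symmetric] using fix_iff by auto
    moreover have "inj_on (\<phi> n) {F \<in> ?RL n. \<exists>v\<in>level ?T n. F v = v}"
      using inj by (rule inj_on_subset) auto
    ultimately have "card {h \<in> H n. Fix n h \<noteq> {}} = card {F \<in> ?RL n. \<exists>v\<in>level ?T n. F v = v}"
      by (simp add: card_image)
    moreover have "card (H n) = card (?RL n)" using card_image[OF inj[of n]] img[of n] by simp
    ultimately show ?thesis by (simp add: fpp_def)
  qed
  then have "FPP ?T (IMG p (Some t)) = lim fpp" by (simp add: FPP_def)
  then show ?thesis using limI[OF fpp_tendsto_0] by simp
qed

end

section \<open>An exceptional polynomial of each degree\<close>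

lemma exceptional_poly_exists:
  assumes "d \<ge> 3"
  obtains p c q where "exceptional_poly p c q" "degree p = d"
proof -
  \<comment> \<open>With \<open>e\<close> the exponents d - 1 and d - 2 become
    \<open>Suc (Suc e)\<close> and \<open>Suc e\<close>, the form required for differentiating
    powers.\<close>
  define e where "e = d - 3"
  have d: "d = Suc (Suc (Suc e))" using assms by (simp add: e_def)
  \<comment> \<open>The value with l (1 - q)^(d-1) = 1, which is the condition that q = 1/d be
    fixed.\<close>
  define l :: complex where "l = (of_nat d / of_nat (Suc (Suc e))) ^ Suc (Suc e)"
  define p where "p = smult l ([:0, 1:] * [:1, -1:] ^ Suc (Suc e))"
  define q :: complex where "q = 1 / of_nat d"
  have d0: "of_nat d \<noteq> (0::complex)" using d by (metis of_nat_eq_0_iff nat.distinct(1))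
  have e0: "of_nat (Suc (Suc e)) \<noteq> (0::complex)" by (metis of_nat_eq_0_iff nat.distinct(1))
  have l0: "l \<noteq> 0" using d0 e0 by (simp add: l_def del: of_nat_Suc)
  have deg: "degree p = d"
    using l0 by (simp add: p_def degree_mult_eq degree_power_eq d del: power_Suc)
  have eval: "poly p z = l * (z * (1 - z) ^ Suc (Suc e))" for z
    by (simp add: p_def poly_power del: power_Suc)
  have dp: "pderiv p = smult l ([:1, -1:] ^ Suc e * [:1, - of_nat d:])"
  proof -
    have "poly (pderiv p) z = poly (smult l ([:1, -1:] ^ Suc e * [:1, - of_nat d:])) z" for z
    proof -
      have "poly (pderiv p) z = l * (z * (of_nat (Suc (Suc e)) * (1 - z) ^ Suc e * - 1) + (1 - z) ^ Suc (Suc e))"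
        by (simp add: p_def pderiv_smult pderiv_mult pderiv_power_Suc pderiv_pCons poly_power algebra_simps
            del: power_Suc of_nat_Suc)
      also have "\<dots> = l * ((1 - z) ^ Suc e * (1 - (1 + of_nat (Suc (Suc e))) * z))"
        by (simp add: power_Suc[of _ "Suc e"] algebra_simps del: power_Suc of_nat_Suc)
      also have "1 + of_nat (Suc (Suc e)) = (of_nat d :: complex)" by (simp add: d)
      finally show ?thesis by (simp add: poly_power algebra_simps del: power_Suc of_nat_Suc)
    qed
    then show ?thesis by (simp add: poly_eq_poly_eq_iff[symmetric] fun_eq_iff)
  qed
  have q1: "1 - q = of_nat (Suc (Suc e)) / of_nat d"
    using d0 by (simp add: q_def d field_simps)
  have qd: "1 - of_nat d * q = 0" using d0 by (simp add: q_def)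
  have "exceptional_poly p 1 q"
  proof
    show "degree p \<ge> 3" using deg assms by simp
    show "poly p z = 0 \<longleftrightarrow> z = 0 \<or> z = 1" for z using l0 by (auto simp: eval)
    have "l * (1 - q) ^ Suc (Suc e) = 1"
      unfolding l_def q1 power_mult_distrib[symmetric] using d0 e0 by (simp del: of_nat_Suc)
    then have "poly p q = q * 1" unfolding eval by (metis mult.left_commute)
    then show "poly p q = q" by simp
    show "(1::complex) \<noteq> 0" "q \<noteq> 0" using d0 by (simp_all add: q_def)
    show "poly (pderiv p) z = 0 \<longleftrightarrow> z = 1 \<or> z = q" for z
    proof -
      have "poly (pderiv p) z = l * ((1 - z) ^ Suc e * (1 - of_nat d * z))"
        by (simp add: dp poly_power algebra_simps del: power_Suc)
      moreover have "1 - of_nat d * z = 0 \<longleftrightarrow> z = q" using d0 by (auto simp: q_def field_simps)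
      ultimately show ?thesis using l0 by auto
    qed
    have "pderiv (pderiv p) = smult l ([:1, -1:] ^ Suc e * [:- of_nat d:] + [:1, - of_nat d:] * pderiv ([:1, -1:] ^ Suc e))"
      unfolding dp pderiv_smult pderiv_mult by (simp add: pderiv_pCons)
    then have "poly (pderiv (pderiv p)) q = l * ((1 - q) ^ Suc e * - of_nat d + (1 - of_nat d * q) * poly (pderiv ([:1, -1:] ^ Suc e)) q)"
      by (simp add: poly_power algebra_simps del: power_Suc)
    \<comment> \<open>The factor 1 - d z of the derivative vanishes at \<open>q\<close>, so only the
      term in which it is differentiated remains.\<close>
    also have "\<dots> = - (l * (1 - q) ^ Suc e * of_nat d)" unfolding qd by simp
    finally show "poly (pderiv (pderiv p)) q \<noteq> 0"
      using l0 d0 e0 q1 by (simp del: of_nat_Suc)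
  qed
  then show ?thesis using that deg by blast
qed

theorem theorem2:
  fixes d :: nat
  assumes "d \<ge> 3"
  shows "\<exists>f :: complex poly.
           degree f = d \<and> post_critically_finite f \<and>
           (\<exists>E. card E = 1 \<and> exceptional_set f E) \<and>
           (\<forall>t. t \<notin> post_critical_set f \<longrightarrow> FPP (preimage_tree f t) (IMG f t) = 0)"
proof -
  obtain p c q where p: "exceptional_poly p c q" "degree p = d"
    using exceptional_poly_exists[OF assms] by blast
  interpret exceptional_poly p c q by (rule p(1))
  obtain D V W where discs: "exceptional_discs p c q D V W" using exceptional_discs_exist by blast
  have "FPP (preimage_tree p t) (IMG p t) = 0" if t: "t \<notin> post_critical_set p" for t
  proof -
    obtain z where z: "t = Some z" using t post_critical_set_eq by (cases t) auto
    then have "z \<in> Om 0" using t by (simp add: post_critical_set_eq Om_0)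
    then show ?thesis using exceptional_discs.FPP_IMG_eq_0[OF discs] z by blast
  qed
  moreover have "post_critically_finite p"
    by (simp add: post_critically_finite_def post_critical_set_eq)
  moreover have "card {Some (0::complex)} = 1" by simp
  ultimately show ?thesis using p(2) zero_exceptional by blast
qed

end
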